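(* Let $1\le g<h$ be integers. Suppose $\mathcal{D}_A\subseteq SM(\mathbb{R})^h$ is a bounded real free spectrahedron and suppose that $\mathcal{D}_A(1)$ has a $g$-dimensional face $F$ that is in standard position with respect to $\mathcal{D}_A(1)$. Define $$K=\{X\in SM(\mathbb{R})^g : (X,I,0,\dots,0)\in \mathrm{gr}_{\mathcal{D}_A}(F)\},$$ where for $X\in SM_n(\mathbb{R})^g$ the tuple $(X,I,0,\dots,0)\in SM_n(\mathbb{R})^h$ has first $g$ entries $X_1,\dots,X_g$, entry $g+1$ equal to $I_n$, and the remaining $h-g-1$ entries equal to $0$. Then $K$ is a bounded free spectrahedron. Moreover, for $X\in SM(\mathbb{R})^g$, $$X\in\partial^{\mathrm{free}}K\iff (X,I,0,\dots,0)\in\partial^{\mathrm{free}}\,\mathrm{gr}_{\mathcal{D}_A}(F)\iff (X,I,0,\dots,0)\in\partial^{\mathrm{free}}\mathcal{D}_A .$$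
   Context: All matrices are real. $SM_n(\mathbb{R})^g$ is the set of $g$-tuples of real symmetric $n\times n$ matrices, $SM(\mathbb{R})^g=\bigcup_{n\ge1}SM_n(\mathbb{R})^g$, and for $K\subseteq SM(\mathbb{R})^g$, $K(n)=K\cap SM_n(\mathbb{R})^g$. For a matrix $V$, $V^TXV=(V^TX_1V,\dots,V^TX_gV)$. $X\sim_u Y$ means $U^TXU=Y$ for some real orthogonal matrix $U$. Direct sums of tuples are coordinatewise. A matrix convex combination of elements of $K$ is a finite sum $\sum_{\ell=1}^m V_\ell^TX^\ell V_\ell$ with $X^\ell\in K(n_\ell)$, $V_\ell\in M_{n_\ell\times n}(\mathbb{R})$, $\sum_\ell V_\ell^TV_\ell=I_n$. The matrix convex hull $\mathrm{co}^{\mathrm{mat}}(K)$ is the set of all matrix convex combinations of elements of $K$; $K$ is matrix convex if $K=\mathrm{co}^{\mathrm{mat}}(K)$. $K$ is bounded if there is $C>0$ with $CI-\sum_iX_i^2\succeq0$ for all $X\in K$. For $A\in SM_d(\mathbb{R})^g$, the free spectrahedron $\mathcal{D}_A\subseteq SM(\mathbb{R})^g$ is $\mathcal{D}_A=\{X\in SM(\mathbb{R})^g: L_A(X)\succeq0\}$, where for $X\in SM_n(\mathbb{R})^g$, $L_A(X)=I_{dn}-A_1\otimes X_1-\dots-A_g\otimes X_g$ ($\otimes$ is the Kronecker product). A free spectrahedron is matrix convex. A point $X\in K(n)$ of a matrix convex set $K$ is a free extreme point of $K$ if whenever $X=\sum_{\ell=1}^m V_\ell^TY^\ell V_\ell$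 is a matrix convex combination of $Y^\ell\in K(n_\ell)$ with every $V_\ell\ne0$, then for each $\ell$ either $n_\ell=n$ and $X\sim_uY^\ell$, or $n_\ell>n$ and there is $Z^\ell\in K$ with $X\oplus Z^\ell\sim_uY^\ell$. The set of free extreme points of $K$ is denoted $\partial^{\mathrm{free}}K$. A subset $F$ of a convex set $C\subseteq\mathbb{R}^h$ is a face if whenever $x,y\in C$ and $tx+(1-t)y\in F$ for some $t\in(0,1)$, then $x,y\in F$. The dimension of $F$ is that of its affine hull $\mathrm{aff}(F)$. Standard position: let $C\subset\mathbb{R}^h$ be a closed bounded convex set with $0$ in its interior and $F$ a $g$-dimensional face of $C$. $F$ is in standard position relative to (with respect to) $C$ if (1) $\mathrm{aff}(F)=\{x\in\mathbb{R}^h:x_{g+1}=1\text{ and }x_j=0\text{ for all }j>g+1\}$; (2) the point $(0,\dots,0,1,0,\dots,0)$ with $1$ in position $g+1$ is in the relative interior of $F$; (3) $C\subseteq\{x:x_{g+1}\le1\}$. Graded lift: the matrix affine hull of $F$ is $\mathrm{aff}^{\mathrm{mat}}(F)=\mathrm{co}^{\mathrm{mat}}(\mathrm{aff}(F))\subseteq SM(\mathbb{R})^h$. For a closed matrix convex set $K\subseteq SM(\mathbb{R})^h$ (each $K(n)$ closed) and a face $F$ of $K(1)$, the graded lift of $F$ with respect to $K$ is $\mathrm{gr}_K(F)=\mathrm{aff}^{\mathrm{mat}}(F)\cap K$. *)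

theory Defs
  imports Complex_Main "Jordan_Normal_Form.Matrix" "Jordan_Normal_Form.VS_Connect"
begin

section \<open>Tuples of symmetric matrices\<close>

text \<open>A g-tuple of matrices is a list of length g; its entries are indexed from 0, so the
  i-th entry of the tuple in the usual numbering is \<open>X ! (i - 1)\<close>.\<close>

definition SMn :: "nat \<Rightarrow> nat \<Rightarrow> real mat list set" where
  "SMn g n = {X. n \<ge> 1 \<and> length X = g \<and>
     (\<forall>M \<in> set X. M \<in> carrier_mat n n \<and> transpose_mat M = M)}"

definition msum :: "nat \<Rightarrow> nat \<Rightarrow> nat \<Rightarrow> (nat \<Rightarrow> real mat) \<Rightarrow> real mat" where
  "msum nr nc m M = mat nr nc (\<lambda>(r, c). \<Sum>l<m. M l $$ (r, c))"

definition kron :: "real mat \<Rightarrow> real mat \<Rightarrow> real mat" where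
  "kron A B = mat (dim_row A * dim_row B) (dim_col A * dim_col B)
     (\<lambda>(i, j). A $$ (i div dim_row B, j div dim_col B) * B $$ (i mod dim_row B, j mod dim_col B))"

definition psd :: "nat \<Rightarrow> real mat \<Rightarrow> bool" where
  "psd n M \<longleftrightarrow> M \<in> carrier_mat n n \<and> transpose_mat M = M \<and>
     (\<forall>v \<in> carrier_vec n. v \<bullet> (M *\<^sub>v v) \<ge> 0)"

definition conj_tuple :: "real mat \<Rightarrow> real mat list \<Rightarrow> real mat list" where
  "conj_tuple V X = map (\<lambda>M. transpose_mat V * M * V) X"

text \<open>Orthogonality is \<open>U\<^sup>T U = I\<close>; the predicate \<open>orthogonal_mat\<close> of the library only asks
  for pairwise orthogonal non-zero columns.\<close>

definition orth_equiv :: "nat \<Rightarrow> real mat list \<Rightarrow> real mat list \<Rightarrow> bool" where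
  "orth_equiv n X Y \<longleftrightarrow>
     (\<exists>U \<in> carrier_mat n n. transpose_mat U * U = 1\<^sub>m n \<and> conj_tuple U X = Y)"

definition direct_sum :: "real mat list \<Rightarrow> real mat list \<Rightarrow> real mat list" where
  "direct_sum X Z = map2 (\<lambda>M N. diag_block_mat [M, N]) X Z"

section \<open>Matrix convexity\<close>

text \<open>\<open>mconv_data g K n m k V Y\<close>: the contractions \<open>V 0, \<dots>, V (m - 1)\<close> and the points
  \<open>Y l \<in> K(k l)\<close> are the data of a matrix convex combination of size n, whose value is
  \<open>mconv_value g n m V Y\<close>.\<close>

definition mconv_data ::
  "nat \<Rightarrow> real mat list set \<Rightarrow> nat \<Rightarrow> nat \<Rightarrow> (nat \<Rightarrow> nat) \<Rightarrow> (nat \<Rightarrow> real mat) \<Rightarrow>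
   (nat \<Rightarrow> real mat list) \<Rightarrow> bool" where
  "mconv_data g K n m k V Y \<longleftrightarrow>
     (\<forall>l<m. Y l \<in> K \<inter> SMn g (k l) \<and> V l \<in> carrier_mat (k l) n) \<and>
     msum n n m (\<lambda>l. transpose_mat (V l) * V l) = 1\<^sub>m n"

definition mconv_value ::
  "nat \<Rightarrow> nat \<Rightarrow> nat \<Rightarrow> (nat \<Rightarrow> real mat) \<Rightarrow> (nat \<Rightarrow> real mat list) \<Rightarrow> real mat list" where
  "mconv_value g n m V Y =
     map (\<lambda>i. msum n n m (\<lambda>l. conj_tuple (V l) (Y l) ! i)) [0..<g]"

definition matrix_convex_hull :: "nat \<Rightarrow> real mat list set \<Rightarrow> real mat list set" where
  "matrix_convex_hull g K =
     {mconv_value g n m V Y | n m k V Y. n \<ge> 1 \<and> mconv_data g K n m k V Y}"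

definition bounded_mat_set :: "nat \<Rightarrow> real mat list set \<Rightarrow> bool" where
  "bounded_mat_set g K \<longleftrightarrow> (\<exists>C>0. \<forall>n. \<forall>X \<in> K \<inter> SMn g n.
     psd n (C \<cdot>\<^sub>m 1\<^sub>m n - msum n n g (\<lambda>i. X ! i * X ! i)))"

definition free_extreme_points :: "nat \<Rightarrow> real mat list set \<Rightarrow> real mat list set" where
  "free_extreme_points g K = {X. \<exists>n. X \<in> K \<inter> SMn g n \<and>
     (\<forall>m k V Y. mconv_data g K n m k V Y \<and> (\<forall>l<m. V l \<noteq> 0\<^sub>m (k l) n) \<and>
        X = mconv_value g n m V Y \<longrightarrow>
        (\<forall>l<m. (k l = n \<and> orth_equiv n X (Y l)) \<or>
               (k l > n \<and> (\<exists>Z \<in> K. orth_equiv (k l) (direct_sum X Z) (Y l)))))}"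

section \<open>Free spectrahedra\<close>

definition lin_pencil :: "nat \<Rightarrow> nat \<Rightarrow> nat \<Rightarrow> real mat list \<Rightarrow> real mat list \<Rightarrow> real mat" where
  "lin_pencil g d n A X = 1\<^sub>m (d * n) - msum (d * n) (d * n) g (\<lambda>i. kron (A ! i) (X ! i))"

definition free_spec :: "nat \<Rightarrow> nat \<Rightarrow> real mat list \<Rightarrow> real mat list set" where
  "free_spec g d A = {X. \<exists>n. X \<in> SMn g n \<and> psd (d * n) (lin_pencil g d n A X)}"

definition is_free_spectrahedron :: "nat \<Rightarrow> real mat list set \<Rightarrow> bool" where
  "is_free_spectrahedron g K \<longleftrightarrow> (\<exists>d. \<exists>A \<in> SMn g d. K = free_spec g d A)"

section \<open>Faces and standard position\<close>

text \<open>\<open>\<real>\<^sup>h\<close> is \<open>carrier_vec h\<close>, so that h can be an ordinary natural number; the type-based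
  notions \<open>affine hull\<close>, \<open>aff_dim\<close>, \<open>face_of\<close> and \<open>rel_interior\<close> do not apply to it. A point of \<open>\<real>\<^sup>h\<close> is identified with an h-tuple of 1 x 1 matrices.\<close>

definition tuple_of_vec :: "real vec \<Rightarrow> real mat list" where
  "tuple_of_vec x = map (\<lambda>a. mat 1 1 (\<lambda>_. a)) (list_of_vec x)"

definition level_one :: "nat \<Rightarrow> real mat list set \<Rightarrow> real vec set" where
  "level_one h K = {x \<in> carrier_vec h. tuple_of_vec x \<in> K}"

definition aff_hull :: "nat \<Rightarrow> real vec set \<Rightarrow> real vec set" where
  "aff_hull h F = {vec h (\<lambda>j. \<Sum>l<m. c l * x l $ j) | (m::nat) c x.
     (\<forall>l<m. x l \<in> F) \<and> (\<Sum>l<m. c l) = 1}"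

text \<open>The dimension of a non-empty affine subspace is the linear dimension of its space of
  differences.\<close>

definition has_dim :: "nat \<Rightarrow> real vec set \<Rightarrow> nat \<Rightarrow> bool" where
  "has_dim h F k \<longleftrightarrow> F \<noteq> {} \<and>
     vectorspace.dim class_ring
       (module_vec TYPE(real) h
          \<lparr>carrier := {x - y | x y. x \<in> aff_hull h F \<and> y \<in> aff_hull h F}\<rparr>) = k"

definition rel_int :: "nat \<Rightarrow> real vec set \<Rightarrow> real vec set" where
  "rel_int h F = {x \<in> F. \<exists>\<epsilon>>0. \<forall>y \<in> aff_hull h F. sqrt ((y - x) \<bullet> (y - x)) < \<epsilon> \<longrightarrow> y \<in> F}"

text \<open>Convexity of a face is not required separately. It follows for a face in standard
  position, which contains a relative neighbourhood of one of its points in its affine hull and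
  hence equals \<open>C \<inter> aff(F)\<close>.\<close>

definition is_face :: "real vec set \<Rightarrow> real vec set \<Rightarrow> bool" where
  "is_face C F \<longleftrightarrow> F \<subseteq> C \<and>
     (\<forall>x \<in> C. \<forall>y \<in> C. \<forall>t. 0 < t \<and> t < 1 \<and> t \<cdot>\<^sub>v x + (1 - t) \<cdot>\<^sub>v y \<in> F \<longrightarrow> x \<in> F \<and> y \<in> F)"

text \<open>The distinguished coordinate, number g + 1 in the usual numbering, has index g here.
  The standing assumptions on C (closed, bounded, convex, 0 in the interior) are not part of the
  predicate: they hold for level one of every bounded free spectrahedron.\<close>

definition standard_position :: "nat \<Rightarrow> nat \<Rightarrow> real vec set \<Rightarrow> real vec set \<Rightarrow> bool" where
  "standard_position h g C F \<longleftrightarrow>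
     aff_hull h F = {x \<in> carrier_vec h. x $ g = 1 \<and> (\<forall>j. g < j \<and> j < h \<longrightarrow> x $ j = 0)} \<and>
     unit_vec h g \<in> rel_int h F \<and>
     C \<subseteq> {x \<in> carrier_vec h. x $ g \<le> 1}"

section \<open>Graded lifts\<close>

definition matrix_affine_hull :: "nat \<Rightarrow> real vec set \<Rightarrow> real mat list set" where
  "matrix_affine_hull h F = matrix_convex_hull h (tuple_of_vec ` aff_hull h F)"

definition graded_lift :: "nat \<Rightarrow> real mat list set \<Rightarrow> real vec set \<Rightarrow> real mat list set" where
  "graded_lift h K F = matrix_affine_hull h F \<inter> K"

text \<open>\<open>pad g h n X\<close> is \<open>(X, I\<^sub>n, 0, \<dots>, 0)\<close> with \<open>h - g - 1\<close> zero matrices.\<close>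

definition pad :: "nat \<Rightarrow> nat \<Rightarrow> nat \<Rightarrow> real mat list \<Rightarrow> real mat list" where
  "pad g h n X = X @ [1\<^sub>m n] @ replicate (h - g - 1) (0\<^sub>m n n)"

end

(* An element of the matrix affine hull of F is exactly a tuple (X, I, 0, ..., 0), so K is the
   set of X with B (x) I - sum A_i (x) X_i >= 0, where B = I - A_(g+1) is psd. As the point
   (0, ..., 0, 1, 0, ..., 0) is relatively interior to F, the kernel of B is contained in the
   kernels of A_1, ..., A_g; compressing to an orthonormal basis for B makes the pencil monic.

   For the extreme points only the step from the graded lift to the spectrahedron is hard.
   If (X, I, 0, ..., 0) = sum V_l^T Y^l V_l with Y^l in the spectrahedron, the face property,
   applied to small perturbations that the pencil allows, gives Y_(g+1) V = V and Y_j V = 0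
   for j > g + 1 on the range of each V. Compressing Y^l to the range of V_l gives a
   combination inside the graded lift, so X sits in Y^l as a compression J^T Y^l J with
   J isometric. The off-diagonal block of Y^l must vanish: otherwise a small multiple of it
   would define a dilation of X by one row inside the graded lift, and comparing traces and
   Frobenius norms shows that X is not a direct summand of that dilation. *)

theory Submission
  imports Defs
begin

section \<open>Matrix algebra and the Frobenius inner product\<close>

text \<open>Both hard steps rest on one estimate. Cauchy-Schwarz bounds a cross term of the pencil
  by a product of two diagonal forms, one of which is the corner R of Y at an arbitrary vector w and
  is beyond control. The perturbation of a point of the face needs the pencil P at that point in
  place of R, and the dilation by one row needs B. The exchange is possible because the cross term
  vanishes on the kernel of P or B, and on a complement of that kernel R is at most a multiple of P
  or B. \<open>psd_domination\<close> gives a constant that serves all values of the other argument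
  at once; both step lengths t come from it. No eigenvalues occur: \<open>psd_gram_schmidt\<close>
  yields W with W W^T a generalised inverse, and this gives the monic pencil, completions of
  isometries, ranges of contractions and the domination. Extremality is restated by isometries J
  with Y_i J = J X_i (\<open>embeds\<close>). That condition does not mention the ambient set, so
  the three sets of extreme points can be compared directly.\<close>

lemma mat_assoc:
  fixes A B C :: "real mat"
  assumes "dim_col A = dim_row B" "dim_col B = dim_row C"
  shows "A * B * C = A * (B * C)"
  by (rule assoc_mult_mat[of A "dim_row A" "dim_row B" B "dim_row C" C "dim_col C"])
    (use assms in \<open>auto intro!: carrier_matI\<close>)

lemma mat_transpose_mult:
  fixes A B :: "real mat"
  assumes "dim_col A = dim_row B"
  shows "transpose_mat (A * B) = transpose_mat B * transpose_mat A"
  by (rule transpose_mult[of A "dim_row A" "dim_row B" B "dim_col B"])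
    (use assms in \<open>auto intro!: carrier_matI\<close>)

lemma mat_add_mult:
  fixes A B C :: "real mat"
  assumes "dim_row A = dim_row B" "dim_col A = dim_col B" "dim_col B = dim_row C"
  shows "(A + B) * C = A * C + B * C"
  by (rule add_mult_distrib_mat[of A "dim_row B" "dim_row C" B C "dim_col C"])
    (use assms in \<open>auto intro!: carrier_matI\<close>)

lemma mat_mult_add:
  fixes A B C :: "real mat"
  assumes "dim_row A = dim_row B" "dim_col A = dim_col B" "dim_col C = dim_row B"
  shows "C * (A + B) = C * A + C * B"
  by (rule mult_add_distrib_mat[of C "dim_row C" "dim_row B" A "dim_col B" B])
    (use assms in \<open>auto intro!: carrier_matI\<close>)

lemma mat_minus_mult:
  fixes A B C :: "real mat"
  assumes "dim_row A = dim_row B" "dim_col A = dim_col B" "dim_col B = dim_row C"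
  shows "(A - B) * C = A * C - B * C"
  by (rule minus_mult_distrib_mat[of A "dim_row B" "dim_row C" B C "dim_col C"])
    (use assms in \<open>auto intro!: carrier_matI\<close>)

lemma mat_mult_minus:
  fixes A B C :: "real mat"
  assumes "dim_row A = dim_row B" "dim_col A = dim_col B" "dim_col C = dim_row B"
  shows "C * (A - B) = C * A - C * B"
  by (rule mult_minus_distrib_mat[of C "dim_row C" "dim_row B" A "dim_col B" B])
    (use assms in \<open>auto intro!: carrier_matI\<close>)

lemma mat_smult_mult:
  fixes A B :: "real mat"
  assumes "dim_col A = dim_row B"
  shows "(c \<cdot>\<^sub>m A) * B = c \<cdot>\<^sub>m (A * B)"
  by (rule mult_smult_assoc_mat[of A "dim_row A" "dim_row B" B "dim_col B"])
    (use assms in \<open>auto intro!: carrier_matI\<close>)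

lemma mat_mult_smult:
  fixes A B :: "real mat"
  assumes "dim_col A = dim_row B"
  shows "A * (c \<cdot>\<^sub>m B) = c \<cdot>\<^sub>m (A * B)"
  by (rule mult_smult_distrib[of A "dim_row A" "dim_row B" B "dim_col B"])
    (use assms in \<open>auto intro!: carrier_matI\<close>)

lemma mat_one_mult: "dim_row (A :: real mat) = n \<Longrightarrow> 1\<^sub>m n * A = A"
  by (rule left_mult_one_mat[of A n "dim_col A"]) (auto intro!: carrier_matI)

lemma mat_mult_one: "dim_col (A :: real mat) = n \<Longrightarrow> A * 1\<^sub>m n = A"
  by (rule right_mult_one_mat[of A "dim_row A" n]) (auto intro!: carrier_matI)

lemma mat_zero_mult: "dim_row (A :: real mat) = n \<Longrightarrow> 0\<^sub>m m n * A = 0\<^sub>m m (dim_col A)"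
  by (rule left_mult_zero_mat[of A n "dim_col A"]) (auto intro!: carrier_matI)

lemma mat_mult_zero: "dim_col (A :: real mat) = n \<Longrightarrow> A * 0\<^sub>m n m = 0\<^sub>m (dim_row A) m"
  by (rule right_mult_zero_mat[of A "dim_row A" n]) (auto intro!: carrier_matI)

lemmas mat_ring = mat_assoc mat_transpose_mult mat_one_mult mat_mult_one

lemma index_mult_sum:
  fixes A B :: "real mat"
  assumes "dim_col A = dim_row B" "i < dim_row A" "j < dim_col B"
  shows "(A * B) $$ (i, j) = (\<Sum>l<dim_row B. A $$ (i, l) * B $$ (l, j))"
  using assms by (simp add: scalar_prod_def lessThan_atLeast0)

text \<open>Column vectors are matrices with one column throughout, so this is also their dot
  product, and \<open>ip (1\<^sub>m n) M\<close> is the trace of M. The index ranges are read off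
  the second argument; hence the dimension hypotheses in the rules for the left one.\<close>

definition ip :: "real mat \<Rightarrow> real mat \<Rightarrow> real" where
  "ip M N = (\<Sum>i<dim_row N. \<Sum>a<dim_col N. M $$ (i, a) * N $$ (i, a))"

lemma ip_comm: "dim_row M = dim_row N \<Longrightarrow> dim_col M = dim_col N \<Longrightarrow> ip M N = ip N M"
  by (simp add: ip_def mult.commute)

lemma ip_transpose:
  "dim_row M = dim_row N \<Longrightarrow> dim_col M = dim_col N \<Longrightarrow> ip (transpose_mat M) (transpose_mat N) = ip M N"
  unfolding ip_def by (subst sum.swap) simp

lemma ip_mult_left:
  assumes "dim_row M = dim_row A" "dim_col M = dim_col N" "dim_col A = dim_row N"
  shows "ip M (A * N) = ip (transpose_mat A * M) N"
proof -
  have "ip M (A * N) = (\<Sum>i<dim_row A. \<Sum>a<dim_col N. \<Sum>l<dim_row N. M $$ (i, a) * (A $$ (i, l) * N $$ (l, a)))"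
    using assms unfolding ip_def by (simp del: index_mult_mat(1) add: index_mult_sum sum_distrib_left)
  also have "\<dots> = (\<Sum>i<dim_row A. \<Sum>l<dim_row N. \<Sum>a<dim_col N. M $$ (i, a) * (A $$ (i, l) * N $$ (l, a)))"
    by (intro sum.cong refl sum.swap)
  also have "\<dots> = (\<Sum>l<dim_row N. \<Sum>i<dim_row A. \<Sum>a<dim_col N. M $$ (i, a) * (A $$ (i, l) * N $$ (l, a)))"
    by (rule sum.swap)
  also have "\<dots> = (\<Sum>l<dim_row N. \<Sum>a<dim_col N. \<Sum>i<dim_row A. M $$ (i, a) * (A $$ (i, l) * N $$ (l, a)))"
    by (intro sum.cong refl sum.swap)
  also have "\<dots> = ip (transpose_mat A * M) N"
    using assms unfolding ip_def
    by (simp del: index_mult_mat(1) add: index_mult_sum sum_distrib_left sum_distrib_right mult_ac)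
  finally show ?thesis .
qed

lemma ip_mult_right:
  assumes "dim_row M = dim_row N" "dim_col M = dim_col V" "dim_col N = dim_row V"
  shows "ip M (N * V) = ip (M * transpose_mat V) N"
proof -
  have "ip M (N * V) = ip (transpose_mat M) (transpose_mat V * transpose_mat N)"
    using assms by (subst ip_transpose[symmetric]) (simp_all add: mat_transpose_mult)
  also have "\<dots> = ip (transpose_mat (M * transpose_mat V)) (transpose_mat N)"
    using assms by (subst ip_mult_left) (simp_all add: mat_transpose_mult)
  also have "\<dots> = ip (M * transpose_mat V) N"
    using assms by (subst ip_transpose) simp_all
  finally show ?thesis .
qed

lemma ip_add_right:
  "dim_row N = dim_row N' \<Longrightarrow> dim_col N = dim_col N' \<Longrightarrow> ip M (N + N') = ip M N + ip M N'"
  by (simp add: ip_def sum.distrib algebra_simps)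

lemma ip_minus_right:
  "dim_row N = dim_row N' \<Longrightarrow> dim_col N = dim_col N' \<Longrightarrow> ip M (N - N') = ip M N - ip M N'"
  by (simp add: ip_def sum_subtractf algebra_simps)

lemma ip_add_left:
  "dim_row M = dim_row N \<Longrightarrow> dim_col M = dim_col N \<Longrightarrow> dim_row M' = dim_row N \<Longrightarrow> dim_col M' = dim_col N
   \<Longrightarrow> ip (M + M') N = ip M N + ip M' N"
  by (simp add: ip_def sum.distrib algebra_simps)

lemma ip_minus_left:
  "dim_row M = dim_row N \<Longrightarrow> dim_col M = dim_col N \<Longrightarrow> dim_row M' = dim_row N \<Longrightarrow> dim_col M' = dim_col N
   \<Longrightarrow> ip (M - M') N = ip M N - ip M' N"
  by (simp add: ip_def sum_subtractf algebra_simps)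

lemma ip_smult_right: "ip M (c \<cdot>\<^sub>m N) = c * ip M N"
  by (simp add: ip_def sum_distrib_left mult_ac)

lemma ip_smult_left:
  "dim_row M = dim_row N \<Longrightarrow> dim_col M = dim_col N \<Longrightarrow> ip (c \<cdot>\<^sub>m M) N = c * ip M N"
  by (simp add: ip_def sum_distrib_left mult_ac)

lemma ip_zero_right [simp]: "ip M (0\<^sub>m r c) = 0"
  by (simp add: ip_def)

lemma ip_zero_left [simp]: "dim_row N = r \<Longrightarrow> dim_col N = c \<Longrightarrow> ip (0\<^sub>m r c) N = 0"
  by (simp add: ip_def)

lemma ip_self_nonneg: "0 \<le> ip M M"
  by (simp add: ip_def sum_nonneg)

lemma ip_self_zero: "ip M M = 0 \<Longrightarrow> M = 0\<^sub>m (dim_row M) (dim_col M)"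
proof -
  assume "ip M M = 0"
  hence "\<forall>i<dim_row M. (\<Sum>a<dim_col M. M $$ (i, a) * M $$ (i, a)) = 0"
    unfolding ip_def by (subst (asm) sum_nonneg_eq_0_iff) (auto intro: sum_nonneg)
  hence "\<forall>i<dim_row M. \<forall>a<dim_col M. M $$ (i, a) = 0"
    by (subst (asm) sum_nonneg_eq_0_iff) auto
  thus ?thesis by (intro eq_matI) auto
qed

lemma ip_outer:
  assumes "p \<in> carrier_mat d 1" "q \<in> carrier_mat d 1" "v \<in> carrier_mat k 1" "w \<in> carrier_mat k 1"
  shows "ip (p * transpose_mat v) (q * transpose_mat w) = ip p q * ip v w"
proof -
  have e: "ip p q = (\<Sum>i<d. p $$ (i, 0) * q $$ (i, 0))" "ip v w = (\<Sum>a<k. v $$ (a, 0) * w $$ (a, 0))"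
    using assms by (simp_all add: ip_def)
  have "ip (p * transpose_mat v) (q * transpose_mat w)
      = (\<Sum>i<d. \<Sum>a<k. (p $$ (i, 0) * v $$ (a, 0)) * (q $$ (i, 0) * w $$ (a, 0)))"
    using assms unfolding ip_def by (simp del: index_mult_mat(1) add: index_mult_sum)
  also have "\<dots> = ip p q * ip v w"
    unfolding e by (simp add: sum_product mult_ac)
  finally show ?thesis .
qed

section \<open>Standard basis columns\<close>

definition basis_col :: "nat \<Rightarrow> nat \<Rightarrow> real mat" where
  "basis_col n a = mat n 1 (\<lambda>(i, _). if i = a then 1 else 0)"

lemma basis_col_carrier [simp]: "basis_col n a \<in> carrier_mat n 1" "basis_col n a \<in> carrier_mat n (Suc 0)"
  by (simp_all add: basis_col_def)

lemma basis_col_dim [simp]: "dim_row (basis_col n a) = n" "dim_col (basis_col n a) = Suc 0"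
  by (simp_all add: basis_col_def)

lemma ip_basis_col:
  assumes "a < n" "M \<in> carrier_mat n 1"
  shows "ip (basis_col n a) M = M $$ (a, 0)" "ip M (basis_col n a) = M $$ (a, 0)"
  using assms by (simp_all add: ip_def basis_col_def if_distrib if_distribR sum.delta cong: if_cong)

lemma mult_basis_col:
  assumes "a < dim_col M"
  shows "M * basis_col (dim_col M) a = mat (dim_row M) 1 (\<lambda>(i, _). M $$ (i, a))"
  using assms
  by (intro eq_matI)
    (auto simp: basis_col_def index_mult_sum if_distrib if_distribR sum.delta simp del: index_mult_mat(1) cong: if_cong)

lemma mult_basis_col_index:
  assumes "M \<in> carrier_mat k n" "a < n" "i < k"
  shows "(M * basis_col n a) $$ (i, 0) = M $$ (i, a)"
  using mult_basis_col[of a M] assms by simp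

lemma mat_eq_by_cols:
  assumes "M \<in> carrier_mat k n" "N \<in> carrier_mat k n"
    and "\<And>a. a < n \<Longrightarrow> M * basis_col n a = N * basis_col n a"
  shows "M = N"
proof (rule eq_matI)
  fix i j assume "i < dim_row N" "j < dim_col N"
  thus "M $$ (i, j) = N $$ (i, j)"
    using assms(1,2) assms(3)[of j] mult_basis_col_index[of M k n j i] mult_basis_col_index[of N k n j i]
    by simp
qed (use assms in auto)

text \<open>For c > 0 the minimum, at s = -b/c, equals a - b^2/c. This is the common source of both
  Cauchy-Schwarz inequalities, for a psd matrix and for the form of a pencil.\<close>

lemma quadratic_nonneg_discriminant:
  fixes a b c :: real
  assumes "\<And>s. 0 \<le> a + 2 * s * b + s\<^sup>2 * c"
  shows "b\<^sup>2 \<le> a * c"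
proof (cases "c = 0")
  case True
  show ?thesis
  proof (rule ccontr)
    assume "\<not> ?thesis"
    hence b: "b \<noteq> 0" using True by auto
    \<comment> \<open>If b is nonzero, the affine function a + 2 s b takes every value; this s gives
      -1.\<close>
    have "0 \<le> a + 2 * (-(a + 1) / (2 * b)) * b" using assms[of "-(a + 1) / (2 * b)"] True by simp
    also have "\<dots> = -1" using b by (simp add: field_simps)
    finally show False by simp
  qed
next
  case False
  have c: "c > 0"
  proof (rule ccontr)
    assume "\<not> c > 0"
    hence c: "c < 0" using False by simp
    \<comment> \<open>Large enough that s |c| exceeds |a| + 2 |b|; with s at least 1 the negative
      quadratic term then outweighs the rest.\<close>
    define s where "s = (1 + \<bar>a\<bar> + 2 * \<bar>b\<bar>) / \<bar>c\<bar> + 1"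
    have s1: "s \<ge> 1" by (simp add: s_def)
    have "s * \<bar>c\<bar> = 1 + \<bar>a\<bar> + 2 * \<bar>b\<bar> + \<bar>c\<bar>" using c by (simp add: s_def field_simps)
    hence "s * c < - \<bar>a\<bar> - 2 * \<bar>b\<bar>" using c by (simp add: abs_if split: if_splits)
    hence "s * (s * c) < s * (- \<bar>a\<bar> - 2 * \<bar>b\<bar>)" using s1 by (intro mult_strict_left_mono) auto
    moreover have "s * \<bar>a\<bar> \<ge> \<bar>a\<bar>" using s1 mult_right_mono[of 1 s "\<bar>a\<bar>"] by simp
    moreover have "s * b \<le> s * \<bar>b\<bar>" using s1 by (intro mult_left_mono) auto
    ultimately have "a + 2 * s * b + s\<^sup>2 * c < 0" by (simp add: power2_eq_square algebra_simps)
    thus False using assms[of s] by simp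
  qed
  have "0 \<le> a + 2 * (- b / c) * b + (- b / c)\<^sup>2 * c" by (rule assms)
  also have "\<dots> = a - b\<^sup>2 / c" using c by (simp add: power2_eq_square field_simps)
  finally show ?thesis using c by (simp add: field_simps)
qed

section \<open>Positive semidefinite matrices\<close>

text \<open>Trades the vectors in \<open>psd\<close> for one-column matrices, so that all later
  computations stay within matrix algebra.\<close>

lemma psd_iff_ip:
  "psd n M \<longleftrightarrow> M \<in> carrier_mat n n \<and> transpose_mat M = M \<and>
     (\<forall>v \<in> carrier_mat n 1. 0 \<le> ip v (M * v))"
proof -
  have *: "ip v (M * v) = col v 0 \<bullet> (M *\<^sub>v col v 0)" if "M \<in> carrier_mat n n" "v \<in> carrier_mat n 1" for v
    using that by (simp add: ip_def scalar_prod_def lessThan_atLeast0)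
  have **: "\<exists>u\<in>carrier_mat n 1. v = col u 0" if "v \<in> carrier_vec n" for v :: "real vec"
    using that by (intro bexI[of _ "mat n 1 (\<lambda>(i, _). v $ i)"]) auto
  show ?thesis
  proof (intro iffI conjI ballI)
    fix v :: "real mat" assume "psd n M" and v: "v \<in> carrier_mat n 1"
    thus "0 \<le> ip v (M * v)"
      using *[of v] col_carrier_vec[of 0 1 v n] by (simp add: psd_def)
  next
    assume r: "M \<in> carrier_mat n n \<and> transpose_mat M = M \<and> (\<forall>v \<in> carrier_mat n 1. 0 \<le> ip v (M * v))"
    show "psd n M"
      unfolding psd_def
    proof (intro conjI ballI)
      fix v :: "real vec" assume "v \<in> carrier_vec n"
      then obtain u where u: "u \<in> carrier_mat n 1" "v = col u 0" using ** by blast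
      have "0 \<le> ip u (M * u)" using r u by blast
      thus "0 \<le> v \<bullet> (M *\<^sub>v v)" using *[of u] r u by simp
    qed (use r in auto)
  qed (auto simp: psd_def)
qed

lemma psd_carrier: "psd n M \<Longrightarrow> M \<in> carrier_mat n n"
  and psd_sym: "psd n M \<Longrightarrow> transpose_mat M = M"
  and psd_nonneg: "psd n M \<Longrightarrow> v \<in> carrier_mat n 1 \<Longrightarrow> 0 \<le> ip v (M * v)"
  by (simp_all add: psd_iff_ip)

lemma ip_sym_mult:
  assumes "transpose_mat B = B" "B \<in> carrier_mat d d" "p \<in> carrier_mat d 1" "q \<in> carrier_mat d 1"
  shows "ip q (B * p) = ip p (B * q)"
proof -
  have "ip q (B * p) = ip (B * q) p" using assms by (subst ip_mult_left) auto
  also have "\<dots> = ip p (B * q)" using assms by (intro ip_comm) auto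
  finally show ?thesis .
qed

lemma psd_cauchy_schwarz:
  assumes B: "psd d B" and p: "p \<in> carrier_mat d 1" and q: "q \<in> carrier_mat d 1"
  shows "(ip p (B * q))\<^sup>2 \<le> ip p (B * p) * ip q (B * q)"
proof (rule quadratic_nonneg_discriminant)
  fix s :: real
  note c = psd_carrier[OF B]
  have "0 \<le> ip (p + s \<cdot>\<^sub>m q) (B * (p + s \<cdot>\<^sub>m q))" using p q by (intro psd_nonneg[OF B]) auto
  also have "\<dots> = ip p (B * p) + s * ip p (B * q) + (s * ip q (B * p) + s * s * ip q (B * q))"
    using c p q
    by (simp add: mat_mult_add mat_mult_smult ip_add_left ip_add_right ip_smult_left ip_smult_right algebra_simps)
  also have "ip q (B * p) = ip p (B * q)" by (rule ip_sym_mult[OF psd_sym[OF B] c p q])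
  finally show "0 \<le> ip p (B * p) + 2 * s * ip p (B * q) + s\<^sup>2 * ip q (B * q)"
    by (simp add: power2_eq_square algebra_simps)
qed

text \<open>Cauchy-Schwarz for the pair B q and q bounds |B q|^4 by a multiple of the vanishing
  value at q.\<close>

lemma psd_kernel:
  assumes B: "psd d B" and q: "q \<in> carrier_mat d 1" and z: "ip q (B * q) = 0"
  shows "B * q = 0\<^sub>m d 1"
proof -
  have c: "B * q \<in> carrier_mat d 1" using psd_carrier[OF B] q by auto
  have "ip (B * q) (B * q) = 0"
    using psd_cauchy_schwarz[OF B c q] z by simp
  from ip_self_zero[OF this] show ?thesis using c by (simp only: carrier_matD)
qed

lemma psd_one: "psd n (1\<^sub>m n)"
  by (auto simp: psd_iff_ip mat_one_mult ip_self_nonneg)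

lemma ip_cauchy_schwarz:
  assumes "p \<in> carrier_mat d 1" "q \<in> carrier_mat d 1"
  shows "(ip p q)\<^sup>2 \<le> ip p p * ip q q"
  using psd_cauchy_schwarz[OF psd_one assms] assms by (simp add: mat_one_mult)

lemma inner_col:
  assumes "v \<in> carrier_mat k 1" "w \<in> carrier_mat k 1"
  shows "transpose_mat v * w = ip v w \<cdot>\<^sub>m 1\<^sub>m 1"
  using assms by (intro eq_matI) (auto simp: ip_def index_mult_sum simp del: index_mult_mat(1))

lemma ip_one_one: "ip (1\<^sub>m n) (1\<^sub>m n) = n"
  by (simp add: ip_def if_distrib sum.delta cong: if_cong)

section \<open>Block rows and Gram-Schmidt for a semi-inner product\<close>

definition hcat :: "real mat \<Rightarrow> real mat \<Rightarrow> real mat" where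
  "hcat A B = mat (dim_row A) (dim_col A + dim_col B)
     (\<lambda>(i, j). if j < dim_col A then A $$ (i, j) else B $$ (i, j - dim_col A))"

lemma hcat_carrier [simp]:
  "A \<in> carrier_mat k n \<Longrightarrow> B \<in> carrier_mat k m \<Longrightarrow> hcat A B \<in> carrier_mat k (n + m)"
  by (auto simp: hcat_def)

lemma hcat_dim [simp]: "dim_row (hcat A B) = dim_row A" "dim_col (hcat A B) = dim_col A + dim_col B"
  by (simp_all add: hcat_def)

lemma sum_lessThan_add:
  fixes f :: "nat \<Rightarrow> real"
  shows "(\<Sum>i<n + m. f i) = (\<Sum>i<n. f i) + (\<Sum>i<m. f (n + i))"
  by (induction m) (simp_all add: add.assoc)

lemma mult_hcat:
  assumes "A \<in> carrier_mat k n" "B \<in> carrier_mat k m" "C \<in> carrier_mat l k"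
  shows "C * hcat A B = hcat (C * A) (C * B)"
  using assms by (intro eq_matI) (auto simp: hcat_def index_mult_sum simp del: index_mult_mat(1))

lemma hcat_mult_transpose:
  assumes "A \<in> carrier_mat k n" "B \<in> carrier_mat k m" "C \<in> carrier_mat l n" "D \<in> carrier_mat l m"
  shows "hcat A B * transpose_mat (hcat C D) = A * transpose_mat C + B * transpose_mat D"
  using assms
  by (intro eq_matI) (auto simp: hcat_def index_mult_sum sum_lessThan_add simp del: index_mult_mat(1))

text \<open>Two different block rows, because orthonormality is needed with respect to B: C and D
  will be B A and B times the second block.\<close>

lemma hcat_gram_one:
  assumes "A \<in> carrier_mat k n" "B \<in> carrier_mat k m" "C \<in> carrier_mat k n" "D \<in> carrier_mat k m"
    and "transpose_mat A * C = 1\<^sub>m n" "transpose_mat A * D = 0\<^sub>m n m"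
    and "transpose_mat B * C = 0\<^sub>m m n" "transpose_mat B * D = 1\<^sub>m m"
  shows "transpose_mat (hcat A B) * hcat C D = 1\<^sub>m (n + m)"
proof (rule eq_matI)
  fix i j assume "i < dim_row (1\<^sub>m (n + m) :: real mat)" "j < dim_col (1\<^sub>m (n + m) :: real mat)"
  hence ij: "i < n + m" "j < n + m" by auto
  define a where "a = (\<lambda>l. if i < n then A $$ (l, i) else B $$ (l, i - n))"
  define c where "c = (\<lambda>l. if j < n then C $$ (l, j) else D $$ (l, j - n))"
  have e: "(transpose_mat P * Q) $$ (i', j') = (\<Sum>l<k. P $$ (l, i') * Q $$ (l, j'))"
    if "P \<in> carrier_mat k np" "Q \<in> carrier_mat k nq" "i' < np" "j' < nq" for P Q :: "real mat" and np nq i' j'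
    using that by (simp add: index_mult_sum del: index_mult_mat(1))
  have "(transpose_mat (hcat A B) * hcat C D) $$ (i, j) = (\<Sum>l<k. a l * c l)"
    using assms(1-4) ij by (subst e[of _ "n + m" _ "n + m"]) (auto simp: hcat_def a_def c_def intro!: sum.cong)
  also have "\<dots> = (if i = j then 1 else 0)"
    using e[OF assms(1,3), of i j] e[OF assms(1,4), of i "j - n"] e[OF assms(2,3), of "i - n" j]
      e[OF assms(2,4), of "i - n" "j - n"] ij
    unfolding assms(5-8) a_def c_def
    by (cases "i < n"; cases "j < n") (auto simp: le_diff_iff eq_diff_iff split: if_splits)
  also have "\<dots> = 1\<^sub>m (n + m) $$ (i, j)" using ij by simp
  finally show "(transpose_mat (hcat A B) * hcat C D) $$ (i, j) = 1\<^sub>m (n + m) $$ (i, j)" .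
qed (use assms in auto)

text \<open>Gram-Schmidt on the standard basis for the semi-inner product given by B, discarding
  residuals of length zero. Reproduction of the basis vectors can be asked only after multiplication
  by B, since the semi-inner product does not see the kernel of B.\<close>

lemma psd_partial_gram_schmidt:
  assumes B: "psd d B"
  shows "\<exists>r\<le>k. \<exists>W\<in>carrier_mat d r. transpose_mat W * (B * W) = 1\<^sub>m r \<and>
    (\<forall>j<k. B * (W * (transpose_mat W * (B * basis_col d j))) = B * basis_col d j)"
proof (induction k)
  case 0
  show ?case
    by (intro exI[of _ 0] conjI bexI[of _ "0\<^sub>m d 0"]) auto
next
  case (Suc k)
  then obtain r W where r: "r \<le> k" and W: "W \<in> carrier_mat d r"
    and WBW: "transpose_mat W * (B * W) = 1\<^sub>m r"
    and span: "\<And>j. j < k \<Longrightarrow> B * (W * (transpose_mat W * (B * basis_col d j))) = B * basis_col d j"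
    by blast
  note c = psd_carrier[OF B] and sym = psd_sym[OF B]
  have dims [simp]: "dim_row B = d" "dim_col B = d" "dim_row W = d" "dim_col W = r" using c W by auto
  define e where "e = basis_col d k"
  have [simp]: "dim_row e = d" "dim_col e = 1" and e: "e \<in> carrier_mat d 1" by (simp_all add: e_def)
  \<comment> \<open>The projection of the new basis vector e to the columns of W with respect to B;
    u below is the residual.\<close>
  define z where "z = W * (transpose_mat W * (B * e))"
  have [simp]: "dim_row z = d" "dim_col z = 1" by (simp_all add: z_def)
  define u where "u = e - z"
  have u: "u \<in> carrier_mat d 1" by (auto simp: u_def z_def)
  have [simp]: "dim_row u = d" "dim_col u = 1" using u by auto
  have "transpose_mat W * (B * z) = transpose_mat W * (B * W) * (transpose_mat W * (B * e))"
    by (simp add: z_def mat_assoc)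
  also have "\<dots> = transpose_mat W * (B * e)" unfolding WBW by (simp add: mat_one_mult)
  finally have WBu: "transpose_mat W * (B * u) = 0\<^sub>m r 1"
    by (simp add: u_def mat_mult_minus) (auto intro!: eq_matI)
  have Bu: "B * e = B * z + B * u" by (simp add: u_def mat_mult_minus) (auto intro!: eq_matI)
  show ?case
  proof (cases "ip u (B * u) = 0")
    case True
    \<comment> \<open>A residual of length zero lies in the kernel of B, so W already reproduces B
      e.\<close>
    have "B * u = 0\<^sub>m d 1" by (rule psd_kernel[OF B u True])
    hence "B * z = B * e" using Bu by auto
    thus ?thesis
      using r W WBW span unfolding z_def e_def
      by (intro exI[of _ r] conjI bexI[of _ W]) (auto simp: less_Suc_eq)
  next
    case False
    define s where "s = sqrt (ip u (B * u))"
    have s: "s > 0" "s * s = ip u (B * u)" using False psd_nonneg[OF B u] by (simp_all add: s_def)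
    define w where "w = (1 / s) \<cdot>\<^sub>m u"
    have w: "w \<in> carrier_mat d 1" using u by (simp add: w_def)
    have [simp]: "dim_row w = d" "dim_col w = 1" using w by auto
    have uw: "u = s \<cdot>\<^sub>m w" using s by (intro eq_matI) (auto simp: w_def)
    have "ip w (B * w) = 1" using s(1) s(2)[symmetric]
      by (simp add: w_def mat_mult_smult ip_smult_left ip_smult_right field_simps)
    hence wBw: "transpose_mat w * (B * w) = 1\<^sub>m 1"
      using inner_col[OF w, of "B * w"] c w by (simp del: One_nat_def) (auto intro!: eq_matI)
    have WBw: "transpose_mat W * (B * w) = 0\<^sub>m r 1"
      using WBu by (simp add: w_def mat_mult_smult)
    have wBW: "transpose_mat w * (B * W) = 0\<^sub>m 1 r"
      using arg_cong[OF WBw, of transpose_mat] by (simp add: mat_transpose_mult mat_assoc sym)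
    define W' where "W' = hcat W w"
    have W': "W' \<in> carrier_mat d (Suc r)" using hcat_carrier[OF W w] by (simp add: W'_def)
    have g: "transpose_mat W' * (B * W') = 1\<^sub>m (Suc r)"
      using hcat_gram_one[OF W w mult_carrier_mat[OF c W] mult_carrier_mat[OF c w] WBW WBw wBW wBw]
      by (simp add: W'_def mult_hcat[OF W w c])
    have WW: "W' * (transpose_mat W' * x) = W * (transpose_mat W * x) + w * (transpose_mat w * x)"
      if "dim_row x = d" for x
      using that hcat_mult_transpose[OF W w W w] W'
      by (simp add: mat_assoc[symmetric] mat_add_mult[symmetric] W'_def)
    have "B * (W' * (transpose_mat W' * (B * basis_col d j))) = B * basis_col d j" if "j < Suc k" for j
    proof (cases "j = k")
      case True
      have "transpose_mat w * (B * z) = (transpose_mat w * (B * W)) * (transpose_mat W * (B * e))"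
        by (simp add: z_def mat_assoc)
      also have "\<dots> = 0\<^sub>m 1 1" unfolding wBW by (simp add: mat_zero_mult)
      finally have "transpose_mat w * (B * e) = s \<cdot>\<^sub>m 1\<^sub>m 1"
        unfolding Bu uw using wBw by (simp add: mat_mult_add mat_mult_smult del: One_nat_def)
      hence "w * (transpose_mat w * (B * e)) = u"
        by (simp add: mat_mult_smult mat_mult_one uw)
      hence "B * (W' * (transpose_mat W' * (B * e))) = B * (z + u)"
        by (subst WW) (simp_all add: z_def)
      also have "\<dots> = B * e" by (simp add: mat_mult_add Bu)
      finally show ?thesis using True by (simp add: e_def)
    next
      case False
      hence j: "j < k" using that by simp
      define y where "y = transpose_mat W * (B * basis_col d j)"
      have [simp]: "dim_row y = r" "dim_col y = 1" by (simp_all add: y_def)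
      have "transpose_mat w * (B * basis_col d j) = transpose_mat w * (B * (W * y))"
        using span[OF j] by (simp add: y_def)
      also have "\<dots> = (transpose_mat w * (B * W)) * y" by (simp add: mat_assoc)
      also have "\<dots> = 0\<^sub>m 1 1" unfolding wBW by (simp add: mat_zero_mult)
      finally have "W' * (transpose_mat W' * (B * basis_col d j)) = W * y"
        by (subst WW) (auto simp: y_def mat_mult_zero intro!: eq_matI)
      thus ?thesis using span[OF j] by (simp add: y_def)
    qed
    thus ?thesis using r W' g by (intro exI[of _ "Suc r"] conjI bexI[of _ W']) auto
  qed
qed

text \<open>W W^T is a generalised inverse of B, and r is its rank. This takes the place of the
  spectral theorem.\<close>

lemma psd_gram_schmidt:
  assumes B: "psd d B"
  obtains r W where "r \<le> d" "W \<in> carrier_mat d r" "transpose_mat W * (B * W) = 1\<^sub>m r"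
    "B * (W * (transpose_mat W * B)) = B"
proof -
  obtain r W where r: "r \<le> d" and W: "W \<in> carrier_mat d r"
    and g: "transpose_mat W * (B * W) = 1\<^sub>m r"
    and span: "\<And>j. j < d \<Longrightarrow> B * (W * (transpose_mat W * (B * basis_col d j))) = B * basis_col d j"
    using psd_partial_gram_schmidt[OF B, of d] by blast
  note c = psd_carrier[OF B]
  have "B * (W * (transpose_mat W * B)) = B"
  proof (rule mat_eq_by_cols)
    fix a assume "a < d"
    thus "B * (W * (transpose_mat W * B)) * basis_col d a = B * basis_col d a"
      using span[of a] c W by (simp add: mat_assoc)
  qed (use c W in auto)
  with that r W g show ?thesis by blast
qed

text \<open>Modulo the kernel of B, q equals W y with |y|^2 the value of B at q, so the functional
  is bounded by |y| times the norm of W^T a. That norm is controlled by R on the finitely many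
  columns of W. The constant depends on B and R only, not on a or \<phi>.\<close>

lemma psd_domination:
  assumes B: "psd d B" and R: "psd d R"
  obtains c where "c > 0"
    "\<And>a q \<phi>. a \<in> carrier_mat d 1 \<Longrightarrow> q \<in> carrier_mat d 1 \<Longrightarrow> 0 \<le> \<phi> \<Longrightarrow>
      (\<And>q. q \<in> carrier_mat d 1 \<Longrightarrow> (ip a q)\<^sup>2 \<le> \<phi> * ip q (R * q)) \<Longrightarrow>
      (\<And>q. q \<in> carrier_mat d 1 \<Longrightarrow> B * q = 0\<^sub>m d 1 \<Longrightarrow> ip a q = 0) \<Longrightarrow>
      (ip a q)\<^sup>2 \<le> c * \<phi> * ip q (B * q)"
proof -
  obtain r W where W: "W \<in> carrier_mat d r" and BWB: "B * (W * (transpose_mat W * B)) = B"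
    using psd_gram_schmidt[OF B] by blast
  note cB = psd_carrier[OF B] and cR = psd_carrier[OF R]
  have dims [simp]: "dim_row B = d" "dim_col B = d" "dim_row W = d" "dim_col W = r"
    "dim_row R = d" "dim_col R = d" using cB cR W by auto
  \<comment> \<open>The trace of W^T R W, plus 1 for strict positivity.\<close>
  define c where "c = 1 + (\<Sum>j<r. ip (W * basis_col r j) (R * (W * basis_col r j)))"
  have Wb: "W * basis_col r j \<in> carrier_mat d 1" for j using W by auto
  have S: "0 \<le> (\<Sum>j<r. ip (W * basis_col r j) (R * (W * basis_col r j)))"
    by (intro sum_nonneg psd_nonneg[OF R] Wb)
  show ?thesis
  proof (rule that[of c])
    show "c > 0" using S by (simp add: c_def)
    fix a q :: "real mat" and \<phi> :: real
    assume a: "a \<in> carrier_mat d 1" and q: "q \<in> carrier_mat d 1" and phi: "0 \<le> \<phi>"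
      and bound: "\<And>q. q \<in> carrier_mat d 1 \<Longrightarrow> (ip a q)\<^sup>2 \<le> \<phi> * ip q (R * q)"
      and ker: "\<And>q. q \<in> carrier_mat d 1 \<Longrightarrow> B * q = 0\<^sub>m d 1 \<Longrightarrow> ip a q = 0"
    have [simp]: "dim_row a = d" "dim_col a = 1" "dim_row q = d" "dim_col q = 1" using a q by auto
    \<comment> \<open>Coordinates of q in the B-orthonormal system W: q - W y lies in the kernel of
      B, where the functional vanishes.\<close>
    define y where "y = transpose_mat W * (B * q)"
    have y: "y \<in> carrier_mat r 1" using W cB q by (auto simp: y_def)
    have [simp]: "dim_row y = r" "dim_col y = 1" using y by auto
    have "B * (W * y) = (B * (W * (transpose_mat W * B))) * q" by (simp add: y_def mat_assoc)
    hence BWy: "B * (W * y) = B * q" by (simp only: BWB)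
    have "ip a (q - W * y) = 0"
      by (rule ker) (use BWy in \<open>auto simp: mat_mult_minus intro!: eq_matI carrier_matI\<close>)
    hence "ip a q = ip a (W * y)" by (simp add: ip_minus_right)
    also have "\<dots> = ip (transpose_mat W * a) y" by (rule ip_mult_left) auto
    finally have "(ip a q)\<^sup>2 \<le> ip (transpose_mat W * a) (transpose_mat W * a) * ip y y"
      using ip_cauchy_schwarz[of "transpose_mat W * a" r y] W a y by auto
    also have "ip y y = ip q (B * q)"
    proof -
      have "ip q (B * q) = ip q (B * (W * y))" by (simp only: BWy)
      also have "\<dots> = ip y y"
        by (simp add: ip_mult_left y_def psd_sym[OF B] mat_transpose_mult mat_assoc)
      finally show ?thesis by simp
    qed
    also have "ip (transpose_mat W * a) (transpose_mat W * a) = (\<Sum>j<r. (ip a (W * basis_col r j))\<^sup>2)"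
    proof -
      have "ip a (W * basis_col r j) = (transpose_mat W * a) $$ (j, 0)" if "j < r" for j
        using ip_basis_col(2)[OF that, of "transpose_mat W * a"] W a
        by (simp add: ip_mult_left del: index_mult_mat(1))
      thus ?thesis by (simp add: ip_def power2_eq_square del: index_mult_mat(1))
    qed
    also have "\<dots> \<le> (\<Sum>j<r. \<phi> * ip (W * basis_col r j) (R * (W * basis_col r j)))"
      by (intro sum_mono bound Wb)
    also have "\<dots> \<le> c * \<phi>" using phi by (simp add: c_def sum_distrib_left[symmetric] algebra_simps)
    finally show "(ip a q)\<^sup>2 \<le> c * \<phi> * ip q (B * q)"
      using psd_nonneg[OF B q] by (simp add: mult_right_mono)
  qed
qed

text \<open>The projection P = I - J J^T is psd. Gram-Schmidt for it gives W, and the columns of P W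
  form an orthonormal basis of the complement of the range of J.\<close>

lemma isometry_completion:
  fixes J :: "real mat"
  assumes J: "J \<in> carrier_mat k n" and iso: "transpose_mat J * J = 1\<^sub>m n"
  obtains J' where "n \<le> k" "J' \<in> carrier_mat k (k - n)" "transpose_mat J' * J' = 1\<^sub>m (k - n)"
    "transpose_mat J * J' = 0\<^sub>m n (k - n)" "J * transpose_mat J + J' * transpose_mat J' = 1\<^sub>m k"
proof -
  have [simp]: "dim_row J = k" "dim_col J = n" using J by auto
  define P :: "real mat" where "P = 1\<^sub>m k - J * transpose_mat J"
  have P: "P \<in> carrier_mat k k" by (auto simp: P_def)
  have [simp]: "dim_row P = k" "dim_col P = k" using P by auto
  have JP: "transpose_mat J * P = 0\<^sub>m n k"
  proof -
    have "transpose_mat J * P = transpose_mat J - (transpose_mat J * J) * transpose_mat J"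
      by (simp add: P_def mat_mult_minus mat_mult_one mat_assoc)
    thus ?thesis unfolding iso by (simp add: mat_one_mult) (auto intro!: eq_matI)
  qed
  have symP: "transpose_mat P = P"
    using transpose_minus[of "1\<^sub>m k" k k "J * transpose_mat J"] J by (simp add: P_def mat_transpose_mult)
  have PP: "P * P = P"
  proof -
    have "P * P = P - J * (transpose_mat J * P)"
      by (subst (1) P_def) (simp add: mat_minus_mult mat_one_mult mat_assoc)
    thus ?thesis by (simp add: JP mat_mult_zero) (auto intro!: eq_matI)
  qed
  have "psd k P"
    unfolding psd_iff_ip
  proof (intro conjI ballI P symP)
    fix v :: "real mat" assume v: "v \<in> carrier_mat k 1"
    have "ip v (P * v) = ip v (P * (P * v))" using v PP by (simp add: mat_assoc[symmetric])
    also have "\<dots> = ip (P * v) (P * v)" using v symP by (subst ip_mult_left) auto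
    finally show "0 \<le> ip v (P * v)" by (simp add: ip_self_nonneg)
  qed
  then obtain r W where W: "W \<in> carrier_mat k r" and WPW: "transpose_mat W * (P * W) = 1\<^sub>m r"
    and PWP: "P * (W * (transpose_mat W * P)) = P"
    using psd_gram_schmidt by blast
  have [simp]: "dim_row W = k" "dim_col W = r" using W by auto
  define J' where "J' = P * W"
  have J': "J' \<in> carrier_mat k r" using P W by (auto simp: J'_def)
  have [simp]: "dim_row J' = k" "dim_col J' = r" using J' by auto
  have 1: "transpose_mat J' * J' = 1\<^sub>m r"
  proof -
    have "transpose_mat J' * J' = transpose_mat W * (P * P * W)" by (simp add: J'_def mat_ring symP)
    thus ?thesis by (simp add: PP WPW)
  qed
  have 2: "transpose_mat J * J' = 0\<^sub>m n r"
  proof -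
    have "transpose_mat J * J' = transpose_mat J * P * W" by (simp add: J'_def mat_assoc)
    thus ?thesis by (simp add: JP mat_zero_mult)
  qed
  have 3: "J' * transpose_mat J' = P"
    using PWP by (simp add: J'_def mat_ring symP)
  \<comment> \<open>Counts the columns of J' by the trace of J' J'^T = P. As r is a natural number,
    n \<le> k comes out as well.\<close>
  have "real r = ip (1\<^sub>m r) (transpose_mat J' * J')" by (simp add: 1 ip_one_one)
  also have "\<dots> = ip J' J'" by (subst ip_mult_left) (simp_all add: mat_mult_one)
  also have "\<dots> = ip (1\<^sub>m k) (J' * transpose_mat J')" by (subst ip_mult_right) (simp_all add: mat_one_mult)
  also have "\<dots> = k - ip (1\<^sub>m k) (J * transpose_mat J)" unfolding 3 P_def by (simp add: ip_minus_right ip_one_one)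
  also have "ip (1\<^sub>m k) (J * transpose_mat J) = ip J J" by (subst ip_mult_right) (simp_all add: mat_one_mult)
  also have "ip J J = ip (1\<^sub>m n) (transpose_mat J * J)" by (subst ip_mult_left) (simp_all add: mat_mult_one)
  also have "\<dots> = n" by (simp add: iso ip_one_one)
  finally have "n \<le> k" "r = k - n" by linarith+
  moreover have "J * transpose_mat J + J' * transpose_mat J' = 1\<^sub>m k"
    unfolding 3 P_def by (auto intro!: eq_matI)
  ultimately show ?thesis using that[of J'] J' 1 2 by simp
qed

section \<open>The quadratic form of a linear pencil\<close>

lemma SMn_nth:
  assumes "X \<in> SMn g n" "i < g"
  shows "X ! i \<in> carrier_mat n n" "transpose_mat (X ! i) = X ! i"
    "dim_row (X ! i) = n" "dim_col (X ! i) = n"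
  using assms nth_mem[of i X] by (auto simp: SMn_def)

lemma SMnD: "X \<in> SMn g n \<Longrightarrow> length X = g" "X \<in> SMn g n \<Longrightarrow> 1 \<le> n"
  by (auto simp: SMn_def)

lemma SMnI:
  "1 \<le> n \<Longrightarrow> length X = g \<Longrightarrow> (\<And>i. i < g \<Longrightarrow> X ! i \<in> carrier_mat n n) \<Longrightarrow>
    (\<And>i. i < g \<Longrightarrow> transpose_mat (X ! i) = X ! i) \<Longrightarrow> X \<in> SMn g n"
  by (auto simp: SMn_def in_set_conv_nth)

text \<open>The empty tuple has every size, hence the condition on g.\<close>

lemma SMn_size_unique: "X \<in> SMn g n \<Longrightarrow> X \<in> SMn g m \<Longrightarrow> 1 \<le> g \<Longrightarrow> n = m"
  using SMn_nth(3)[of X g n 0] SMn_nth(3)[of X g m 0] by simp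

lemma conj_tuple_nth: "i < length X \<Longrightarrow> conj_tuple V X ! i = transpose_mat V * X ! i * V"
  by (simp add: conj_tuple_def)

lemma conj_tuple_SMn:
  assumes "X \<in> SMn g k" "V \<in> carrier_mat k n" "1 \<le> n"
  shows "conj_tuple V X \<in> SMn g n"
proof (rule SMnI)
  fix i assume i: "i < g"
  note X = SMn_nth[OF assms(1) i] and l = SMnD(1)[OF assms(1)]
  show "conj_tuple V X ! i \<in> carrier_mat n n"
    using X l i assms(2) by (auto simp: conj_tuple_nth)
  show "transpose_mat (conj_tuple V X ! i) = conj_tuple V X ! i"
    using X l i assms(2) by (simp add: conj_tuple_nth mat_ring)
qed (use assms SMnD(1)[OF assms(1)] in \<open>auto simp: conj_tuple_def\<close>)

section \<open>Finite sums of matrices\<close>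

lemma msum_carrier [simp]: "msum nr nc m F \<in> carrier_mat nr nc"
  by (simp add: msum_def)

lemma msum_dim [simp]: "dim_row (msum nr nc m F) = nr" "dim_col (msum nr nc m F) = nc"
  by (simp_all add: msum_def)

lemma msum_index: "i < nr \<Longrightarrow> j < nc \<Longrightarrow> msum nr nc m F $$ (i, j) = (\<Sum>l<m. F l $$ (i, j))"
  by (simp add: msum_def)

lemma msum_cong: "(\<And>l. l < m \<Longrightarrow> F l = G l) \<Longrightarrow> msum nr nc m F = msum nr nc m G"
  by (auto simp: msum_def intro!: eq_matI)

lemma ip_msum: "ip M (msum nr nc m F) = (\<Sum>l<m. ip M (F l))"
  if "\<And>l. l < m \<Longrightarrow> F l \<in> carrier_mat nr nc"
proof -
  have "ip M (msum nr nc m F) = (\<Sum>i<nr. \<Sum>a<nc. \<Sum>l<m. M $$ (i, a) * F l $$ (i, a))"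
    by (simp add: ip_def msum_index sum_distrib_left)
  also have "\<dots> = (\<Sum>i<nr. \<Sum>l<m. \<Sum>a<nc. M $$ (i, a) * F l $$ (i, a))"
    by (intro sum.cong refl sum.swap)
  also have "\<dots> = (\<Sum>l<m. \<Sum>i<nr. \<Sum>a<nc. M $$ (i, a) * F l $$ (i, a))"
    by (rule sum.swap)
  also have "\<dots> = (\<Sum>l<m. ip M (F l))"
    using that by (intro sum.cong refl) (auto simp: ip_def)
  finally show ?thesis .
qed

lemma msum_mult:
  assumes "\<And>l. l < m \<Longrightarrow> F l \<in> carrier_mat nr nc" "w \<in> carrier_mat nc c"
  shows "msum nr nc m F * w = msum nr c m (\<lambda>l. F l * w)"
proof (rule eq_matI)
  fix i j assume "i < dim_row (msum nr c m (\<lambda>l. F l * w))" "j < dim_col (msum nr c m (\<lambda>l. F l * w))"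
  hence ij: "i < nr" "j < c" by auto
  have "(msum nr nc m F * w) $$ (i, j) = (\<Sum>x<nc. \<Sum>l<m. F l $$ (i, x) * w $$ (x, j))"
    using assms(2) ij by (simp add: index_mult_sum msum_index sum_distrib_right del: index_mult_mat(1))
  also have "\<dots> = (\<Sum>l<m. \<Sum>x<nc. F l $$ (i, x) * w $$ (x, j))" by (rule sum.swap)
  also have "\<dots> = (\<Sum>l<m. (F l * w) $$ (i, j))"
  proof (intro sum.cong refl)
    fix l assume "l \<in> {..<m}"
    hence "F l \<in> carrier_mat nr nc" using assms(1) by simp
    thus "(\<Sum>x<nc. F l $$ (i, x) * w $$ (x, j)) = (F l * w) $$ (i, j)"
      using assms(2) ij by (simp add: index_mult_sum del: index_mult_mat(1))
  qed
  also have "\<dots> = msum nr c m (\<lambda>l. F l * w) $$ (i, j)" using ij by (simp add: msum_index)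
  finally show "(msum nr nc m F * w) $$ (i, j) = msum nr c m (\<lambda>l. F l * w) $$ (i, j)" .
qed (use assms in auto)

lemma mult_msum:
  assumes "\<And>l. l < m \<Longrightarrow> F l \<in> carrier_mat nr nc" "w \<in> carrier_mat c nr"
  shows "w * msum nr nc m F = msum c nc m (\<lambda>l. w * F l)"
proof (rule eq_matI)
  fix i j assume "i < dim_row (msum c nc m (\<lambda>l. w * F l))" "j < dim_col (msum c nc m (\<lambda>l. w * F l))"
  hence ij: "i < c" "j < nc" by auto
  have "(w * msum nr nc m F) $$ (i, j) = (\<Sum>x<nr. \<Sum>l<m. w $$ (i, x) * F l $$ (x, j))"
    using assms(2) ij by (simp add: index_mult_sum msum_index sum_distrib_left del: index_mult_mat(1))
  also have "\<dots> = (\<Sum>l<m. \<Sum>x<nr. w $$ (i, x) * F l $$ (x, j))" by (rule sum.swap)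
  also have "\<dots> = (\<Sum>l<m. (w * F l) $$ (i, j))"
  proof (intro sum.cong refl)
    fix l assume "l \<in> {..<m}"
    hence "F l \<in> carrier_mat nr nc" using assms(1) by simp
    thus "(\<Sum>x<nr. w $$ (i, x) * F l $$ (x, j)) = (w * F l) $$ (i, j)"
      using assms(2) ij by (simp add: index_mult_sum del: index_mult_mat(1))
  qed
  also have "\<dots> = msum c nc m (\<lambda>l. w * F l) $$ (i, j)" using ij by (simp add: msum_index)
  finally show "(w * msum nr nc m F) $$ (i, j) = msum c nc m (\<lambda>l. w * F l) $$ (i, j)" .
qed (use assms in auto)

text \<open>The bilinear form of \<open>lin_pencil\<close> when vectors of length d n are read as d
  x n matrices: the tensor product of A_j and Y_j acts as N \<mapsto> A_j N Y_j, since Y_j is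
  symmetric.\<close>

definition form :: "nat \<Rightarrow> real mat list \<Rightarrow> real mat list \<Rightarrow> real mat \<Rightarrow> real mat \<Rightarrow> real" where
  "form h A Y M N = ip M N - (\<Sum>j<h. ip M (A ! j * N * Y ! j))"

text \<open>Flattening by rows, which matches the index convention of \<open>kron\<close>: the
  quotient by n indexes the first factor, the remainder the second.\<close>

definition flat_mat :: "nat \<Rightarrow> nat \<Rightarrow> real mat \<Rightarrow> real mat" where
  "flat_mat d n M = mat (d * n) 1 (\<lambda>(r, _). M $$ (r div n, r mod n))"

lemma flat_mat_carrier [simp]:
  "flat_mat d n M \<in> carrier_mat (d * n) 1" "flat_mat d n M \<in> carrier_mat (d * n) (Suc 0)"
  and flat_mat_dim [simp]: "dim_row (flat_mat d n M) = d * n" "dim_col (flat_mat d n M) = Suc 0"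
  by (simp_all add: flat_mat_def)

lemma div_mod_less: "r < d * n \<Longrightarrow> r div n < d \<and> r mod n < (n :: nat)"
  by (metis less_mult_imp_div_less mod_less_divisor mult_0_right neq0_conv not_less_zero)

lemma sum_lessThan_mult:
  fixes f :: "nat \<Rightarrow> nat \<Rightarrow> real"
  shows "(\<Sum>r<d * n. f (r div n) (r mod n)) = (\<Sum>i<d. \<Sum>a<n. f i a)"
proof (induction d)
  case (Suc d)
  have "(\<Sum>r<Suc d * n. f (r div n) (r mod n)) =
      (\<Sum>r<d * n + n. f (r div n) (r mod n))" by (simp add: add.commute)
  also have "\<dots> = (\<Sum>i<d. \<Sum>a<n. f i a) + (\<Sum>a<n. f ((d * n + a) div n) ((d * n + a) mod n))"
    unfolding sum_lessThan_add by (simp add: Suc)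
  also have "(\<Sum>a<n. f ((d * n + a) div n) ((d * n + a) mod n)) = (\<Sum>a<n. f d a)"
    by (intro sum.cong refl) (auto simp: div_mult_self3)
  finally show ?case by simp
qed simp

lemma flat_mat_index: "r < d * n \<Longrightarrow> flat_mat d n M $$ (r, 0) = M $$ (r div n, r mod n)"
  by (simp add: flat_mat_def)

lemma ip_flat_mat:
  assumes "N \<in> carrier_mat d n"
  shows "ip (flat_mat d n M) (flat_mat d n N) = ip M N"
proof -
  have "ip (flat_mat d n M) (flat_mat d n N)
      = (\<Sum>r<d * n. (\<lambda>i a. M $$ (i, a) * N $$ (i, a)) (r div n) (r mod n))"
    by (simp add: ip_def flat_mat_index)
  also have "\<dots> = (\<Sum>i<d. \<Sum>a<n. M $$ (i, a) * N $$ (i, a))" by (rule sum_lessThan_mult)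
  also have "\<dots> = ip M N" using assms by (simp add: ip_def)
  finally show ?thesis .
qed

lemma kron_flat_mat:
  assumes "A \<in> carrier_mat d d" "X \<in> carrier_mat n n" "M \<in> carrier_mat d n"
  shows "kron A X * flat_mat d n M = flat_mat d n (A * M * transpose_mat X)"
proof (rule eq_matI)
  fix r j assume "r < dim_row (flat_mat d n (A * M * transpose_mat X))"
    "j < dim_col (flat_mat d n (A * M * transpose_mat X))"
  hence r: "r < d * n" and j: "j = 0" by auto
  note dm = div_mod_less[OF r]
  have "(kron A X * flat_mat d n M) $$ (r, 0)
      = (\<Sum>c<d * n. (\<lambda>i a. A $$ (r div n, i) * X $$ (r mod n, a) * M $$ (i, a)) (c div n) (c mod n))"
    using assms r
    by (subst index_mult_sum) (auto simp: kron_def flat_mat_index simp del: index_mult_mat(1) intro!: sum.cong)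
  also have "\<dots> = (\<Sum>i<d. \<Sum>a<n. A $$ (r div n, i) * X $$ (r mod n, a) * M $$ (i, a))"
    by (rule sum_lessThan_mult)
  also have "\<dots> = (\<Sum>a<n. \<Sum>i<d. A $$ (r div n, i) * X $$ (r mod n, a) * M $$ (i, a))"
    by (rule sum.swap)
  also have "\<dots> = (A * M * transpose_mat X) $$ (r div n, r mod n)"
    using assms dm
    by (simp add: index_mult_sum sum_distrib_right sum_distrib_left mult_ac
        del: index_mult_mat(1) assoc_mult_mat)
  finally show "(kron A X * flat_mat d n M) $$ (r, j) = flat_mat d n (A * M * transpose_mat X) $$ (r, j)"
    using j r by (simp add: flat_mat_index del: index_mult_mat(1))
qed (use assms in \<open>auto simp: kron_def\<close>)

lemma kron_carrier: "A \<in> carrier_mat d d \<Longrightarrow> X \<in> carrier_mat n n \<Longrightarrow> kron A X \<in> carrier_mat (d * n) (d * n)"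
  by (auto simp: kron_def)

lemma kron_sym:
  assumes "A \<in> carrier_mat d d" "X \<in> carrier_mat n n" "transpose_mat A = A" "transpose_mat X = X"
    and "r < d * n" "c < d * n"
  shows "kron A X $$ (r, c) = kron A X $$ (c, r)"
proof -
  have "A $$ (i, j) = A $$ (j, i)" if "i < d" "j < d" for i j
    using arg_cong[OF assms(3), of "\<lambda>B. B $$ (i, j)"] that assms(1) by simp
  moreover have "X $$ (i, j) = X $$ (j, i)" if "i < n" "j < n" for i j
    using arg_cong[OF assms(4), of "\<lambda>B. B $$ (i, j)"] that assms(2) by simp
  ultimately show ?thesis
    using div_mod_less[OF assms(5)] div_mod_less[OF assms(6)] assms(1,2,5,6)
    by (auto simp: kron_def intro!: arg_cong2[where f = "(*)"])
qed

lemma lin_pencil_flat_mat: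
  assumes A: "A \<in> SMn h d" and X: "X \<in> SMn h n" and M: "M \<in> carrier_mat d n"
  shows "ip (flat_mat d n M) (lin_pencil h d n A X * flat_mat d n M) = form h A X M M"
proof -
  note kc = kron_carrier[OF SMn_nth(1)[OF A] SMn_nth(1)[OF X]]
  have "lin_pencil h d n A X * flat_mat d n M
      = flat_mat d n M - msum (d * n) 1 h (\<lambda>j. kron (A ! j) (X ! j) * flat_mat d n M)"
    unfolding lin_pencil_def
    by (subst msum_mult[symmetric, OF kc]) (simp_all add: mat_minus_mult mat_one_mult)
  also have "\<dots> = flat_mat d n M - msum (d * n) 1 h (\<lambda>j. flat_mat d n (A ! j * M * X ! j))"
    using kron_flat_mat[OF SMn_nth(1)[OF A] SMn_nth(1)[OF X] M] SMn_nth(2)[OF X]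
    by (intro arg_cong[of _ _ "\<lambda>Z. flat_mat d n M - Z"] msum_cong) simp
  finally have "ip (flat_mat d n M) (lin_pencil h d n A X * flat_mat d n M)
      = ip (flat_mat d n M) (flat_mat d n M) - (\<Sum>j<h. ip (flat_mat d n M) (flat_mat d n (A ! j * M * X ! j)))"
    by (simp add: ip_minus_right ip_msum)
  also have "\<dots> = form h A X M M"
  proof -
    have "A ! j * M * X ! j \<in> carrier_mat d n" if "j < h" for j
      using M SMn_nth(1)[OF A that] SMn_nth(1)[OF X that] by auto
    thus ?thesis using M by (simp add: form_def ip_flat_mat)
  qed
  finally show ?thesis .
qed

text \<open>Membership is tested on d x n matrices from here on; Kronecker products do not occur
  again.\<close>

lemma free_spec_iff:
  assumes h: "1 \<le> h" and A: "A \<in> SMn h d" and X: "X \<in> SMn h n"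
  shows "X \<in> free_spec h d A \<longleftrightarrow> (\<forall>M\<in>carrier_mat d n. 0 \<le> form h A X M M)"
proof -
  have "X \<in> free_spec h d A \<longleftrightarrow> psd (d * n) (lin_pencil h d n A X)"
  proof
    assume "X \<in> free_spec h d A"
    then obtain n' where n': "X \<in> SMn h n'" "psd (d * n') (lin_pencil h d n' A X)"
      by (auto simp: free_spec_def)
    show "psd (d * n) (lin_pencil h d n A X)" using n'(2) unfolding SMn_size_unique[OF n'(1) X h] .
  qed (use X in \<open>auto simp: free_spec_def\<close>)
  also have "\<dots> \<longleftrightarrow> (\<forall>v\<in>carrier_mat (d * n) 1. 0 \<le> ip v (lin_pencil h d n A X * v))"
  proof -
    have "transpose_mat (lin_pencil h d n A X) = lin_pencil h d n A X"
      using kron_sym[OF SMn_nth(1)[OF A] SMn_nth(1)[OF X] SMn_nth(2)[OF A] SMn_nth(2)[OF X]]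
      unfolding lin_pencil_def by (intro eq_matI) (auto simp: msum_index intro!: sum.cong)
    moreover have "lin_pencil h d n A X \<in> carrier_mat (d * n) (d * n)"
      unfolding lin_pencil_def by (intro minus_carrier_mat) auto
    ultimately show ?thesis by (simp add: psd_iff_ip)
  qed
  also have "\<dots> \<longleftrightarrow> (\<forall>M\<in>carrier_mat d n. 0 \<le> form h A X M M)"
  proof safe
    fix M :: "real mat" assume a: "\<forall>v\<in>carrier_mat (d * n) 1. 0 \<le> ip v (lin_pencil h d n A X * v)" "M \<in> carrier_mat d n"
    thus "0 \<le> form h A X M M" using lin_pencil_flat_mat[OF A X a(2)] flat_mat_carrier[of d n M] by metis
  next
    fix v :: "real mat"
    assume a: "\<forall>M\<in>carrier_mat d n. 0 \<le> form h A X M M" and v: "v \<in> carrier_mat (d * n) 1"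
    define M where "M = mat d n (\<lambda>(i, a). v $$ (i * n + a, 0))"
    have "v = flat_mat d n M"
      using v by (intro eq_matI) (auto simp: flat_mat_def M_def dest!: div_mod_less)
    moreover have M: "M \<in> carrier_mat d n" by (simp add: M_def)
    ultimately show "0 \<le> ip v (lin_pencil h d n A X * v)" using a lin_pencil_flat_mat[OF A X M] by simp
  qed
  finally show ?thesis .
qed

lemma form_sym:
  assumes A: "A \<in> SMn h d" and Y: "Y \<in> SMn h n" and M: "M \<in> carrier_mat d n" and N: "N \<in> carrier_mat d n"
  shows "form h A Y M N = form h A Y N M"
proof -
  have "ip M (A ! j * N * Y ! j) = ip N (A ! j * M * Y ! j)" if j: "j < h" for j
  proof -
    note a = SMn_nth[OF A j] and y = SMn_nth[OF Y j]
    have "ip M (A ! j * N * Y ! j) = ip (A ! j * (M * Y ! j)) N"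
      using a y M N by (subst ip_mult_right, simp, simp, simp, subst ip_mult_left) auto
    also have "\<dots> = ip N (A ! j * M * Y ! j)"
      using a y M N by (subst ip_comm) (auto simp: mat_assoc)
    finally show ?thesis .
  qed
  moreover have "ip M N = ip N M" using M N by (intro ip_comm) auto
  ultimately show ?thesis by (simp add: form_def)
qed

lemma form_add_right:
  assumes A: "A \<in> SMn h d" and Y: "Y \<in> SMn h n" and N: "N \<in> carrier_mat d n" and N': "N' \<in> carrier_mat d n"
  shows "form h A Y M (N + N') = form h A Y M N + form h A Y M N'"
proof -
  have "ip M (A ! j * (N + N') * Y ! j) = ip M (A ! j * N * Y ! j) + ip M (A ! j * N' * Y ! j)" if j: "j < h" for j
    using SMn_nth[OF A j] SMn_nth[OF Y j] N N' by (simp add: mat_mult_add mat_add_mult ip_add_right)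
  thus ?thesis using N N' by (simp add: form_def ip_add_right sum.distrib)
qed

lemma form_smult_right:
  assumes A: "A \<in> SMn h d" and Y: "Y \<in> SMn h n" and N: "N \<in> carrier_mat d n"
  shows "form h A Y M (c \<cdot>\<^sub>m N) = c * form h A Y M N"
proof -
  have "ip M (A ! j * (c \<cdot>\<^sub>m N) * Y ! j) = c * ip M (A ! j * N * Y ! j)" if j: "j < h" for j
    using SMn_nth[OF A j] SMn_nth[OF Y j] N by (simp add: mat_mult_smult mat_smult_mult ip_smult_right)
  thus ?thesis using N by (simp add: form_def ip_smult_right sum_distrib_left right_diff_distrib)
qed

lemma form_expand:
  assumes A: "A \<in> SMn h d" and Y: "Y \<in> SMn h n" and M: "M \<in> carrier_mat d n" and N: "N \<in> carrier_mat d n"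
  shows "form h A Y (M + c \<cdot>\<^sub>m N) (M + c \<cdot>\<^sub>m N)
    = form h A Y M M + 2 * c * form h A Y M N + c\<^sup>2 * form h A Y N N"
proof -
  define L where "L = M + c \<cdot>\<^sub>m N"
  have L: "L \<in> carrier_mat d n" and cN: "c \<cdot>\<^sub>m N \<in> carrier_mat d n" using M N by (auto simp: L_def)
  have s: "form h A Y P L = form h A Y P M + c * form h A Y P N" for P
    unfolding L_def by (simp add: form_add_right[OF A Y M cN] form_smult_right[OF A Y N])
  have "form h A Y L L = form h A Y M L + c * form h A Y N L"
    unfolding s[of L] form_sym[OF A Y L M] form_sym[OF A Y L N] ..
  also have "\<dots> = form h A Y M M + 2 * c * form h A Y M N + c\<^sup>2 * form h A Y N N"
    unfolding s form_sym[OF A Y N M] by (simp add: power2_eq_square algebra_simps)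
  finally show ?thesis unfolding L_def .
qed

lemma form_cauchy_schwarz:
  assumes A: "A \<in> SMn h d" and Y: "Y \<in> SMn h n" and M: "M \<in> carrier_mat d n" and N: "N \<in> carrier_mat d n"
    and nonneg: "\<And>M. M \<in> carrier_mat d n \<Longrightarrow> 0 \<le> form h A Y M M"
  shows "(form h A Y M N)\<^sup>2 \<le> form h A Y M M * form h A Y N N"
proof (rule quadratic_nonneg_discriminant)
  fix s :: real
  show "0 \<le> form h A Y M M + 2 * s * form h A Y M N + s\<^sup>2 * form h A Y N N"
    unfolding form_expand[OF A Y M N, symmetric] using M N by (intro nonneg) auto
qed

section \<open>Matrix convex combinations and compressions\<close>

lemma mconv_dataD:
  assumes "mconv_data g K n m k V Y"
  shows "\<And>l. l < m \<Longrightarrow> Y l \<in> K" "\<And>l. l < m \<Longrightarrow> Y l \<in> SMn g (k l)"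
    "\<And>l. l < m \<Longrightarrow> V l \<in> carrier_mat (k l) n"
    "msum n n m (\<lambda>l. transpose_mat (V l) * V l) = 1\<^sub>m n"
  using assms by (auto simp: mconv_data_def)

lemma mconv_value_nth:
  assumes "mconv_data g K n m k V Y" "i < g"
  shows "mconv_value g n m V Y ! i = msum n n m (\<lambda>l. transpose_mat (V l) * Y l ! i * V l)"
proof -
  have "conj_tuple (V l) (Y l) ! i = transpose_mat (V l) * Y l ! i * V l" if "l < m" for l
    using SMnD(1)[OF mconv_dataD(2)[OF assms(1) that]] assms(2) by (simp add: conj_tuple_nth)
  thus ?thesis unfolding mconv_value_def using assms(2) by (auto intro!: msum_cong)
qed

text \<open>Each V_l moves from the point to the arguments of the form. The identity term splits in
  the same way because the V_l^T V_l add up to I.\<close>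

lemma form_mconv_value:
  assumes A: "A \<in> SMn h d" and V: "mconv_data h K n m k V Y"
    and M: "M \<in> carrier_mat d n" and N: "N \<in> carrier_mat d n"
  shows "form h A (mconv_value h n m V Y) M N
    = (\<Sum>l<m. form h A (Y l) (M * transpose_mat (V l)) (N * transpose_mat (V l)))"
proof -
  note D = mconv_dataD[OF V]
  have 1: "ip M N = (\<Sum>l<m. ip (M * transpose_mat (V l)) (N * transpose_mat (V l)))"
  proof -
    have "ip M N = ip M (N * msum n n m (\<lambda>l. transpose_mat (V l) * V l))"
      using N by (simp add: D(4) mat_mult_one)
    also have "\<dots> = (\<Sum>l<m. ip M (N * (transpose_mat (V l) * V l)))"
    proof -
      have "transpose_mat (V l) * V l \<in> carrier_mat n n" if "l < m" for l
        using D(3)[OF that] by auto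
      thus ?thesis using N by (subst mult_msum[of _ _ _ _ _ d]) (auto intro!: ip_msum)
    qed
    also have "\<dots> = (\<Sum>l<m. ip (M * transpose_mat (V l)) (N * transpose_mat (V l)))"
    proof (intro sum.cong refl)
      fix l assume "l \<in> {..<m}"
      hence v: "V l \<in> carrier_mat (k l) n" using D(3) by auto
      show "ip M (N * (transpose_mat (V l) * V l)) = ip (M * transpose_mat (V l)) (N * transpose_mat (V l))"
        using M N v by (subst mat_assoc[symmetric], simp, simp, subst ip_mult_right) auto
    qed
    finally show ?thesis .
  qed
  have 2: "ip M (A ! j * N * mconv_value h n m V Y ! j)
      = (\<Sum>l<m. ip (M * transpose_mat (V l)) (A ! j * (N * transpose_mat (V l)) * Y l ! j))" if j: "j < h" for j
  proof -
    note a = SMn_nth[OF A j]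
    have F: "transpose_mat (V l) * Y l ! j * V l \<in> carrier_mat n n" if "l < m" for l
      using D(3)[OF that] SMn_nth(1)[OF D(2)[OF that] j] by auto
    have AN: "A ! j * N \<in> carrier_mat d n" using N a by auto
    have "ip M (A ! j * N * mconv_value h n m V Y ! j)
        = (\<Sum>l<m. ip M (A ! j * N * (transpose_mat (V l) * Y l ! j * V l)))"
      unfolding mconv_value_nth[OF V j]
      by (subst mult_msum[OF F AN]) (auto intro!: ip_msum mult_carrier_mat[OF AN F])
    also have "\<dots> = (\<Sum>l<m. ip (M * transpose_mat (V l)) (A ! j * (N * transpose_mat (V l)) * Y l ! j))"
    proof (intro sum.cong refl)
      fix l assume "l \<in> {..<m}"
      hence v: "V l \<in> carrier_mat (k l) n" and y: "Y l ! j \<in> carrier_mat (k l) (k l)"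
        using D(3) SMn_nth(1)[OF D(2) j] by auto
      have "A ! j * N * (transpose_mat (V l) * Y l ! j * V l) = A ! j * (N * transpose_mat (V l)) * Y l ! j * V l"
        using M N v y a by (simp add: mat_assoc)
      thus "ip M (A ! j * N * (transpose_mat (V l) * Y l ! j * V l))
          = ip (M * transpose_mat (V l)) (A ! j * (N * transpose_mat (V l)) * Y l ! j)"
        using M N v y a by (simp, subst ip_mult_right) auto
    qed
    finally show ?thesis .
  qed
  show ?thesis
    unfolding form_def sum_subtractf 1[symmetric]
    by (subst sum.swap) (simp add: 2)
qed

lemma mconv_value_SMn:
  assumes V: "mconv_data g K n m k V Y" and n: "1 \<le> n"
  shows "mconv_value g n m V Y \<in> SMn g n"
proof (rule SMnI)
  note D = mconv_dataD[OF V]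
  fix i assume i: "i < g"
  show "mconv_value g n m V Y ! i \<in> carrier_mat n n" by (simp add: mconv_value_nth[OF V i])
  have F: "(transpose_mat (V l) * Y l ! i * V l) $$ (a, b) = (transpose_mat (V l) * Y l ! i * V l) $$ (b, a)"
    if l: "l < m" and ab: "a < n" "b < n" for l a b
  proof -
    note v = D(3)[OF l] and y = SMn_nth[OF D(2)[OF l] i]
    have "transpose_mat (transpose_mat (V l) * Y l ! i * V l) = transpose_mat (V l) * Y l ! i * V l"
      using v y by (simp add: mat_ring)
    thus ?thesis using v y ab index_transpose_mat(1)[of a "transpose_mat (V l) * Y l ! i * V l" b]
      by (simp del: index_mult_mat(1) index_transpose_mat(1))
  qed
  show "transpose_mat (mconv_value g n m V Y ! i) = mconv_value g n m V Y ! i"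
    unfolding mconv_value_nth[OF V i] using F
    by (intro eq_matI) (auto simp: msum_index simp del: index_mult_mat(1) intro!: sum.cong)
qed (use n in \<open>auto simp: mconv_value_def\<close>)

lemma free_spec_mconv_closed:
  assumes h: "1 \<le> h" and A: "A \<in> SMn h d" and V: "mconv_data h (free_spec h d A) n m k V Y" and n: "1 \<le> n"
  shows "mconv_value h n m V Y \<in> free_spec h d A"
proof -
  note D = mconv_dataD[OF V]
  have "0 \<le> form h A (mconv_value h n m V Y) M M" if M: "M \<in> carrier_mat d n" for M
    unfolding form_mconv_value[OF A V M M]
  proof (intro sum_nonneg)
    fix l assume "l \<in> {..<m}"
    hence l: "l < m" by simp
    have "M * transpose_mat (V l) \<in> carrier_mat d (k l)" using M D(3)[OF l] by auto
    thus "0 \<le> form h A (Y l) (M * transpose_mat (V l)) (M * transpose_mat (V l))"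
      using D(1)[OF l] free_spec_iff[OF h A D(2)[OF l]] by blast
  qed
  thus ?thesis using free_spec_iff[OF h A mconv_value_SMn[OF V n]] by blast
qed

text \<open>Compression by an isometry is a combination with a single term, so facts on combinations
  specialise to compressions.\<close>

lemma mconv_data_isometry:
  assumes "Y \<in> K" "Y \<in> SMn g k" "V \<in> carrier_mat k n" "transpose_mat V * V = 1\<^sub>m n"
  shows "mconv_data g K n 1 (\<lambda>_. k) (\<lambda>_. V) (\<lambda>_. Y)" "mconv_value g n 1 (\<lambda>_. V) (\<lambda>_. Y) = conj_tuple V Y"
proof -
  have s: "msum n n 1 (\<lambda>_. Q) = Q" if "Q \<in> carrier_mat n n" for Q
    using that by (intro eq_matI) (auto simp: msum_index)
  show V: "mconv_data g K n 1 (\<lambda>_. k) (\<lambda>_. V) (\<lambda>_. Y)"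
    using assms by (auto simp: mconv_data_def s[simplified])
  show "mconv_value g n 1 (\<lambda>_. V) (\<lambda>_. Y) = conj_tuple V Y"
  proof (rule nth_equalityI)
    fix i assume "i < length (mconv_value g n 1 (\<lambda>_. V) (\<lambda>_. Y))"
    hence i: "i < g" by (simp add: mconv_value_def)
    have "transpose_mat V * Y ! i * V \<in> carrier_mat n n" using assms SMn_nth(1)[OF assms(2) i] by auto
    from s[OF this] show "mconv_value g n 1 (\<lambda>_. V) (\<lambda>_. Y) ! i = conj_tuple V Y ! i"
      unfolding mconv_value_nth[OF V i] using i SMnD(1)[OF assms(2)] by (simp add: conj_tuple_nth)
  qed (use SMnD(1)[OF assms(2)] in \<open>simp add: mconv_value_def conj_tuple_def\<close>)
qed

lemma form_conj_tuple:
  assumes A: "A \<in> SMn h d" and Y: "Y \<in> SMn h k" and V: "V \<in> carrier_mat k n" "transpose_mat V * V = 1\<^sub>m n"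
    and M: "M \<in> carrier_mat d n" and N: "N \<in> carrier_mat d n"
  shows "form h A (conj_tuple V Y) M N = form h A Y (M * transpose_mat V) (N * transpose_mat V)"
  using form_mconv_value[OF A mconv_data_isometry(1)[OF UNIV_I Y V] M N] mconv_data_isometry(2)[OF UNIV_I Y V]
  by simp

lemma free_spec_conj_closed:
  assumes "1 \<le> h" "A \<in> SMn h d" "Y \<in> free_spec h d A" "Y \<in> SMn h k" "V \<in> carrier_mat k n"
    "transpose_mat V * V = 1\<^sub>m n" "1 \<le> n"
  shows "conj_tuple V Y \<in> free_spec h d A"
  using free_spec_mconv_closed[OF assms(1,2) mconv_data_isometry(1)[OF assms(3-6)] assms(7)]
    mconv_data_isometry(2)[OF assms(3-6)] by simp

section \<open>Embeddings and free extreme points\<close>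

text \<open>The range of J is invariant under all Y_i, which act on it as X_i. For symmetric tuples
  this says that X is a direct summand of Y up to orthogonal equivalence, with an empty complement
  allowed; both alternatives in \<open>free_extreme_points\<close> become one condition.\<close>

definition embeds :: "nat \<Rightarrow> nat \<Rightarrow> nat \<Rightarrow> real mat list \<Rightarrow> real mat list \<Rightarrow> bool" where
  "embeds g n k X Y \<longleftrightarrow> (\<exists>J\<in>carrier_mat k n. transpose_mat J * J = 1\<^sub>m n \<and>
     (\<forall>i<g. Y ! i * J = J * X ! i))"

text \<open>The completion of U has n - n = 0 columns and contributes nothing.\<close>

lemma orthogonal_right_inverse:
  fixes U :: "real mat"
  assumes "U \<in> carrier_mat n n" "transpose_mat U * U = 1\<^sub>m n"
  shows "U * transpose_mat U = 1\<^sub>m n"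
proof -
  obtain J' where J': "J' \<in> carrier_mat n (n - n)" "U * transpose_mat U + J' * transpose_mat J' = 1\<^sub>m n"
    using isometry_completion[OF assms] by blast
  have "J' * transpose_mat J' = 0\<^sub>m n n"
    using J'(1) by (intro eq_matI) (auto simp: index_mult_sum simp del: index_mult_mat(1))
  thus ?thesis using J'(2) assms(1) by (simp add: right_add_zero_mat[of _ n n])
qed

lemma hcat_mult_diag_block:
  assumes "A \<in> carrier_mat k n" "B \<in> carrier_mat k m" "M \<in> carrier_mat n n" "N \<in> carrier_mat m m"
  shows "hcat A B * diag_block_mat [M, N] = hcat (A * M) (B * N)"
proof (rule eq_matI)
  fix i j assume "i < dim_row (hcat (A * M) (B * N))" "j < dim_col (hcat (A * M) (B * N))"
  hence ij: "i < k" "j < n + m" using assms by auto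
  show "(hcat A B * diag_block_mat [M, N]) $$ (i, j) = hcat (A * M) (B * N) $$ (i, j)"
    using assms ij less_diff_conv2[of n j m, simplified add.commute[of m]]
    by (cases "j < n"; subst index_mult_sum)
      (auto simp: Let_def hcat_def sum_lessThan_add index_mult_sum simp del: index_mult_mat(1))
qed (use assms in \<open>auto simp: Let_def\<close>)

lemma direct_sum_nth:
  "i < length X \<Longrightarrow> i < length Z \<Longrightarrow> direct_sum X Z ! i = diag_block_mat [X ! i, Z ! i]"
  by (simp add: direct_sum_def)

text \<open>Completing J by J' to an orthogonal matrix block-diagonalises Y. The second block is the
  compression of Y to the range of J'.\<close>

lemma embeds_split:
  assumes X: "X \<in> SMn g n" and Y: "Y \<in> SMn g k" and e: "embeds g n k X Y"
  shows "n \<le> k" and "k = n \<Longrightarrow> orth_equiv n X Y"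
    and "n < k \<Longrightarrow> \<exists>V\<in>carrier_mat k (k - n). transpose_mat V * V = 1\<^sub>m (k - n) \<and>
           orth_equiv k (direct_sum X (conj_tuple V Y)) Y"
proof -
  obtain J where J: "J \<in> carrier_mat k n" and iso: "transpose_mat J * J = 1\<^sub>m n"
    and YJ: "\<And>i. i < g \<Longrightarrow> Y ! i * J = J * X ! i"
    using e unfolding embeds_def by blast
  obtain J' where nk: "n \<le> k" and J': "J' \<in> carrier_mat k (k - n)"
    and iso': "transpose_mat J' * J' = 1\<^sub>m (k - n)"
    and orth: "transpose_mat J * J' = 0\<^sub>m n (k - n)"
    and compl: "J * transpose_mat J + J' * transpose_mat J' = 1\<^sub>m k"
    using isometry_completion[OF J iso] by blast
  have [simp]: "dim_row J = k" "dim_col J = n" "dim_row J' = k" "dim_col J' = k - n" using J J' by auto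
  show "n \<le> k" by (rule nk)
  show "orth_equiv n X Y" if kn: "k = n"
  proof -
    have JJ: "J * transpose_mat J = 1\<^sub>m n" using orthogonal_right_inverse J iso kn by blast
    have "conj_tuple (transpose_mat J) X = Y"
    proof (rule nth_equalityI)
      fix i assume "i < length (conj_tuple (transpose_mat J) X)"
      hence i: "i < g" using SMnD(1)[OF X] by (simp add: conj_tuple_def)
      have "J * X ! i * transpose_mat J = Y ! i * (J * transpose_mat J)"
        unfolding YJ[OF i, symmetric] using SMn_nth[OF Y i] by (simp add: mat_assoc)
      thus "conj_tuple (transpose_mat J) X ! i = Y ! i"
        using i SMnD(1)[OF X] SMn_nth[OF Y i] kn by (simp add: conj_tuple_nth JJ mat_mult_one)
    qed (use SMnD(1)[OF X] SMnD(1)[OF Y] in \<open>simp add: conj_tuple_def\<close>)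
    thus ?thesis unfolding orth_equiv_def using J kn JJ by (intro bexI[of _ "transpose_mat J"]) auto
  qed
  show "\<exists>V\<in>carrier_mat k (k - n). transpose_mat V * V = 1\<^sub>m (k - n) \<and>
      orth_equiv k (direct_sum X (conj_tuple V Y)) Y" if "n < k"
  proof (intro bexI[of _ J'] conjI iso' J')
    define U where "U = hcat J J'"
    have U: "U \<in> carrier_mat k k" using hcat_carrier[OF J J'] nk by (simp add: U_def)
    have UU: "U * transpose_mat U = 1\<^sub>m k"
      unfolding U_def by (simp add: hcat_mult_transpose[OF J J' J J'] compl)
    have "conj_tuple (transpose_mat U) (direct_sum X (conj_tuple J' Y)) = Y"
    proof (rule nth_equalityI)
      fix i assume "i < length (conj_tuple (transpose_mat U) (direct_sum X (conj_tuple J' Y)))"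
      hence i: "i < g" using SMnD(1)[OF X] by (simp add: conj_tuple_def direct_sum_def)
      note x = SMn_nth[OF X i] and y = SMn_nth[OF Y i]
      define z where "z = transpose_mat J' * Y ! i * J'"
      have z: "z \<in> carrier_mat (k - n) (k - n)" using y by (auto simp: z_def)
      have "U * diag_block_mat [X ! i, z] * transpose_mat U
          = J * X ! i * transpose_mat J + J' * z * transpose_mat J'"
        unfolding U_def hcat_mult_diag_block[OF J J' x(1) z]
        by (rule hcat_mult_transpose[OF mult_carrier_mat[OF J x(1)] mult_carrier_mat[OF J' z] J J'])
      also have "J' * z * transpose_mat J' = Y ! i * (J' * transpose_mat J')"
      proof -
        have "transpose_mat J * Y ! i = transpose_mat (Y ! i * J)" using y by (simp add: mat_transpose_mult)
        also have "\<dots> = X ! i * transpose_mat J" using x by (simp add: YJ[OF i] mat_transpose_mult)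
        finally have JtY: "transpose_mat J * Y ! i = X ! i * transpose_mat J" .
        \<comment> \<open>By symmetry J^T Y_i = X_i J^T, and J^T J' = 0; so the range of J' is
          invariant too.\<close>
        have "J * transpose_mat J * (Y ! i * J') = J * ((transpose_mat J * Y ! i) * J')"
          using y by (simp add: mat_assoc)
        also have "\<dots> = J * (X ! i * (transpose_mat J * J'))"
          unfolding JtY using x by (simp add: mat_assoc)
        finally have 0: "J * transpose_mat J * (Y ! i * J') = 0\<^sub>m k (k - n)"
          using x by (simp add: orth mat_mult_zero)
        have "Y ! i * J' = (J * transpose_mat J + J' * transpose_mat J') * (Y ! i * J')"
          using y by (simp add: compl mat_one_mult)
        also have "\<dots> = J' * transpose_mat J' * (Y ! i * J')"
          using y 0 by (subst mat_add_mult) (auto intro!: left_add_zero_mat)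
        finally have "J' * z = Y ! i * J'" using y by (simp add: z_def mat_assoc)
        thus ?thesis using y z by (simp add: mat_assoc)
      qed
      also have "J * X ! i * transpose_mat J = Y ! i * (J * transpose_mat J)"
        unfolding YJ[OF i, symmetric] using y by (simp add: mat_assoc)
      also have "Y ! i * (J * transpose_mat J) + Y ! i * (J' * transpose_mat J') = Y ! i"
        using y by (subst mat_mult_add[symmetric]) (auto simp: compl mat_mult_one)
      finally show "conj_tuple (transpose_mat U) (direct_sum X (conj_tuple J' Y)) ! i = Y ! i"
        using i SMnD(1)[OF X] SMnD(1)[OF Y]
        by (simp add: conj_tuple_nth direct_sum_nth z_def conj_tuple_def direct_sum_def)
    qed (use SMnD(1)[OF X] SMnD(1)[OF Y] in \<open>simp add: conj_tuple_def direct_sum_def\<close>)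
    thus "orth_equiv k (direct_sum X (conj_tuple J' Y)) Y"
      unfolding orth_equiv_def using U UU by (intro bexI[of _ "transpose_mat U"]) auto
  qed
qed

text \<open>The size of Z is not required to be \<open>k - n\<close>: the junk entries in a product of
  matrices of incompatible sizes either are multiplied by the zero blocks of the direct sum or
  appear in columns that are absent from J.\<close>

lemma orth_equiv_direct_sum_embeds:
  assumes X: "X \<in> SMn g n" and Z: "Z \<in> SMn g p" and Y: "Y \<in> SMn g k" and nk: "n \<le> k"
    and eq: "orth_equiv k (direct_sum X Z) Y"
  shows "embeds g n k X Y"
proof -
  obtain U where U: "U \<in> carrier_mat k k" and UU: "transpose_mat U * U = 1\<^sub>m k"
    and c: "conj_tuple U (direct_sum X Z) = Y"
    using eq unfolding orth_equiv_def by blast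
  have UU': "U * transpose_mat U = 1\<^sub>m k" by (rule orthogonal_right_inverse[OF U UU])
  have inner: "(\<Sum>j<k. U $$ (a, j) * U $$ (b, j)) = (if a = b then 1 else 0)" if "a < k" "b < k" for a b
    using arg_cong[OF UU', of "\<lambda>M. M $$ (a, b)"] that U by (simp add: index_mult_sum del: index_mult_mat(1))
  define J where "J = mat k n (\<lambda>(i, a). U $$ (a, i))"
  have J: "J \<in> carrier_mat k n" by (simp add: J_def)
  have iso: "transpose_mat J * J = 1\<^sub>m n"
    using nk inner by (intro eq_matI) (auto simp: J_def index_mult_sum simp del: index_mult_mat(1))
  have "Y ! i * J = J * X ! i" if i: "i < g" for i
  proof (rule eq_matI)
    note x = SMn_nth[OF X i] and z = SMn_nth[OF Z i] and y = SMn_nth[OF Y i]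
    define M where "M = diag_block_mat [X ! i, Z ! i]"
    have M: "M \<in> carrier_mat (n + p) (n + p)" using x z by (auto simp: M_def Let_def)
    have Y': "Y ! i = transpose_mat U * M * U"
      using i SMnD(1)[OF X] SMnD(1)[OF Z] c[symmetric]
      by (simp add: M_def conj_tuple_nth direct_sum_nth direct_sum_def conj_tuple_def)
    fix r b assume "r < dim_row (J * X ! i)" "b < dim_col (J * X ! i)"
    hence r: "r < k" and b: "b < n" using J x by auto
    define T where "T = (\<lambda>c. row (transpose_mat U * M) r $ c)"
    have Yrj: "Y ! i $$ (r, j) = (\<Sum>c<k. T c * U $$ (c, j))" if "j < k" for j
      unfolding Y' T_def using that r U by (simp add: scalar_prod_def lessThan_atLeast0)
    have "(Y ! i * J) $$ (r, b) = (\<Sum>j<k. \<Sum>c<k. T c * U $$ (c, j) * U $$ (b, j))"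
      using y J r b by (simp add: index_mult_sum Yrj sum_distrib_right J_def del: index_mult_mat(1))
    also have "\<dots> = (\<Sum>c<k. T c * (\<Sum>j<k. U $$ (c, j) * U $$ (b, j)))"
      by (subst sum.swap) (simp add: sum_distrib_left mult.assoc)
    also have "\<dots> = (\<Sum>c<k. if c = b then T c else 0)"
      using b nk by (intro sum.cong refl) (simp add: inner)
    also have "\<dots> = T b" using b nk by simp
    also have "T b = (transpose_mat U * M) $$ (r, b)"
      unfolding T_def using r b U M by (simp del: index_mult_mat(1))
    also have "\<dots> = (\<Sum>l<n + p. row (transpose_mat U) r $ l * M $$ (l, b))"
      using r b U M by (simp add: scalar_prod_def lessThan_atLeast0)
    also have "\<dots> = (\<Sum>l<n. U $$ (l, r) * X ! i $$ (l, b))"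
    proof -
      have "row (transpose_mat U) r $ l * M $$ (l, b) = U $$ (l, r) * X ! i $$ (l, b)" if "l < n" for l
        using that r b nk U x z by (simp add: M_def Let_def)
      moreover have "M $$ (n + l, b) = 0" if "l < p" for l
        using that b x z by (simp add: M_def Let_def)
      ultimately show ?thesis by (simp add: sum_lessThan_add)
    qed
    also have "\<dots> = (J * X ! i) $$ (r, b)"
      using r b J x by (simp add: index_mult_sum J_def del: index_mult_mat(1))
    finally show "(Y ! i * J) $$ (r, b) = (J * X ! i) $$ (r, b)" .
  qed (use J SMn_nth[OF X i] SMn_nth[OF Y i] in auto)
  thus ?thesis using J iso unfolding embeds_def by blast
qed

lemma orth_equiv_embeds:
  assumes X: "X \<in> SMn g n" and eq: "orth_equiv n X Y"
  shows "embeds g n n X Y"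
proof -
  obtain U where U: "U \<in> carrier_mat n n" and UU: "transpose_mat U * U = 1\<^sub>m n" and c: "conj_tuple U X = Y"
    using eq unfolding orth_equiv_def by blast
  have UU': "U * transpose_mat U = 1\<^sub>m n" by (rule orthogonal_right_inverse[OF U UU])
  have "Y ! i * transpose_mat U = transpose_mat U * X ! i" if i: "i < g" for i
    using SMn_nth[OF X i] i SMnD(1)[OF X] U c[symmetric]
    by (simp add: conj_tuple_nth mat_assoc UU' mat_mult_one)
  thus ?thesis unfolding embeds_def using U UU' by (intro bexI[of _ "transpose_mat U"]) auto
qed

text \<open>Ensures that the complementary summand Z in \<open>free_extreme_points\<close>, being a
  compression of Y, lies in K.\<close>

definition compression_closed :: "nat \<Rightarrow> real mat list set \<Rightarrow> bool" where
  "compression_closed g K \<longleftrightarrow> (\<forall>k n. \<forall>Y\<in>K \<inter> SMn g k. \<forall>V\<in>carrier_mat k n.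
     1 \<le> n \<longrightarrow> transpose_mat V * V = 1\<^sub>m n \<longrightarrow> conj_tuple V Y \<in> K)"

text \<open>With complementary summands automatically in K, the conclusion about each Y l no longer
  refers to K. This makes the extreme points of different sets comparable.\<close>

lemma free_extreme_points_iff:
  assumes g: "1 \<le> g" and X: "X \<in> SMn g n" and K: "compression_closed g K" and KS: "\<And>Z. Z \<in> K \<Longrightarrow> \<exists>p. Z \<in> SMn g p"
  shows "X \<in> free_extreme_points g K \<longleftrightarrow> X \<in> K \<and>
    (\<forall>m k V Y. mconv_data g K n m k V Y \<and> (\<forall>l<m. V l \<noteq> 0\<^sub>m (k l) n) \<and> X = mconv_value g n m V Y \<longrightarrow>
      (\<forall>l<m. embeds g n (k l) X (Y l)))"
proof -
  have emb: "((k = n \<and> orth_equiv n X Y) \<or> (k > n \<and> (\<exists>Z \<in> K. orth_equiv k (direct_sum X Z) Y)))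
      \<longleftrightarrow> embeds g n k X Y" if Y: "Y \<in> K" "Y \<in> SMn g k" for k Y
  proof
    assume "(k = n \<and> orth_equiv n X Y) \<or> (k > n \<and> (\<exists>Z \<in> K. orth_equiv k (direct_sum X Z) Y))"
    thus "embeds g n k X Y"
      using orth_equiv_embeds[OF X] orth_equiv_direct_sum_embeds[OF X _ Y(2)] KS by (metis less_imp_le)
  next
    assume e: "embeds g n k X Y"
    note s = embeds_split[OF X Y(2) e]
    show "(k = n \<and> orth_equiv n X Y) \<or> (k > n \<and> (\<exists>Z \<in> K. orth_equiv k (direct_sum X Z) Y))"
    proof (cases "k = n")
      case False
      hence nk: "n < k" using s(1) by simp
      then obtain V where V: "V \<in> carrier_mat k (k - n)" "transpose_mat V * V = 1\<^sub>m (k - n)"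
        "orth_equiv k (direct_sum X (conj_tuple V Y)) Y" using s(3) by blast
      have "1 \<le> k - n" using nk by simp
      hence "conj_tuple V Y \<in> K" using K V(1,2) Y unfolding compression_closed_def by blast
      thus ?thesis using nk V(3) by blast
    qed (use s(2) in blast)
  qed
  show ?thesis
  proof
    assume "X \<in> free_extreme_points g K"
    then obtain n' where X': "X \<in> K" "X \<in> SMn g n'"
      and ext: "\<And>m k V Y. mconv_data g K n' m k V Y \<Longrightarrow> \<forall>l<m. V l \<noteq> 0\<^sub>m (k l) n' \<Longrightarrow> X = mconv_value g n' m V Y \<Longrightarrow>
        \<forall>l<m. k l = n' \<and> orth_equiv n' X (Y l) \<or>
               n' < k l \<and> (\<exists>Z\<in>K. orth_equiv (k l) (direct_sum X Z) (Y l))"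
      unfolding free_extreme_points_def by blast
    have n': "n' = n" by (rule SMn_size_unique[OF X'(2) X g])
    have "embeds g n (k l) X (Y l)"
      if d: "mconv_data g K n m k V Y" "\<forall>l<m. V l \<noteq> 0\<^sub>m (k l) n" "X = mconv_value g n m V Y" and l: "l < m"
      for m k V Y l
      using ext[unfolded n', OF d] l emb[OF mconv_dataD(1,2)[OF d(1) l]] by blast
    with X'(1) show "X \<in> K \<and> (\<forall>m k V Y. mconv_data g K n m k V Y \<and> (\<forall>l<m. V l \<noteq> 0\<^sub>m (k l) n) \<and>
      X = mconv_value g n m V Y \<longrightarrow> (\<forall>l<m. embeds g n (k l) X (Y l)))" by blast
  next
    assume r: "X \<in> K \<and> (\<forall>m k V Y. mconv_data g K n m k V Y \<and> (\<forall>l<m. V l \<noteq> 0\<^sub>m (k l) n) \<and>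
      X = mconv_value g n m V Y \<longrightarrow> (\<forall>l<m. embeds g n (k l) X (Y l)))"
    have "(k l = n \<and> orth_equiv n X (Y l)) \<or> (k l > n \<and> (\<exists>Z \<in> K. orth_equiv (k l) (direct_sum X Z) (Y l)))"
      if d: "mconv_data g K n m k V Y" "\<forall>l<m. V l \<noteq> 0\<^sub>m (k l) n" "X = mconv_value g n m V Y" and l: "l < m"
      for m k V Y l
      using r d l emb[OF mconv_dataD(1,2)[OF d(1) l]] by blast
    with r X show "X \<in> free_extreme_points g K"
      unfolding free_extreme_points_def by blast
  qed
qed

text \<open>A scalar pencil with a homogenising coefficient s: restricting the form of Y to a pair
  of vectors v, w puts \<open>ip v w\<close>, of any sign, in the place of 1.\<close>

definition pen :: "nat \<Rightarrow> nat \<Rightarrow> real mat list \<Rightarrow> real \<Rightarrow> (nat \<Rightarrow> real) \<Rightarrow> real mat" where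
  "pen h d A s x = s \<cdot>\<^sub>m 1\<^sub>m d - msum d d h (\<lambda>j. x j \<cdot>\<^sub>m A ! j)"

lemma pen_carrier [simp]: "pen h d A s x \<in> carrier_mat d d"
  unfolding pen_def by (intro minus_carrier_mat) simp

lemma pen_dim [simp]: "dim_row (pen h d A s x) = d" "dim_col (pen h d A s x) = d"
  using pen_carrier[of h d A s x] by (auto simp del: pen_carrier)

lemma pen_mult:
  assumes A: "A \<in> SMn h d" and q: "q \<in> carrier_mat d c"
  shows "pen h d A s x * q = s \<cdot>\<^sub>m q - msum d c h (\<lambda>j. x j \<cdot>\<^sub>m (A ! j * q))"
proof -
  have "msum d d h (\<lambda>j. x j \<cdot>\<^sub>m A ! j) * q = msum d c h (\<lambda>j. x j \<cdot>\<^sub>m A ! j * q)"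
    using SMn_nth(1)[OF A] q by (intro msum_mult) auto
  also have "\<dots> = msum d c h (\<lambda>j. x j \<cdot>\<^sub>m (A ! j * q))"
  proof (rule msum_cong)
    fix j assume "j < h"
    thus "x j \<cdot>\<^sub>m A ! j * q = x j \<cdot>\<^sub>m (A ! j * q)"
      using SMn_nth(4)[OF A] q by (intro mat_smult_mult) simp
  qed
  finally show ?thesis using q by (simp add: pen_def mat_minus_mult mat_smult_mult mat_one_mult)
qed

lemma ip_pen:
  assumes A: "A \<in> SMn h d" and q: "q \<in> carrier_mat d c"
  shows "ip p (pen h d A s x * q) = s * ip p q - (\<Sum>j<h. x j * ip p (A ! j * q))"
proof -
  have "ip p (msum d c h (\<lambda>j. x j \<cdot>\<^sub>m (A ! j * q))) = (\<Sum>j<h. x j * ip p (A ! j * q))"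
    using q by (subst ip_msum)
      (auto simp: ip_smult_right intro!: smult_carrier_mat mult_carrier_mat[OF SMn_nth(1)[OF A]])
  thus ?thesis using q by (simp add: pen_mult[OF A q] ip_minus_right ip_smult_right)
qed

lemma pen_sym: "A \<in> SMn h d \<Longrightarrow> transpose_mat (pen h d A s x) = pen h d A s x"
proof -
  assume A: "A \<in> SMn h d"
  have "A ! j $$ (a, b) = A ! j $$ (b, a)" if "j < h" "a < d" "b < d" for j a b
    using index_transpose_mat(1)[of a "A ! j" b] SMn_nth[OF A that(1)] that by simp
  thus ?thesis
    unfolding pen_def using SMn_nth[OF A] by (intro eq_matI) (auto simp: msum_index intro!: sum.cong)
qed

lemma psd_pen_iff:
  assumes A: "A \<in> SMn h d"
  shows "psd d (pen h d A s x) \<longleftrightarrow> (\<forall>p\<in>carrier_mat d 1. 0 \<le> s * ip p p - (\<Sum>j<h. x j * ip p (A ! j * p)))"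
  using pen_sym[OF A] ip_pen[OF A] by (simp add: psd_iff_ip)

lemma form_outer_right:
  assumes A: "A \<in> SMn h d" and Y: "Y \<in> SMn h k" and N: "N \<in> carrier_mat d k"
    and q: "q \<in> carrier_mat d 1" and w: "w \<in> carrier_mat k 1"
  shows "form h A Y N (q * transpose_mat w)
    = ip (N * w) q - (\<Sum>j<h. ip (N * (Y ! j * w)) (A ! j * q))"
proof -
  have e: "ip N (p * transpose_mat v) = ip (N * v) p" if "p \<in> carrier_mat d 1" "v \<in> carrier_mat k 1" for p v
    using that N by (subst ip_mult_right) auto
  have "ip N (A ! j * (q * transpose_mat w) * Y ! j) = ip (N * (Y ! j * w)) (A ! j * q)" if j: "j < h" for j
  proof -
    note a = SMn_nth[OF A j] and y = SMn_nth[OF Y j]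
    have "A ! j * (q * transpose_mat w) * Y ! j = (A ! j * q) * transpose_mat (Y ! j * w)"
      using a y q w by (simp add: mat_ring)
    moreover have "A ! j * q \<in> carrier_mat d 1" "Y ! j * w \<in> carrier_mat k 1" using a y q w by auto
    ultimately show ?thesis by (simp only: e)
  qed
  thus ?thesis by (simp add: form_def e[OF q w])
qed

text \<open>On rank one arguments the form collapses to a d x d scalar pencil. This is the link
  between points of arbitrary size and level one, where the face lives.\<close>

lemma form_outer:
  assumes A: "A \<in> SMn h d" and Y: "Y \<in> SMn h k"
    and "p \<in> carrier_mat d 1" "q \<in> carrier_mat d 1" "v \<in> carrier_mat k 1" "w \<in> carrier_mat k 1"
  shows "form h A Y (p * transpose_mat v) (q * transpose_mat w)
    = ip p (pen h d A (ip v w) (\<lambda>j. ip v (Y ! j * w)) * q)"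
proof -
  have "ip (p * transpose_mat v) (A ! j * (q * transpose_mat w) * Y ! j) = ip v (Y ! j * w) * ip p (A ! j * q)"
    if j: "j < h" for j
  proof -
    note a = SMn_nth[OF A j] and y = SMn_nth[OF Y j]
    have "A ! j * (q * transpose_mat w) * Y ! j = (A ! j * q) * transpose_mat (Y ! j * w)"
      using a y assms by (simp add: mat_ring)
    moreover have "A ! j * q \<in> carrier_mat d 1" "Y ! j * w \<in> carrier_mat k 1" using a y assms by auto
    ultimately show ?thesis using ip_outer[of p d "A ! j * q" v k "Y ! j * w"] assms by simp
  qed
  thus ?thesis using assms by (simp add: form_def ip_outer[OF assms(3-6)] ip_pen[OF A])
qed

section \<open>Level one of a free spectrahedron\<close>

lemma tuple_of_vec_nth: "x \<in> carrier_vec h \<Longrightarrow> j < h \<Longrightarrow> tuple_of_vec x ! j = x $ j \<cdot>\<^sub>m 1\<^sub>m 1"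
  by (auto simp: tuple_of_vec_def intro!: eq_matI)

lemma tuple_of_vec_SMn: "x \<in> carrier_vec h \<Longrightarrow> tuple_of_vec x \<in> SMn h 1"
proof (rule SMnI)
  fix i assume "x \<in> carrier_vec h" "i < h"
  thus "tuple_of_vec x ! i \<in> carrier_mat 1 1" "transpose_mat (tuple_of_vec x ! i) = tuple_of_vec x ! i"
    by (auto simp: tuple_of_vec_nth intro!: eq_matI)
qed (auto simp: tuple_of_vec_def)

lemma level_one_iff:
  assumes h: "1 \<le> h" and A: "A \<in> SMn h d"
  shows "x \<in> level_one h (free_spec h d A) \<longleftrightarrow> x \<in> carrier_vec h \<and> psd d (pen h d A 1 (($) x))"
proof -
  have "tuple_of_vec x \<in> free_spec h d A \<longleftrightarrow> psd d (pen h d A 1 (($) x))" if x: "x \<in> carrier_vec h"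
  proof -
    have "form h A (tuple_of_vec x) M M = 1 * ip M M - (\<Sum>j<h. x $ j * ip M (A ! j * M))" if "M \<in> carrier_mat d 1" for M
      using that SMn_nth[OF A] by (simp add: form_def tuple_of_vec_nth[OF x] mat_mult_smult mat_mult_one ip_smult_right)
    thus ?thesis unfolding free_spec_iff[OF h A tuple_of_vec_SMn[OF x]] psd_pen_iff[OF A] by auto
  qed
  thus ?thesis by (auto simp: level_one_def)
qed

lemma free_spec_compression_closed:
  "1 \<le> h \<Longrightarrow> A \<in> SMn h d \<Longrightarrow> compression_closed h (free_spec h d A)"
  unfolding compression_closed_def using free_spec_conj_closed by blast

lemma free_spec_SMn: "Z \<in> free_spec h d A \<Longrightarrow> \<exists>p. Z \<in> SMn h p"
  by (auto simp: free_spec_def)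

section \<open>Faces in standard position\<close>

lemma pad_nth:
  assumes "length X = g" "j < h"
  shows "pad g h n X ! j = (if j < g then X ! j else if j = g then 1\<^sub>m n else 0\<^sub>m n n)"
  using assms by (auto simp: pad_def nth_append nth_Cons split: nat.split)

lemma pad_length: "length X = g \<Longrightarrow> g < h \<Longrightarrow> length (pad g h n X) = h"
  by (simp add: pad_def)

lemma pad_SMn: "X \<in> SMn g n \<Longrightarrow> g < h \<Longrightarrow> pad g h n X \<in> SMn h n"
  using SMn_nth[of X g n] SMnD[of X g n] by (intro SMnI) (auto simp: pad_length pad_nth)

lemma pad_inj: "length X = g \<Longrightarrow> length X' = g \<Longrightarrow> pad g h n X = pad g h n X' \<longleftrightarrow> X = X'"
  by (simp add: pad_def)

lemma pad_take:
  assumes Y: "Y \<in> SMn h n" and g: "g < h" and 1: "Y ! g = 1\<^sub>m n" and 0: "\<And>j. g < j \<Longrightarrow> j < h \<Longrightarrow> Y ! j = 0\<^sub>m n n"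
  shows "take g Y \<in> SMn g n" "Y = pad g h n (take g Y)"
proof -
  have l: "length (take g Y) = g" using SMnD(1)[OF Y] g by simp
  show "take g Y \<in> SMn g n" using SMn_nth[OF Y] SMnD[OF Y] g l by (intro SMnI) auto
  show "Y = pad g h n (take g Y)"
  proof (rule nth_equalityI)
    fix j assume "j < length Y"
    thus "Y ! j = pad g h n (take g Y) ! j"
      unfolding SMnD(1)[OF Y] using pad_nth[OF l, of j h n] 1 0[of j] by (cases "j < g"; cases "j = g") auto
  qed (use l pad_length[OF l g] SMnD(1)[OF Y] in simp)
qed

lemma conj_tuple_pad:
  assumes "X \<in> SMn g k" "g < h" "V \<in> carrier_mat k n" "transpose_mat V * V = 1\<^sub>m n" "1 \<le> n"
  shows "conj_tuple V (pad g h k X) = pad g h n (conj_tuple V X)"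
proof (rule nth_equalityI)
  note l = SMnD(1)[OF assms(1)]
  have lc: "length (conj_tuple V X) = g" using l by (simp add: conj_tuple_def)
  show "length (conj_tuple V (pad g h k X)) = length (pad g h n (conj_tuple V X))"
    using pad_length[OF l assms(2)] pad_length[OF lc assms(2)] by (simp add: conj_tuple_def)
  fix j assume "j < length (conj_tuple V (pad g h k X))"
  hence j: "j < h" using pad_length[OF l assms(2)] by (simp add: conj_tuple_def)
  show "conj_tuple V (pad g h k X) ! j = pad g h n (conj_tuple V X) ! j"
    using j pad_length[OF l assms(2)] assms(3,4) SMn_nth[OF assms(1)]
    by (simp add: conj_tuple_nth pad_nth[OF l j] pad_nth[OF lc j] l mat_mult_one mat_mult_zero mat_zero_mult)
qed

section \<open>The matrix affine hull of the face\<close>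

lemma sum_split_tail:
  fixes f :: "nat \<Rightarrow> real"
  assumes "g < h" "\<And>j. g < j \<Longrightarrow> j < h \<Longrightarrow> f j = 0"
  shows "(\<Sum>j<h. f j) = (\<Sum>j<g. f j) + f g"
proof -
  have "(\<Sum>j<h. f j) = (\<Sum>j<Suc g. f j)"
    using assms by (intro sum.mono_neutral_right) auto
  thus ?thesis by simp
qed

text \<open>\<open>mconv_data\<close> numbers its terms by an initial segment of the naturals, while
  the combination below is naturally indexed by pairs with a sign.\<close>

lemma exists_enumeration:
  assumes "finite S"
  obtains m :: nat and \<phi> where "\<And>l. l < m \<Longrightarrow> \<phi> l \<in> S" "\<And>f :: _ \<Rightarrow> real. (\<Sum>l<m. f (\<phi> l)) = (\<Sum>s\<in>S. f s)"
proof -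
  obtain \<phi> where b: "bij_betw \<phi> {0..<card S} S" using ex_bij_betw_nat_finite[OF assms] by blast
  show ?thesis
  proof (rule that[of "card S" \<phi>])
    show "\<phi> l \<in> S" if "l < card S" for l using b that by (auto simp: bij_betw_def)
    show "(\<Sum>l<card S. f (\<phi> l)) = (\<Sum>s\<in>S. f s)" for f :: "_ \<Rightarrow> real"
      using sum.reindex_bij_betw[OF b, of f] by (simp add: lessThan_atLeast0)
  qed
qed

text \<open>The matrix units are recovered from rank one matrices by polarisation: the vectors
  \<open>e\<^sub>a + e\<^sub>b\<close> and \<open>e\<^sub>a - e\<^sub>b\<close>, each scaled by \<open>1 / (2 \<surd>n)\<close>, carry the points
  \<open>n X\<^sub>a\<^sub>b\<close> and \<open>- n X\<^sub>a\<^sub>b\<close>.\<close>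

lemma symmetric_tuple_matrix_affine:
  assumes X: "X \<in> SMn g n" and gh: "g < h"
    and aff: "aff_hull h F = {x \<in> carrier_vec h. x $ g = 1 \<and> (\<forall>j. g < j \<and> j < h \<longrightarrow> x $ j = 0)}"
  shows "pad g h n X \<in> matrix_affine_hull h F"
proof -
  have n: "1 \<le> n" using SMnD(2)[OF X] .
  \<comment> \<open>Pairs a = b are included. With sign -1 their vector is zero, which a combination
    in the hull may contain.\<close>
  define S where "S = ({..<n} \<times> {..<n}) \<times> {-1, 1 :: real}"
  have sumS: "(\<Sum>s\<in>S. f s) = (\<Sum>a<n. \<Sum>b<n. f ((a, b), -1) + f ((a, b), 1))" for f :: "_ \<Rightarrow> real"
  proof -
    have "(\<Sum>s\<in>S. f s) = (\<Sum>x\<in>{..<n} \<times> {..<n}. \<Sum>t\<in>{-1, 1}. f (x, t))"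
      unfolding S_def sum.cartesian_product by (simp add: case_prod_unfold)
    also have "\<dots> = (\<Sum>x\<in>{..<n} \<times> {..<n}. f (x, -1) + f (x, 1))" by simp
    also have "\<dots> = (\<Sum>a<n. \<Sum>b<n. f ((a, b), -1) + f ((a, b), 1))"
      unfolding sum.cartesian_product by (simp add: case_prod_unfold)
    finally show ?thesis .
  qed
  obtain m :: nat and \<phi> where \<phi>: "\<And>l. l < m \<Longrightarrow> \<phi> l \<in> S"
    and sum: "\<And>f :: _ \<Rightarrow> real. (\<Sum>l<m. f (\<phi> l)) = (\<Sum>s\<in>S. f s)"
    using exists_enumeration[of S] by (auto simp: S_def)
  \<comment> \<open>For fixed a, b the two signs add up to 2 c^2 (e_a e_a^T + e_b e_b^T). Over all
    pairs this is 4 n c^2 I, which has to be I.\<close>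
  define c where "c = 1 / (2 * sqrt (real n))"
  have cc: "c * c = 1 / (4 * real n)" using n by (simp add: c_def)
  define W where "W = (\<lambda>s :: (nat \<times> nat) \<times> real. mat 1 n (\<lambda>(_, r).
     c * ((if r = fst (fst s) then 1 else 0) + snd s * (if r = snd (fst s) then 1 else 0))))"
  \<comment> \<open>With the sign as weight, the two rank one matrices leave 2 c^2 (e_a e_b^T + e_b
    e_a^T). The factor n turns the coefficient into X_ab / 2, and the sum over all pairs is (X +
    X^T) / 2 = X.\<close>
  define y where "y = (\<lambda>s :: (nat \<times> nat) \<times> real. vec h (\<lambda>j.
     if j < g then snd s * real n * X ! j $$ fst s else if j = g then 1 else 0))"
  have y: "y s \<in> aff_hull h F" for s using gh by (auto simp: aff y_def)
  hence yc: "y s \<in> carrier_vec h" for s by (simp add: y_def)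
  have quad: "(transpose_mat (W s) * (t \<cdot>\<^sub>m 1\<^sub>m 1) * W s) $$ (r, r')
      = t * (c * c) * (((if r = fst (fst s) then 1 else 0) + snd s * (if r = snd (fst s) then 1 else 0))
       * ((if r' = fst (fst s) then 1 else 0) + snd s * (if r' = snd (fst s) then 1 else 0)))"
    if "r < n" "r' < n" for s t r r'
    using that by (simp add: W_def index_mult_sum del: index_mult_mat(1))
  have delta: "(\<Sum>a<n. \<Sum>b<n. f a b * ((if r = a then 1 else 0) * (if r' = b then 1 else 0))) = f r r'"
    if "r < n" "r' < n" for f :: "nat \<Rightarrow> nat \<Rightarrow> real" and r r'
  proof -
    have "(\<Sum>a<n. \<Sum>b<n. f a b * ((if r = a then 1 else 0) * (if r' = b then 1 else 0)))
        = (\<Sum>a<n. \<Sum>b<n. if b = r' then (if a = r then f a b else 0) else 0)"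
      by (intro sum.cong refl) auto
    thus ?thesis using that by simp
  qed
  have one: "(\<Sum>s\<in>S. (transpose_mat (W s) * (1 \<cdot>\<^sub>m 1\<^sub>m 1) * W s) $$ (r, r')) = (if r = r' then 1 else 0)"
    if r: "r < n" "r' < n" for r r'
  proof -
    have "(\<Sum>s\<in>S. (transpose_mat (W s) * (1 \<cdot>\<^sub>m 1\<^sub>m 1) * W s) $$ (r, r'))
      = (\<Sum>a<n. \<Sum>b<n. (1 / (2 * real n)) * ((if r = a then 1 else 0) * (if r' = a then 1 else 0)
            + (if r = b then 1 else 0) * (if r' = b then 1 else 0)))"
      unfolding sumS quad[OF r] cc by (intro sum.cong refl) (auto simp: field_simps)
    also have "\<dots> = (\<Sum>a<n. if r = a \<and> r' = a then 1 / 2 else 0) + (\<Sum>b<n. if r = b \<and> r' = b then 1 / 2 else 0)"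
    proof -
      have "(\<Sum>a<n. \<Sum>b<n. (1 / (2 * real n)) * ((if r = a then 1 else 0) * (if r' = a then 1 else 0)))
          = (\<Sum>a<n. if r = a \<and> r' = a then 1 / 2 else 0)"
        using n by (intro sum.cong refl) auto
      moreover have "(\<Sum>a<n. \<Sum>b<n. (1 / (2 * real n)) * ((if r = b then 1 else 0) * (if r' = b then 1 else 0)))
          = (\<Sum>b<n. if r = b \<and> r' = b then 1 / 2 else 0)"
        using n by (subst sum.swap, intro sum.cong refl) auto
      ultimately show ?thesis by (simp add: distrib_left sum.distrib)
    qed
    also have "\<dots> = (if r = r' then 1 else 0)"
      using r by (cases "r = r'") (auto simp: sum.delta intro!: sum.neutral)
    finally show ?thesis .
  qed
  have entry: "(\<Sum>s\<in>S. (transpose_mat (W s) * ((snd s * real n * X ! j $$ fst s) \<cdot>\<^sub>m 1\<^sub>m 1) * W s) $$ (r, r'))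
      = X ! j $$ (r, r')" if j: "j < g" and r: "r < n" "r' < n" for j r r'
  proof -
    have "(\<Sum>s\<in>S. (transpose_mat (W s) * ((snd s * real n * X ! j $$ fst s) \<cdot>\<^sub>m 1\<^sub>m 1) * W s) $$ (r, r'))
      = (\<Sum>a<n. \<Sum>b<n. (X ! j $$ (a, b) / 2) * ((if r = a then 1 else 0) * (if r' = b then 1 else 0))
            + (X ! j $$ (a, b) / 2) * ((if r' = a then 1 else 0) * (if r = b then 1 else 0)))"
      unfolding sumS quad[OF r] cc using n by (intro sum.cong refl) (auto simp: field_simps)
    also have "\<dots> = X ! j $$ (r, r') / 2 + X ! j $$ (r', r) / 2"
      by (simp only: sum.distrib delta[OF r(1) r(2)] delta[OF r(2) r(1)])
    also have "X ! j $$ (r', r) = X ! j $$ (r, r')"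
      using index_transpose_mat(1)[of r' "X ! j" r] SMn_nth[OF X j] r by simp
    finally show ?thesis by simp
  qed
  define V Y where "V = (\<lambda>l. W (\<phi> l))" and "Y = (\<lambda>l. tuple_of_vec (y (\<phi> l)))"
  have data: "mconv_data h (tuple_of_vec ` aff_hull h F) n m (\<lambda>_. 1) V Y"
    unfolding mconv_data_def
  proof (intro conjI allI impI)
    fix l assume "l < m"
    show "Y l \<in> tuple_of_vec ` aff_hull h F \<inter> SMn h 1" using y tuple_of_vec_SMn[OF yc] by (auto simp: Y_def)
    show "V l \<in> carrier_mat 1 n" by (simp add: V_def W_def)
  next
    have e: "transpose_mat (W s) * W s = transpose_mat (W s) * (1 \<cdot>\<^sub>m 1\<^sub>m 1) * W s" for s
      by (auto simp: W_def mat_mult_one intro!: arg_cong2[where f = "(*)"] eq_matI)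
    show "msum n n m (\<lambda>l. transpose_mat (V l) * V l) = 1\<^sub>m n"
    proof (rule eq_matI)
      fix r r' assume "r < dim_row (1\<^sub>m n :: real mat)" "r' < dim_col (1\<^sub>m n :: real mat)"
      hence r: "r < n" "r' < n" by auto
      show "msum n n m (\<lambda>l. transpose_mat (V l) * V l) $$ (r, r') = 1\<^sub>m n $$ (r, r')"
        unfolding msum_index[OF r] V_def
          sum[of "\<lambda>s. (transpose_mat (W s) * W s) $$ (r, r')"]
        unfolding e one[OF r] using r by simp
    qed auto
  qed
  have "mconv_value h n m V Y = pad g h n X"
  proof (rule nth_equalityI)
    note l = SMnD(1)[OF X]
    show "length (mconv_value h n m V Y) = length (pad g h n X)"
      by (simp add: pad_length[OF l gh] mconv_value_def)
    fix j assume "j < length (mconv_value h n m V Y)"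
    hence j: "j < h" by (simp add: mconv_value_def)
    define t where "t = (\<lambda>s. if j < g then snd s * real n * X ! j $$ fst s else if j = g then 1 else 0)"
    have Yj: "Y l ! j = t (\<phi> l) \<cdot>\<^sub>m 1\<^sub>m 1" for l
      unfolding Y_def tuple_of_vec_nth[OF yc j] by (simp add: y_def j t_def)
    have val: "mconv_value h n m V Y ! j $$ (r, r')
        = (\<Sum>s\<in>S. (transpose_mat (W s) * (t s \<cdot>\<^sub>m 1\<^sub>m 1) * W s) $$ (r, r'))" if r: "r < n" "r' < n" for r r'
      unfolding mconv_value_nth[OF data j] msum_index[OF r]
      unfolding V_def Yj
      by (rule sum[of "\<lambda>s. (transpose_mat (W s) * (t s \<cdot>\<^sub>m 1\<^sub>m 1) * W s) $$ (r, r')"])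
    note S = SMn_nth[OF mconv_value_SMn[OF data n] j] SMn_nth[OF pad_SMn[OF X gh] j]
    show "mconv_value h n m V Y ! j = pad g h n X ! j"
    proof (rule eq_matI)
      fix r r' assume "r < dim_row (pad g h n X ! j)" "r' < dim_col (pad g h n X ! j)"
      hence r: "r < n" "r' < n" using S by auto
      consider "j < g" | "j = g" | "\<not> j < g" "j \<noteq> g" by blast
      thus "mconv_value h n m V Y ! j $$ (r, r') = pad g h n X ! j $$ (r, r')"
      proof cases
        case 1
        thus ?thesis using entry[OF 1 r] by (simp add: val[OF r] pad_nth[OF l j] t_def del: index_mult_mat(1))
      next
        case 2
        thus ?thesis unfolding val[OF r] pad_nth[OF l j]
          using one[OF r] r by (simp add: t_def del: index_mult_mat(1))
      next
        case 3
        hence "t s = 0" for s by (simp add: t_def)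
        thus ?thesis using 3 r unfolding val[OF r] quad[OF r] by (simp add: pad_nth[OF l j])
      qed
    qed (use S in auto)
  qed
  thus ?thesis unfolding matrix_affine_hull_def matrix_convex_hull_def 
    using data n by (intro CollectI exI[of _ n] exI[of _ m] exI[of _ "\<lambda>_. 1"] exI[of _ V] exI[of _ Y]) simp
qed

text \<open>Coordinate g is 1 on the affine hull, so entry g of a combination is the sum of the
  V_l^T V_l; the coordinates after g are 0 and remain so.\<close>

lemma matrix_affine_hull_pad:
  assumes gh: "g < h"
    and aff: "aff_hull h F = {x \<in> carrier_vec h. x $ g = 1 \<and> (\<forall>j. g < j \<and> j < h \<longrightarrow> x $ j = 0)}"
    and Z: "Z \<in> matrix_affine_hull h F"
  shows "\<exists>n X. X \<in> SMn g n \<and> Z = pad g h n X"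
proof -
  obtain n m k V Y where Zv: "Z = mconv_value h n m V Y" and n: "1 \<le> n"
    and data: "mconv_data h (tuple_of_vec ` aff_hull h F) n m k V Y"
    using Z unfolding matrix_affine_hull_def matrix_convex_hull_def by blast
  note D = mconv_dataD[OF data]
  have Yl: "Y l ! g = 1\<^sub>m (k l) \<and> (\<forall>j. g < j \<and> j < h \<longrightarrow> Y l ! j = 0\<^sub>m (k l) (k l))" if l: "l < m" for l
  proof -
    obtain x where x: "Y l = tuple_of_vec x" "x \<in> aff_hull h F" using D(1)[OF l] by blast
    hence xc: "x \<in> carrier_vec h" "x $ g = 1" "\<And>j. g < j \<Longrightarrow> j < h \<Longrightarrow> x $ j = 0" by (auto simp: aff)
    have "k l = 1" using SMn_size_unique[OF D(2)[OF l]] tuple_of_vec_SMn[OF xc(1)] x(1) gh by auto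
    thus ?thesis using xc gh by (auto simp: x(1) tuple_of_vec_nth intro!: eq_matI)
  qed
  note S = mconv_value_SMn[OF data n, folded Zv]
  have "Z ! g = msum n n m (\<lambda>l. transpose_mat (V l) * V l)"
    unfolding Zv mconv_value_nth[OF data gh]
  proof (rule msum_cong)
    fix l assume "l < m"
    thus "transpose_mat (V l) * Y l ! g * V l = transpose_mat (V l) * V l"
      using Yl D(3)[of l] by (simp add: mat_mult_one)
  qed
  hence 1: "Z ! g = 1\<^sub>m n" by (simp add: D(4))
  have 0: "Z ! j = 0\<^sub>m n n" if j: "g < j" "j < h" for j
  proof -
    have "Z ! j = msum n n m (\<lambda>l. 0\<^sub>m n n)"
      unfolding Zv mconv_value_nth[OF data j(2)]
    proof (rule msum_cong)
      fix l assume l: "l < m"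
      thus "transpose_mat (V l) * Y l ! j * V l = 0\<^sub>m n n"
        using Yl[OF l] j D(3)[OF l] by (simp add: mat_mult_zero mat_zero_mult)
    qed
    thus ?thesis by (simp add: msum_index) (auto intro!: eq_matI simp: msum_index)
  qed
  show ?thesis using pad_take[OF S gh 1 0] by blast
qed

lemma psd_add_one: "psd n P \<Longrightarrow> psd n (P + 1\<^sub>m n)"
proof -
  assume P: "psd n P"
  have "transpose_mat (P + 1\<^sub>m n) = P + 1\<^sub>m n"
    using psd_carrier[OF P] psd_sym[OF P] by (simp add: transpose_add[of _ n n])
  moreover have "0 \<le> ip v ((P + 1\<^sub>m n) * v)" if v: "v \<in> carrier_mat n 1" for v
    using psd_carrier[OF P] psd_nonneg[OF P v] ip_self_nonneg[of v] v
    by (simp add: mat_add_mult mat_one_mult ip_add_right)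
  ultimately show ?thesis using psd_carrier[OF P] by (simp add: psd_iff_ip)
qed

section \<open>The face, the kernel of B and the monic pencil\<close>

locale standard_face =
  fixes g h d :: nat and A :: "real mat list" and F :: "real vec set"
  assumes g: "1 \<le> g" and gh: "g < h" and A: "A \<in> SMn h d"
    and face: "is_face (level_one h (free_spec h d A)) F"
    and pos: "standard_position h g (level_one h (free_spec h d A)) F"
begin

abbreviation D where "D \<equiv> free_spec h d A"
abbreviation G where "G \<equiv> graded_lift h D F"

lemma h: "1 \<le> h" using gh by simp

lemma aff: "aff_hull h F = {x \<in> carrier_vec h. x $ g = 1 \<and> (\<forall>j. g < j \<and> j < h \<longrightarrow> x $ j = 0)}"
  using pos by (simp add: standard_position_def)

lemma G_iff: "Z \<in> G \<longleftrightarrow> Z \<in> D \<and> (\<exists>n X. X \<in> SMn g n \<and> Z = pad g h n X)"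
  using matrix_affine_hull_pad[OF gh aff] symmetric_tuple_matrix_affine[OF _ gh aff]
  by (auto simp: graded_lift_def)

lemma pad_mem_G: "X \<in> SMn g n \<Longrightarrow> pad g h n X \<in> G \<longleftrightarrow> pad g h n X \<in> D"
  using G_iff by blast

lemma face_subset: "F \<subseteq> level_one h D"
  using face by (simp add: is_face_def)

lemma level_one_carrier: "x \<in> level_one h D \<Longrightarrow> x \<in> carrier_vec h"
  by (simp add: level_one_def)

lemma face_coordinates:
  assumes x: "x \<in> F"
  shows "x $ g = 1" "\<And>j. g < j \<Longrightarrow> j < h \<Longrightarrow> x $ j = 0"
proof -
  have "x = vec h (\<lambda>j. \<Sum>l<Suc 0. 1 * x $ j)"
    using level_one_carrier[of x] face_subset x by (intro eq_vecI) auto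
  hence "x \<in> aff_hull h F"
    unfolding aff_hull_def using x by (intro CollectI exI[of _ "Suc 0"] exI[of _ "\<lambda>_. 1"] exI[of _ "\<lambda>_. x"]) auto
  thus "x $ g = 1" "\<And>j. g < j \<Longrightarrow> j < h \<Longrightarrow> x $ j = 0" unfolding aff by auto
qed

lemma face_ball:
  obtains \<epsilon> where "\<epsilon> > 0" "\<And>y. y \<in> aff_hull h F \<Longrightarrow>
    sqrt ((y - unit_vec h g) \<bullet> (y - unit_vec h g)) < \<epsilon> \<Longrightarrow> y \<in> F"
  using pos unfolding standard_position_def rel_int_def by blast

text \<open>Prolong the segment from x to the relative interior point p slightly beyond p, to a
  point y of F. Then p lies strictly between x and y, and the face property puts x into F.\<close>

lemma face_iff:
  "x \<in> F \<longleftrightarrow> x \<in> level_one h D \<and> x $ g = 1 \<and> (\<forall>j. g < j \<and> j < h \<longrightarrow> x $ j = 0)"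
proof
  assume "x \<in> F"
  thus "x \<in> level_one h D \<and> x $ g = 1 \<and> (\<forall>j. g < j \<and> j < h \<longrightarrow> x $ j = 0)"
    using face_subset face_coordinates by blast
next
  assume r: "x \<in> level_one h D \<and> x $ g = 1 \<and> (\<forall>j. g < j \<and> j < h \<longrightarrow> x $ j = 0)"
  hence xc: "x \<in> carrier_vec h" using level_one_carrier by blast
  obtain \<epsilon> where e: "\<epsilon> > 0" and ball: "\<And>y. y \<in> aff_hull h F \<Longrightarrow>
    sqrt ((y - unit_vec h g) \<bullet> (y - unit_vec h g)) < \<epsilon> \<Longrightarrow> y \<in> F"
    using face_ball by blast
  define p :: "real vec" where "p = unit_vec h g"
  have pc: "p \<in> carrier_vec h" by (simp add: p_def)
  define N where "N = sqrt ((x - p) \<bullet> (x - p))"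
  have N: "N \<ge> 0" by (simp add: N_def scalar_prod_def sum_nonneg)
  \<comment> \<open>A step of length s N < \<epsilon> beyond p; N + 1 in the denominator admits x =
    p.\<close>
  define s where "s = \<epsilon> / (2 * (N + 1))"
  have s: "s > 0" using e N by (simp add: s_def)
  define y where "y = p - s \<cdot>\<^sub>v (x - p)"
  have yc: "y \<in> carrier_vec h" using xc pc by (simp add: y_def)
  have "y \<in> aff_hull h F"
    using r xc pc yc gh unfolding aff by (auto simp: y_def p_def)
  moreover have "sqrt ((y - p) \<bullet> (y - p)) < \<epsilon>"
  proof -
    have "(y - p) \<bullet> (y - p) = s\<^sup>2 * ((x - p) \<bullet> (x - p))"
      using xc pc by (simp add: y_def scalar_prod_def sum_distrib_left power2_eq_square algebra_simps)
    hence "sqrt ((y - p) \<bullet> (y - p)) = s * N" using s by (simp add: real_sqrt_mult N_def)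
    also have "\<dots> < \<epsilon>" using e N by (simp add: s_def field_simps add_nonneg_pos)
    finally show ?thesis .
  qed
  ultimately have y: "y \<in> F" using ball by (simp add: p_def)
  \<comment> \<open>Solves t = (1 - t) s, so that the deviations of x and y from p cancel.\<close>
  define t where "t = s / (1 + s)"
  have t: "0 < t" "t < 1" using s by (simp_all add: t_def)
  have "t \<cdot>\<^sub>v x + (1 - t) \<cdot>\<^sub>v y = p"
  proof (rule eq_vecI)
    fix i assume "i < dim_vec p"
    hence i: "i < h" using pc by simp
    have "(1 - t) * s = t" using s by (simp add: t_def field_simps)
    moreover have "t * x $ i + (1 - t) * (p $ i - s * (x $ i - p $ i))
        = t * x $ i + (1 - t) * p $ i - ((1 - t) * s) * (x $ i - p $ i)"
      by (simp add: algebra_simps)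
    ultimately have "t * x $ i + (1 - t) * (p $ i - s * (x $ i - p $ i))
        = t * x $ i + (1 - t) * p $ i - t * (x $ i - p $ i)" by (simp only:)
    also have "\<dots> = p $ i" by (simp add: algebra_simps)
    finally have "t * x $ i + (1 - t) * (p $ i - s * (x $ i - p $ i)) = p $ i" .
    thus "(t \<cdot>\<^sub>v x + (1 - t) \<cdot>\<^sub>v y) $ i = p $ i" using i xc pc by (simp add: y_def)
  qed (use xc pc yc in auto)
  moreover have "p \<in> F" using pos by (simp add: standard_position_def rel_int_def p_def)
  ultimately show "x \<in> F"
    using face r y face_subset t unfolding is_face_def by blast
qed

abbreviation B where "B \<equiv> pen h d A 1 (\<lambda>j. if j = g then 1 else 0)"

lemma ip_B: "q \<in> carrier_mat d c \<Longrightarrow> ip p (B * q) = ip p q - ip p (A ! g * q)"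
  using gh by (simp add: ip_pen[OF A] if_distrib if_distribR sum.delta cong: if_cong)

lemma psd_B: "psd d B"
proof -
  have "unit_vec h g \<in> level_one h D" using pos face_subset by (auto simp: standard_position_def rel_int_def)
  hence "psd d (pen h d A 1 (($) (unit_vec h g)))" by (simp add: level_one_iff[OF h A])
  moreover have "pen h d A 1 (($) (unit_vec h g)) = B"
    unfolding pen_def using gh by (intro arg_cong2[where f = "(-)"] refl msum_cong) simp
  ultimately show ?thesis by simp
qed

text \<open>The face contains small displacements of its central point along coordinate i in both
  directions, so B - \<delta> A_i and B + \<delta> A_i are psd. On the kernel of B their values are
  opposite, hence zero; a psd matrix with value zero at q kills q, and only \<delta> A_i q is
  left.\<close>

lemma kernel_B:
  assumes i: "i < g" and q: "q \<in> carrier_mat d 1" and Bq: "B * q = 0\<^sub>m d 1"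
  shows "A ! i * q = 0\<^sub>m d 1"
proof -
  obtain \<epsilon> where e: "\<epsilon> > 0" and ball: "\<And>y. y \<in> aff_hull h F \<Longrightarrow>
    sqrt ((y - unit_vec h g) \<bullet> (y - unit_vec h g)) < \<epsilon> \<Longrightarrow> y \<in> F"
    using face_ball by blast
  have ih: "i < h" using i gh by simp
  note a = SMn_nth[OF A ih]
  define x where "x = (\<lambda>\<delta> :: real. vec h (\<lambda>j. if j = g then 1 else if j = i then \<delta> else 0))"
  have psdx: "psd d (pen h d A 1 (($) (x \<delta>)))" if "\<bar>\<delta>\<bar> < \<epsilon>" for \<delta>
  proof -
    have "(x \<delta> - unit_vec h g) \<bullet> (x \<delta> - unit_vec h g) = (\<Sum>j<h. if j = i then \<delta>\<^sup>2 else 0)"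
      using i gh unfolding scalar_prod_def lessThan_atLeast0
      by (intro sum.cong) (auto simp: x_def power2_eq_square)
    hence "(x \<delta> - unit_vec h g) \<bullet> (x \<delta> - unit_vec h g) = \<delta>\<^sup>2" using ih by simp
    moreover have "x \<delta> \<in> aff_hull h F" using gh i by (auto simp: aff x_def)
    ultimately have "x \<delta> \<in> F" using ball[of "x \<delta>"] that by simp
    thus ?thesis using face_subset level_one_iff[OF h A] by blast
  qed
  have ipx: "ip p (pen h d A 1 (($) (x \<delta>)) * q) = ip p (B * q) - \<delta> * ip p (A ! i * q)" for p \<delta>
  proof -
    have "(\<Sum>j<h. x \<delta> $ j * ip p (A ! j * q)) = (\<Sum>j<h. (if j = g then ip p (A ! j * q) else 0)
        + (if j = i then \<delta> * ip p (A ! j * q) else 0))"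
      using i by (intro sum.cong refl) (auto simp: x_def)
    also have "\<dots> = ip p (A ! g * q) + \<delta> * ip p (A ! i * q)"
      using gh ih by (simp add: sum.distrib)
    finally show ?thesis unfolding ip_pen[OF A q, of p 1] ip_B[OF q] by simp
  qed
  have 0: "ip p (B * q) = 0" for p by (simp add: Bq)
  define \<delta> where "\<delta> = \<epsilon> / 2"
  have \<delta>: "\<delta> > 0" "\<bar>\<delta>\<bar> < \<epsilon>" "\<bar>- \<delta>\<bar> < \<epsilon>" using e by (simp_all add: \<delta>_def)
  have "0 \<le> - (\<delta> * ip q (A ! i * q))" "0 \<le> \<delta> * ip q (A ! i * q)"
    using psd_nonneg[OF psdx[OF \<delta>(2)] q] psd_nonneg[OF psdx[OF \<delta>(3)] q] unfolding ipx 0 by simp_all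
  hence "\<delta> * ip q (A ! i * q) = 0" by simp
  hence "ip q (pen h d A 1 (($) (x \<delta>)) * q) = 0" unfolding ipx 0 by simp
  hence "pen h d A 1 (($) (x \<delta>)) * q = 0\<^sub>m d 1" by (rule psd_kernel[OF psdx[OF \<delta>(2)] q])
  hence "ip (A ! i * q) (A ! i * q) = 0"
    using ipx[of "A ! i * q" \<delta>] \<delta>(1) unfolding 0 by simp
  from ip_self_zero[OF this] show ?thesis using a q by simp
qed

lemma form_pad:
  assumes X: "X \<in> SMn g n" and M: "M \<in> carrier_mat d n" and N: "N \<in> carrier_mat d n"
  shows "form h A (pad g h n X) M N = ip M (B * N) - (\<Sum>i<g. ip M (A ! i * N * X ! i))"
proof -
  note l = SMnD(1)[OF X]
  have "(\<Sum>j<h. ip M (A ! j * N * pad g h n X ! j))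
      = (\<Sum>j<g. ip M (A ! j * N * pad g h n X ! j)) + ip M (A ! g * N * pad g h n X ! g)"
    using gh N SMn_nth[OF A] by (intro sum_split_tail) (auto simp: pad_nth[OF l] mat_mult_zero)
  also have "\<dots> = (\<Sum>j<g. ip M (A ! j * N * X ! j)) + ip M (A ! g * N)"
    using gh N by (simp add: pad_nth[OF l] mat_mult_one)
  finally show ?thesis unfolding form_def ip_B[OF N] by simp
qed

text \<open>Substituting M = W N, with W orthonormal for B, turns B into I and A_i into W^T A_i W.
  Such M suffice because the form of a padded tuple depends on M only modulo the kernel of
  B.\<close>

lemma free_spectrahedron_pad:
  "\<exists>d'. \<exists>C\<in>SMn g d'. \<forall>n. \<forall>X\<in>SMn g n. pad g h n X \<in> D \<longleftrightarrow> X \<in> free_spec g d' C"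
proof -
  obtain r W where W: "W \<in> carrier_mat d r" and WBW: "transpose_mat W * (B * W) = 1\<^sub>m r"
    and BWB: "B * (W * (transpose_mat W * B)) = B"
    using psd_gram_schmidt[OF psd_B] by blast
  have [simp]: "dim_row W = d" "dim_col W = r" using W by auto
  note symB = psd_sym[OF psd_B]
  \<comment> \<open>The projection along the kernel of B. As e - Q e is in that kernel for every
    basis column e, \<open>kernel_B\<close> gives A_i Q = A_i.\<close>
  define Q where "Q = W * (transpose_mat W * B)"
  have Q: "Q \<in> carrier_mat d d" by (auto simp: Q_def)
  have [simp]: "dim_row Q = d" "dim_col Q = d" using Q by auto
  have AQ: "A ! i * Q = A ! i" if i: "i < g" for i
  proof -
    have a: "A ! i \<in> carrier_mat d d" "dim_row (A ! i) = d" "dim_col (A ! i) = d"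
      using SMn_nth[OF A, of i] i gh by auto
    show ?thesis
    proof (rule mat_eq_by_cols)
      fix c assume "c < d"
      have "B * (Q * basis_col d c) = (B * Q) * basis_col d c" by (simp add: mat_assoc)
      hence "B * (basis_col d c - Q * basis_col d c) = 0\<^sub>m d 1"
        using BWB by (simp add: Q_def mat_mult_minus) (auto intro!: eq_matI)
      hence "A ! i * (basis_col d c - Q * basis_col d c) = 0\<^sub>m d 1"
        using Q by (intro kernel_B[OF i]) (auto intro!: carrier_matI)
      hence 0: "A ! i * basis_col d c - A ! i * (Q * basis_col d c) = 0\<^sub>m d 1"
        using a by (simp add: mat_mult_minus)
      show "A ! i * Q * basis_col d c = A ! i * basis_col d c"
      proof (rule eq_matI)
        fix u v assume "u < dim_row (A ! i * basis_col d c)" "v < dim_col (A ! i * basis_col d c)"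
        hence uv: "u < d" "v = 0" using a by auto
        show "(A ! i * Q * basis_col d c) $$ (u, v) = (A ! i * basis_col d c) $$ (u, v)"
          using arg_cong[OF 0, of "\<lambda>M. M $$ (u, v)"] uv a by (simp add: mat_assoc del: index_mult_mat(1))
      qed (use a in auto)
    qed (use a Q in auto)
  qed
  have QA: "transpose_mat Q * A ! i = A ! i" if i: "i < g" for i
    using arg_cong[OF AQ[OF i], of transpose_mat] SMn_nth[OF A, of i] i gh by (simp add: mat_transpose_mult)
  show ?thesis
  proof (cases "r = 0")
    \<comment> \<open>\<open>SMn\<close> has no matrices of size 0, so the empty pencil is replaced
      by the zero pencil of size 1; both sides then hold for every X.\<close>
    case True
    have z: "Q = 0\<^sub>m d d"
      using W True by (intro eq_matI) (auto simp: Q_def index_mult_sum simp del: index_mult_mat(1))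
    have A0: "A ! i = 0\<^sub>m d d" if "i < g" for i
      using AQ[OF that] SMn_nth[OF A, of i] that gh by (simp add: z mat_mult_zero)
    have B0: "B = 0\<^sub>m d d" using BWB z by (simp add: Q_def[symmetric] mat_mult_zero)
    define C where "C = replicate g (0\<^sub>m 1 1 :: real mat)"
    have C: "C \<in> SMn g 1" by (intro SMnI) (auto simp: C_def)
    have "pad g h n X \<in> D \<longleftrightarrow> X \<in> free_spec g 1 C" if X: "X \<in> SMn g n" for n X
    proof -
      have "form h A (pad g h n X) M M = 0" if M: "M \<in> carrier_mat d n" for M
        unfolding form_pad[OF X M M] using M SMn_nth[OF X] by (simp add: A0 B0 mat_zero_mult)
      hence "pad g h n X \<in> D" unfolding free_spec_iff[OF h A pad_SMn[OF X gh]] by simp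
      moreover have "form g C X M M = ip M M" if M: "M \<in> carrier_mat 1 n" for M
        unfolding form_def using M SMn_nth[OF X] by (simp add: C_def mat_zero_mult)
      hence "X \<in> free_spec g 1 C" unfolding free_spec_iff[OF g C X] by (simp add: ip_self_nonneg)
      ultimately show ?thesis by simp
    qed
    thus ?thesis using C by blast
  next
    case False
    define C where "C = conj_tuple W (take g A)"
    have tA: "take g A \<in> SMn g d" using SMn_nth[OF A] SMnD[OF A] gh by (intro SMnI) auto
    have C: "C \<in> SMn g r" unfolding C_def by (rule conj_tuple_SMn[OF tA W]) (use False in simp)
    have Ci: "C ! i = transpose_mat W * A ! i * W" if "i < g" for i
      using that SMnD(1)[OF tA] by (simp add: C_def conj_tuple_nth)
    have dimA: "dim_row (A ! i) = d" "dim_col (A ! i) = d" if "i < g" for i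
      using SMn_nth[OF A, of i] that gh by auto
    have 1: "form g C X N N = form h A (pad g h n X) (W * N) (W * N)"
      if X: "X \<in> SMn g n" and N: "N \<in> carrier_mat r n" for n X N
    proof -
      have WN: "W * N \<in> carrier_mat d n" using W N by auto
      have "ip (W * N) (B * (W * N)) = ip N (transpose_mat W * (B * W) * N)"
        using N by (subst ip_comm, simp, simp, subst ip_mult_left, simp, simp, simp)
          (subst ip_comm, auto simp: mat_ring symB)
      hence e: "ip (W * N) (B * (W * N)) = ip N N" using N by (simp add: WBW mat_one_mult)
      have "ip (W * N) (A ! i * (W * N) * X ! i) = ip N (C ! i * N * X ! i)" if i: "i < g" for i
      proof -
        have "ip (W * N) (A ! i * (W * N) * X ! i) = ip (A ! i * (W * N) * X ! i) (W * N)"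
          using N dimA[OF i] SMn_nth[OF X i] by (intro ip_comm) auto
        also have "\<dots> = ip (transpose_mat W * (A ! i * (W * N) * X ! i)) N"
          using N dimA[OF i] SMn_nth[OF X i] by (intro ip_mult_left) auto
        also have "transpose_mat W * (A ! i * (W * N) * X ! i) = C ! i * N * X ! i"
          using N dimA[OF i] SMn_nth[OF X i] by (simp add: Ci[OF i] mat_assoc)
        also have "ip \<dots> N = ip N (C ! i * N * X ! i)"
          using N dimA[OF i] SMn_nth[OF X i] SMn_nth[OF C i] by (intro ip_comm) auto
        finally show ?thesis .
      qed
      thus ?thesis unfolding form_pad[OF X WN WN] e form_def[of g C] by simp
    qed
    \<comment> \<open>M and Q M have the same form, and Q M = W N with N = W^T B M.\<close>
    have 2: "form h A (pad g h n X) M M = form g C X (transpose_mat W * (B * M)) (transpose_mat W * (B * M))"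
      if X: "X \<in> SMn g n" and M: "M \<in> carrier_mat d n" for n X M
    proof -
      have N: "transpose_mat W * (B * M) \<in> carrier_mat r n" using M by auto
      have QM: "Q * M \<in> carrier_mat d n" using M Q by auto
      have eq: "W * (transpose_mat W * (B * M)) = Q * M" using M by (simp add: Q_def mat_assoc)
      have BQ: "B * Q = B" using BWB by (simp add: Q_def)
      have QBQ: "transpose_mat Q * (B * Q) = B"
      proof -
        have "transpose_mat Q * B = B"
          using arg_cong[OF BQ, of transpose_mat] by (simp add: mat_transpose_mult symB)
        thus ?thesis by (simp add: BQ)
      qed
      have "ip (Q * M) (B * (Q * M)) = ip M (B * M)"
      proof -
        have "ip (Q * M) (B * (Q * M)) = ip (B * (Q * M)) (Q * M)" using M by (intro ip_comm) auto
        also have "\<dots> = ip (transpose_mat Q * (B * Q) * M) M" using M by (subst ip_mult_left) (auto simp: mat_assoc)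
        also have "\<dots> = ip M (B * M)" unfolding QBQ using M by (intro ip_comm) auto
        finally show ?thesis .
      qed
      moreover have "ip (Q * M) (A ! i * (Q * M) * X ! i) = ip M (A ! i * M * X ! i)" if i: "i < g" for i
      proof -
        have "ip (Q * M) (A ! i * (Q * M) * X ! i) = ip (A ! i * (Q * M) * X ! i) (Q * M)"
          using M dimA[OF i] SMn_nth[OF X i] by (intro ip_comm) auto
        also have "\<dots> = ip (transpose_mat Q * (A ! i * Q * M * X ! i)) M"
          using M dimA[OF i] SMn_nth[OF X i] by (subst ip_mult_left) (auto simp: mat_assoc)
        also have "transpose_mat Q * (A ! i * Q * M * X ! i) = (transpose_mat Q * A ! i) * M * X ! i"
          unfolding AQ[OF i] using M dimA[OF i] SMn_nth[OF X i] by (simp add: mat_assoc)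
        also have "ip \<dots> M = ip M (A ! i * M * X ! i)"
          unfolding QA[OF i] using M dimA[OF i] SMn_nth[OF X i] by (intro ip_comm) auto
        finally show ?thesis .
      qed
      ultimately show ?thesis
        unfolding 1[OF X N] eq form_pad[OF X QM QM] form_pad[OF X M M] by simp
    qed
    have "pad g h n X \<in> D \<longleftrightarrow> X \<in> free_spec g r C" if X: "X \<in> SMn g n" for n X
      unfolding free_spec_iff[OF h A pad_SMn[OF X gh]] free_spec_iff[OF g C X]
    proof safe
      fix N :: "real mat" assume *: "\<forall>M\<in>carrier_mat d n. 0 \<le> form h A (pad g h n X) M M" and N: "N \<in> carrier_mat r n"
      show "0 \<le> form g C X N N" unfolding 1[OF X N] using * N W by auto
    next
      fix M :: "real mat" assume *: "\<forall>M\<in>carrier_mat r n. 0 \<le> form g C X M M" and M: "M \<in> carrier_mat d n"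
      have "transpose_mat W * (B * M) \<in> carrier_mat r n" using M by auto
      thus "0 \<le> form h A (pad g h n X) M M" unfolding 2[OF X M] using * by blast
    qed
    thus ?thesis using C by blast
  qed
qed

text \<open>Padding adds a single non-zero square, that of the identity. So the same constant works,
  with I to spare.\<close>

lemma bounded_pad:
  assumes "bounded_mat_set h D"
  shows "bounded_mat_set g {X. \<exists>n. X \<in> SMn g n \<and> pad g h n X \<in> D}"
proof -
  obtain c where c: "c > 0" and bd: "\<And>n X. X \<in> D \<Longrightarrow> X \<in> SMn h n \<Longrightarrow>
     psd n (c \<cdot>\<^sub>m 1\<^sub>m n - msum n n h (\<lambda>i. X ! i * X ! i))"
    using assms unfolding bounded_mat_set_def by blast
  have "psd n (c \<cdot>\<^sub>m 1\<^sub>m n - msum n n g (\<lambda>i. X ! i * X ! i))"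
    if X: "X \<in> SMn g n" and X': "X \<in> SMn g n'" "pad g h n' X \<in> D" for n n' X
  proof -
    have n': "n' = n" by (rule SMn_size_unique[OF X'(1) X g])
    note P = pad_SMn[OF X gh] and l = SMnD(1)[OF X]
    have "c \<cdot>\<^sub>m 1\<^sub>m n - msum n n g (\<lambda>i. X ! i * X ! i)
        = (c \<cdot>\<^sub>m 1\<^sub>m n - msum n n h (\<lambda>i. pad g h n X ! i * pad g h n X ! i)) + 1\<^sub>m n"
    proof (rule eq_matI)
      fix r s assume "r < dim_row ((c \<cdot>\<^sub>m 1\<^sub>m n - msum n n h (\<lambda>i. pad g h n X ! i * pad g h n X ! i)) + 1\<^sub>m n)"
        "s < dim_col ((c \<cdot>\<^sub>m 1\<^sub>m n - msum n n h (\<lambda>i. pad g h n X ! i * pad g h n X ! i)) + 1\<^sub>m n)"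
      hence rs: "r < n" "s < n" by auto
      have "(\<Sum>j<h. (pad g h n X ! j * pad g h n X ! j) $$ (r, s))
          = (\<Sum>j<g. (pad g h n X ! j * pad g h n X ! j) $$ (r, s)) + (pad g h n X ! g * pad g h n X ! g) $$ (r, s)"
        using rs gh by (intro sum_split_tail) (auto simp: pad_nth[OF l] mat_mult_zero)
      also have "\<dots> = (\<Sum>j<g. (X ! j * X ! j) $$ (r, s)) + 1\<^sub>m n $$ (r, s)"
        using rs gh by (simp add: pad_nth[OF l] mat_one_mult del: index_mult_mat(1) index_one_mat(1))
      finally show "(c \<cdot>\<^sub>m 1\<^sub>m n - msum n n g (\<lambda>i. X ! i * X ! i)) $$ (r, s)
        = ((c \<cdot>\<^sub>m 1\<^sub>m n - msum n n h (\<lambda>i. pad g h n X ! i * pad g h n X ! i)) + 1\<^sub>m n) $$ (r, s)"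
        using rs by (simp add: msum_index del: index_mult_mat(1))
    qed auto
    thus ?thesis using psd_add_one[OF bd[OF X'(2)[unfolded n'] P]] by simp
  qed
  thus ?thesis unfolding bounded_mat_set_def using c by blast
qed

end

section \<open>Rigidity of the face\<close>

lemma pen_cong: "(\<And>j. j < h \<Longrightarrow> x j = x' j) \<Longrightarrow> pen h d A s x = pen h d A s x'"
  unfolding pen_def by (intro arg_cong2[where f = "(-)"] refl msum_cong) simp

lemma ip_mult_basis_col:
  assumes "a < n" "M \<in> carrier_mat n n"
  shows "ip (basis_col n a) (M * basis_col n a) = M $$ (a, a)"
  using ip_basis_col(1)[OF assms(1), of "M * basis_col n a"] mult_basis_col_index[OF assms(2) assms(1) assms(1)] assms
  by (simp del: index_mult_mat(1))

lemma ip_basis_self: "a < n \<Longrightarrow> ip (basis_col n a) (basis_col n a) = 1"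
  using ip_basis_col(1)[of a n "basis_col n a"] by (simp add: basis_col_def)

lemma mconv_value_cong:
  "(\<And>l. l < m \<Longrightarrow> Y l = Y' l) \<Longrightarrow> mconv_value g n m V Y = mconv_value g n m V Y'"
  unfolding mconv_value_def by (auto intro!: msum_cong)

section \<open>Padding of combinations and of embeddings\<close>

lemma mconv_value_pad:
  assumes V: "mconv_data g K n m k V Y" and gh: "g < h" and n: "1 \<le> n"
    and V': "mconv_data h K' n m k V (\<lambda>l. pad g h (k l) (Y l))"
  shows "mconv_value h n m V (\<lambda>l. pad g h (k l) (Y l)) = pad g h n (mconv_value g n m V Y)"
proof (rule nth_equalityI)
  note D = mconv_dataD[OF V]
  note l = SMnD(1)[OF mconv_value_SMn[OF V n]]
  show "length (mconv_value h n m V (\<lambda>l. pad g h (k l) (Y l))) = length (pad g h n (mconv_value g n m V Y))"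
    unfolding pad_length[OF l gh] by (simp add: mconv_value_def)
  fix j assume "j < length (mconv_value h n m V (\<lambda>l. pad g h (k l) (Y l)))"
  hence j: "j < h" by (simp add: mconv_value_def)
  have e: "transpose_mat (V l) * pad g h (k l) (Y l) ! j * V l
     = (if j < g then transpose_mat (V l) * Y l ! j * V l else if j = g then transpose_mat (V l) * V l else 0\<^sub>m n n)"
    if "l < m" for l
    using D(3)[OF that] by (simp add: pad_nth[OF SMnD(1)[OF D(2)[OF that]] j] mat_mult_one mat_mult_zero mat_zero_mult)
  have "mconv_value h n m V (\<lambda>l. pad g h (k l) (Y l)) ! j
    = msum n n m (\<lambda>l. if j < g then transpose_mat (V l) * Y l ! j * V l else if j = g then transpose_mat (V l) * V l else 0\<^sub>m n n)"
    unfolding mconv_value_nth[OF V' j] by (rule msum_cong) (rule e)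
  also have "\<dots> = pad g h n (mconv_value g n m V Y) ! j"
  proof -
    have "msum n n m (\<lambda>l. 0\<^sub>m n n) = 0\<^sub>m n n" by (intro eq_matI) (auto simp: msum_index)
    thus ?thesis using D(4) by (auto simp: pad_nth[OF l j] mconv_value_nth[OF V])
  qed
  finally show "mconv_value h n m V (\<lambda>l. pad g h (k l) (Y l)) ! j = pad g h n (mconv_value g n m V Y) ! j" .
qed

lemma embeds_pad:
  assumes X: "X \<in> SMn g n" and Y: "Y \<in> SMn g k" and gh: "g < h"
  shows "embeds h n k (pad g h n X) (pad g h k Y) \<longleftrightarrow> embeds g n k X Y"
proof -
  have "(\<forall>i<h. pad g h k Y ! i * J = J * pad g h n X ! i) \<longleftrightarrow> (\<forall>i<g. Y ! i * J = J * X ! i)"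
    if J: "J \<in> carrier_mat k n" for J
  proof -
    have "pad g h k Y ! i * J = J * pad g h n X ! i \<longleftrightarrow> (i < g \<longrightarrow> Y ! i * J = J * X ! i)" if "i < h" for i
      using J that by (simp add: pad_nth[OF SMnD(1)[OF X]] pad_nth[OF SMnD(1)[OF Y]]
          mat_one_mult mat_mult_one mat_mult_zero mat_zero_mult)
    thus ?thesis using gh by auto
  qed
  thus ?thesis unfolding embeds_def by blast
qed

section \<open>Traces and Frobenius norms in a split orthonormal basis\<close>

lemma trace_split:
  fixes E f M :: "real mat"
  assumes E: "E \<in> carrier_mat k n" and f: "f \<in> carrier_mat k m" and M: "M \<in> carrier_mat k k"
    and 1: "E * transpose_mat E + f * transpose_mat f = 1\<^sub>m k"
  shows "ip (1\<^sub>m k) M = ip (1\<^sub>m n) (transpose_mat E * (M * E)) + ip (1\<^sub>m m) (transpose_mat f * (M * f))"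
proof -
  have e: "ip (1\<^sub>m k) (P * transpose_mat P * M) = ip (1\<^sub>m c) (transpose_mat P * (M * P))"
    if P: "P \<in> carrier_mat k c" for P :: "real mat" and c
  proof -
    have "ip (1\<^sub>m k) (P * transpose_mat P * M) = ip (transpose_mat P) (transpose_mat P * M)"
      using P M by (simp add: mat_assoc ip_mult_left mat_mult_one)
    also have "\<dots> = ip (1\<^sub>m c) (transpose_mat P * M * P)"
      using P M by (subst ip_mult_right) (auto simp: mat_one_mult)
    finally show ?thesis using P M by (simp add: mat_assoc)
  qed
  have "ip (1\<^sub>m k) M = ip (1\<^sub>m k) ((E * transpose_mat E + f * transpose_mat f) * M)"
    using M by (simp add: 1 mat_one_mult)
  also have "\<dots> = ip (1\<^sub>m k) (E * transpose_mat E * M) + ip (1\<^sub>m k) (f * transpose_mat f * M)"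
    using E f M by (simp add: mat_add_mult ip_add_right)
  finally show ?thesis unfolding e[OF E] e[OF f] .
qed

lemma frobenius_split:
  fixes E f M :: "real mat"
  assumes E: "E \<in> carrier_mat k n" and f: "f \<in> carrier_mat k m" and M: "M \<in> carrier_mat k c"
    and 1: "E * transpose_mat E + f * transpose_mat f = 1\<^sub>m k"
  shows "ip M M = ip (transpose_mat E * M) (transpose_mat E * M) + ip (transpose_mat f * M) (transpose_mat f * M)"
proof -
  have e: "ip M (P * transpose_mat P * M) = ip (transpose_mat P * M) (transpose_mat P * M)"
    if P: "P \<in> carrier_mat k c'" for P :: "real mat" and c'
    using P M by (simp add: mat_assoc ip_mult_left[of M P])
  have "ip M M = ip M ((E * transpose_mat E + f * transpose_mat f) * M)"
    using M by (simp add: 1 mat_one_mult)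
  also have "\<dots> = ip M (E * transpose_mat E * M) + ip M (f * transpose_mat f * M)"
    using E f M by (simp add: mat_add_mult ip_add_right)
  finally show ?thesis unfolding e[OF E] e[OF f] .
qed

text \<open>In the basis E, f the matrix Y has blocks X, b and corner 0. If X is a direct summand of
  Y, the remaining 1 x 1 summand z is the difference of the traces of Y and X, that is 0. Then Y and
  X have the same Frobenius norm, whereas the blocks give |Y|^2 = |X|^2 + 2 |b|^2.\<close>

lemma trace_zero_embedding:
  fixes Y X E f :: "real mat"
  assumes Y: "Y \<in> carrier_mat (Suc n) (Suc n)" "transpose_mat Y = Y" and X: "X \<in> carrier_mat n n"
    and E: "E \<in> carrier_mat (Suc n) n" and f: "f \<in> carrier_mat (Suc n) 1"
    and 1: "E * transpose_mat E + f * transpose_mat f = 1\<^sub>m (Suc n)"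
    and EYE: "transpose_mat E * (Y * E) = X" and fYf: "transpose_mat f * (Y * f) = 0\<^sub>m 1 1"
    and L: "L \<in> carrier_mat (Suc n) n" "transpose_mat L * L = 1\<^sub>m n" and YL: "Y * L = L * X"
  shows "Y * f = 0\<^sub>m (Suc n) 1"
proof -
  obtain L' where L': "L' \<in> carrier_mat (Suc n) (Suc n - n)"
    and orth: "transpose_mat L * L' = 0\<^sub>m n (Suc n - n)"
    and cL: "L * transpose_mat L + L' * transpose_mat L' = 1\<^sub>m (Suc n)"
    using isometry_completion[OF L] by blast
  have L': "L' \<in> carrier_mat (Suc n) 1" and orth: "transpose_mat L * L' = 0\<^sub>m n 1"
    using L' orth by simp_all
  have [simp]: "dim_row Y = Suc n" "dim_col Y = Suc n" "dim_row X = n" "dim_col X = n"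
    "dim_row E = Suc n" "dim_col E = n" "dim_row f = Suc n" "dim_col f = 1"
    "dim_row L = Suc n" "dim_col L = n" "dim_row L' = Suc n" "dim_col L' = 1"
    using Y X E f L L' by auto
  define z where "z = transpose_mat L' * (Y * L')"
  have z: "z \<in> carrier_mat 1 1" using L' by (auto simp: z_def)
  have LYL: "transpose_mat L * (Y * L) = X"
    unfolding YL using L(2) by (simp add: mat_one_mult mat_assoc[symmetric] del: assoc_mult_mat)
  \<comment> \<open>The trace of Y computed in the basis E, f and in the basis L, L'.\<close>
  have "ip (1\<^sub>m 1) z = 0"
    using trace_split[OF E f Y(1) 1] trace_split[OF L(1) L' Y(1) cL] unfolding EYE fYf LYL z_def by simp
  hence z0: "z = 0\<^sub>m 1 1" using z by (intro eq_matI) (auto simp: ip_def)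
  have L'YL: "transpose_mat L' * (Y * L) = 0\<^sub>m 1 n"
  proof -
    have "transpose_mat L' * (Y * L) = transpose_mat (transpose_mat L * L') * X"
      unfolding YL by (simp add: mat_transpose_mult mat_assoc)
    thus ?thesis unfolding orth by (simp add: mat_zero_mult)
  qed
  have "transpose_mat L' * Y = transpose_mat L' * Y * (L * transpose_mat L + L' * transpose_mat L')"
    unfolding cL by (simp add: mat_mult_one)
  also have "\<dots> = transpose_mat L' * (Y * L) * transpose_mat L + z * transpose_mat L'"
    by (simp add: mat_mult_add mat_assoc z_def)
  also have "\<dots> = 0\<^sub>m 1 (Suc n)" unfolding L'YL z0 by (simp add: mat_zero_mult)
  finally have L'Y: "transpose_mat L' * Y = 0\<^sub>m 1 (Suc n)" .
  have LY: "transpose_mat L * Y = transpose_mat X * transpose_mat L"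
    using arg_cong[OF YL, of transpose_mat] Y(2) by (simp add: mat_transpose_mult)
  have "transpose_mat X = X"
    unfolding EYE[symmetric] using Y(2) by (simp add: mat_ring)
  hence LY: "transpose_mat L * Y = X * transpose_mat L" using LY by simp
  have "ip (X * transpose_mat L) (X * transpose_mat L) = ip (X * (transpose_mat L * L)) X"
    by (subst ip_mult_right) (simp_all add: mat_assoc)
  also have "\<dots> = ip X X" unfolding L(2) by (simp add: mat_mult_one)
  \<comment> \<open>In the basis L, L' the matrix Y is X with a zero row and column added.\<close>
  finally have "ip Y Y = ip X X"
    using frobenius_split[OF L(1) L' Y(1) cL] unfolding LY L'Y by simp
  moreover have "ip Y Y = ip (Y * E) (Y * E) + ip (Y * f) (Y * f)"
  proof -
    have t: "ip (transpose_mat P * Y) (transpose_mat P * Y) = ip (Y * P) (Y * P)" if "dim_row P = Suc n" for P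
      using ip_transpose[of "Y * P" "Y * P"] that Y(2) by (simp add: mat_transpose_mult)
    show ?thesis using frobenius_split[OF E f Y(1) 1] by (simp add: t)
  qed
  moreover have "ip (Y * E) (Y * E) = ip X X + ip (transpose_mat f * (Y * E)) (transpose_mat f * (Y * E))"
    using frobenius_split[OF E f mult_carrier_mat[OF Y(1) E] 1] unfolding EYE .
  ultimately have "ip (Y * f) (Y * f) = 0"
    using ip_self_nonneg[of "Y * f"] ip_self_nonneg[of "transpose_mat f * (Y * E)"] by linarith
  from ip_self_zero[OF this] show ?thesis by simp
qed

section \<open>Perturbations inside the face\<close>

context standard_face
begin

lemma form_nonneg:
  "Y \<in> D \<Longrightarrow> Y \<in> SMn h k \<Longrightarrow> M \<in> carrier_mat d k \<Longrightarrow> 0 \<le> form h A Y M M"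
  using free_spec_iff[OF h A] by blast

lemma psd_corner:
  assumes Y: "Y \<in> D" "Y \<in> SMn h k" and w: "w \<in> carrier_mat k 1"
  shows "psd d (pen h d A (ip w w) (\<lambda>j. ip w (Y ! j * w)))"
proof -
  have "0 \<le> ip p (pen h d A (ip w w) (\<lambda>j. ip w (Y ! j * w)) * p)" if p: "p \<in> carrier_mat d 1" for p
    unfolding form_outer[OF A Y(2) p p w w, symmetric] using p w by (intro form_nonneg[OF Y]) auto
  thus ?thesis using pen_sym[OF A] by (simp add: psd_iff_ip)
qed

lemma corner_cauchy_schwarz:
  assumes Y: "Y \<in> D" "Y \<in> SMn h k" and w: "w \<in> carrier_mat k 1" and q: "q \<in> carrier_mat d 1"
    and N: "N \<in> carrier_mat d k"
  shows "(form h A Y N (q * transpose_mat w))\<^sup>2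
    \<le> form h A Y N N * ip q (pen h d A (ip w w) (\<lambda>j. ip w (Y ! j * w)) * q)"
  unfolding form_outer[OF A Y(2) q q w w, symmetric]
  using q w by (intro form_cauchy_schwarz[OF A Y(2) N _ form_nonneg[OF Y]]) auto

text \<open>The (a, a) entries x of the padded tuple form a point of F. With v = V_l e_a, the pencil
  P at x dominates the corner of Y^l at v. Hence x can be moved a little, in both directions, along
  the cross coefficients \<open>ip v (Y l ! j * w)\<close> and, after normalisation, stays in level
  one. The face then contains the moved points, and its equations read off the coefficients.\<close>

lemma face_direction:
  assumes V: "mconv_data h D n m k V Y" and X: "X \<in> SMn g n"
    and eq: "pad g h n X = mconv_value h n m V Y" and l: "l < m"
    and a: "a < n" and w: "w \<in> carrier_mat (k l) 1"
  shows "ip (V l * basis_col n a) (Y l ! g * w) = ip (V l * basis_col n a) w"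
    and "\<And>j. g < j \<Longrightarrow> j < h \<Longrightarrow> ip (V l * basis_col n a) (Y l ! j * w) = 0"
proof -
  note dat = mconv_dataD[OF V]
  note Pd = pad_SMn[OF X gh] and len = SMnD(1)[OF X] and n = SMnD(2)[OF X]
  define e where "e = basis_col n a"
  have e: "e \<in> carrier_mat n 1" by (simp add: e_def)
  define v where "v = (\<lambda>l. V l * e)"
  have v: "v l \<in> carrier_mat (k l) 1" if "l < m" for l using dat(3)[OF that] e by (auto simp: v_def)
  define x where "x = vec h (\<lambda>j. pad g h n X ! j $$ (a, a))"
  have xc: "x \<in> carrier_vec h" by (simp add: x_def)
  define P where "P = pen h d A 1 (($) x)"
  have P: "P \<in> carrier_mat d d" by (simp add: P_def)
  have padD: "pad g h n X \<in> D" unfolding eq by (rule free_spec_mconv_closed[OF h A V n])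
  have Pform: "ip p (P * q) = form h A (pad g h n X) (p * transpose_mat e) (q * transpose_mat e)"
    if "p \<in> carrier_mat d 1" "q \<in> carrier_mat d 1" for p q
  proof -
    have "P = pen h d A (ip e e) (\<lambda>j. ip e (pad g h n X ! j * e))"
      unfolding P_def e_def using a SMn_nth(1)[OF Pd]
      by (simp add: ip_basis_self) (intro pen_cong, simp add: x_def ip_mult_basis_col)
    thus ?thesis by (simp add: form_outer[OF A Pd that e e])
  qed
  have psdP: "psd d P"
    unfolding psd_iff_ip
  proof (intro conjI ballI P)
    show "transpose_mat P = P" unfolding P_def by (rule pen_sym[OF A])
    fix p :: "real mat" assume p: "p \<in> carrier_mat d 1"
    show "0 \<le> ip p (P * p)" unfolding Pform[OF p p] using p e by (intro form_nonneg[OF padD Pd]) auto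
  qed
  have xF: "x \<in> F"
    unfolding face_iff level_one_iff[OF h A] using psdP xc gh a
    by (auto simp: P_def x_def pad_nth[OF len])
  have Psum: "ip p (P * p) = (\<Sum>l<m. form h A (Y l) (p * transpose_mat (v l)) (p * transpose_mat (v l)))"
    if p: "p \<in> carrier_mat d 1" for p
  proof -
    have pe: "p * transpose_mat e \<in> carrier_mat d n" using p e by auto
    have "form h A (pad g h n X) (p * transpose_mat e) (p * transpose_mat e)
      = (\<Sum>l<m. form h A (Y l) (p * transpose_mat e * transpose_mat (V l)) (p * transpose_mat e * transpose_mat (V l)))"
      unfolding eq by (rule form_mconv_value[OF A V pe pe])
    also have "\<dots> = (\<Sum>l<m. form h A (Y l) (p * transpose_mat (v l)) (p * transpose_mat (v l)))"
    proof (intro sum.cong refl)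
      fix l assume "l \<in> {..<m}"
      hence "p * transpose_mat e * transpose_mat (V l) = p * transpose_mat (v l)"
        using p e dat(3)[of l] by (simp add: v_def mat_ring)
      thus "form h A (Y l) (p * transpose_mat e * transpose_mat (V l)) (p * transpose_mat e * transpose_mat (V l))
        = form h A (Y l) (p * transpose_mat (v l)) (p * transpose_mat (v l))" by simp
    qed
    finally show ?thesis unfolding Pform[OF p p] .
  qed
  note Yl = dat(1,2)[OF l] and vl = v[OF l]
  \<comment> \<open>P is a sum of such corners over all terms of the combination, and every one of
    them is nonnegative.\<close>
  have part: "form h A (Y l) (p * transpose_mat (v l)) (p * transpose_mat (v l)) \<le> ip p (P * p)"
    if p: "p \<in> carrier_mat d 1" for p
    unfolding Psum[OF p]
  proof (rule member_le_sum)
    fix l' assume "l' \<in> {..<m} - {l}"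
    hence l': "l' < m" by simp
    show "0 \<le> form h A (Y l') (p * transpose_mat (v l')) (p * transpose_mat (v l'))"
      using p v[OF l'] by (intro form_nonneg[OF dat(1,2)[OF l']]) auto
  qed (use l in auto)
  define \<sigma> where "\<sigma> = ip (v l) w"
  define b where "b = (\<lambda>j. ip (v l) (Y l ! j * w))"
  \<comment> \<open>The cross pencil of v and w: the direction in which P is perturbed.\<close>
  define Q where "Q = pen h d A \<sigma> b"
  have Q: "Q \<in> carrier_mat d d" and symQ: "transpose_mat Q = Q" by (simp_all add: Q_def pen_sym[OF A])
  define R where "R = pen h d A (ip w w) (\<lambda>j. ip w (Y l ! j * w))"
  have psdR: "psd d R" unfolding R_def by (rule psd_corner[OF Yl w])
  have bound: "(ip p (Q * q))\<^sup>2 \<le> ip p (P * p) * ip q (R * q)"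
    if p: "p \<in> carrier_mat d 1" and q: "q \<in> carrier_mat d 1" for p q
  proof -
    have "(ip p (Q * q))\<^sup>2 = (form h A (Y l) (p * transpose_mat (v l)) (q * transpose_mat w))\<^sup>2"
      unfolding Q_def \<sigma>_def b_def form_outer[OF A Yl(2) p q vl w] ..
    also have "\<dots> \<le> form h A (Y l) (p * transpose_mat (v l)) (p * transpose_mat (v l)) * ip q (R * q)"
      unfolding R_def using p vl by (intro corner_cauchy_schwarz[OF Yl w q]) auto
    also have "\<dots> \<le> ip p (P * p) * ip q (R * q)"
      by (intro mult_right_mono part[OF p] psd_nonneg[OF psdR q])
    finally show ?thesis .
  qed
  obtain c where c: "c > 0" and dom: "\<And>a q \<phi>. a \<in> carrier_mat d 1 \<Longrightarrow> q \<in> carrier_mat d 1 \<Longrightarrow> 0 \<le> \<phi> \<Longrightarrow>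
      (\<And>q. q \<in> carrier_mat d 1 \<Longrightarrow> (ip a q)\<^sup>2 \<le> \<phi> * ip q (R * q)) \<Longrightarrow>
      (\<And>q. q \<in> carrier_mat d 1 \<Longrightarrow> P * q = 0\<^sub>m d 1 \<Longrightarrow> ip a q = 0) \<Longrightarrow>
      (ip a q)\<^sup>2 \<le> c * \<phi> * ip q (P * q)"
    using psd_domination[OF psdP psdR] by blast
  have Qp: "ip (Q * p) q = ip p (Q * q)" if "p \<in> carrier_mat d 1" "q \<in> carrier_mat d 1" for p q
    using that Q symQ by (subst ip_mult_left[of p Q q]) auto
  \<comment> \<open>\<open>bound\<close> still contains R. It also shows that Q vanishes on the
    kernel of P, so \<open>psd_domination\<close> applies to the functional Q p with \<phi> the
    value of P at p.\<close>
  have dominated: "(ip p (Q * p))\<^sup>2 \<le> c * (ip p (P * p))\<^sup>2" if p: "p \<in> carrier_mat d 1" for p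
  proof -
    have "(ip (Q * p) p)\<^sup>2 \<le> c * ip p (P * p) * ip p (P * p)"
    proof (rule dom)
      show "0 \<le> ip p (P * p)" by (rule psd_nonneg[OF psdP p])
      fix q :: "real mat" assume q: "q \<in> carrier_mat d 1"
      show "(ip (Q * p) q)\<^sup>2 \<le> ip p (P * p) * ip q (R * q)" unfolding Qp[OF p q] by (rule bound[OF p q])
      assume "P * q = 0\<^sub>m d 1"
      hence "(ip q (Q * p))\<^sup>2 \<le> 0" using bound[OF q p] by simp
      thus "ip (Q * p) q = 0" unfolding Qp[OF p q] ip_sym_mult[OF symQ Q q p] by simp
    qed (use p Q in auto)
    thus ?thesis unfolding Qp[OF p p] by (simp add: power2_eq_square)
  qed
  \<comment> \<open>The three summands give t sqrt c \<le> 1, which keeps P + s Q psd for |s| = t,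
    and t |\<sigma>| < 1, which keeps the normalising factor positive.\<close>
  define t where "t = 1 / (sqrt c + \<bar>\<sigma>\<bar> + 1)"
  have den: "sqrt c + \<bar>\<sigma>\<bar> + 1 > 0" using c by (simp add: add_pos_nonneg add_nonneg_pos)
  have t: "t > 0" "t * sqrt c \<le> 1" "t * \<bar>\<sigma>\<bar> < 1"
    using den c by (simp_all add: t_def field_simps add_pos_nonneg)
  have small: "s * ip p (Q * p) \<ge> - ip p (P * p)" if p: "p \<in> carrier_mat d 1" and s: "\<bar>s\<bar> = t" for p s
  proof -
    have nn: "0 \<le> ip p (P * p)" by (rule psd_nonneg[OF psdP p])
    have "\<bar>ip p (Q * p)\<bar> \<le> sqrt c * ip p (P * p)"
      using real_sqrt_le_mono[OF dominated[OF p]] nn by (simp add: real_sqrt_mult)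
    hence "t * \<bar>ip p (Q * p)\<bar> \<le> (t * sqrt c) * ip p (P * p)"
      using mult_left_mono[of _ _ t] t(1) by (simp add: mult.assoc)
    also have "\<dots> \<le> ip p (P * p)" using mult_right_mono[OF t(2) nn] by simp
    finally have "\<bar>s * ip p (Q * p)\<bar> \<le> ip p (P * p)" unfolding abs_mult s .
    thus ?thesis by linarith
  qed
  \<comment> \<open>P + s Q has the constant coefficient 1 + s \<sigma>; dividing by it gives the
    pencil at a point of level one.\<close>
  define y where "y = (\<lambda>s. vec h (\<lambda>j. (x $ j + s * b j) / (1 + s * \<sigma>)))"
  have pos1: "1 + s * \<sigma> > 0" if "\<bar>s\<bar> = t" for s
  proof -
    have "\<bar>s * \<sigma>\<bar> < 1" using t(3) that by (simp add: abs_mult)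
    thus ?thesis by linarith
  qed
  have yC: "y s \<in> level_one h D" if s: "\<bar>s\<bar> = t" for s
    unfolding level_one_iff[OF h A] psd_pen_iff[OF A]
  proof (intro conjI ballI)
    show "y s \<in> carrier_vec h" by (simp add: y_def)
    fix p :: "real mat" assume p: "p \<in> carrier_mat d 1"
    have "1 * ip p p - (\<Sum>j<h. y s $ j * ip p (A ! j * p))
      = (ip p (P * p) + s * ip p (Q * p)) / (1 + s * \<sigma>)"
    proof -
      have "(\<Sum>j<h. y s $ j * ip p (A ! j * p))
        = ((\<Sum>j<h. x $ j * ip p (A ! j * p)) + s * (\<Sum>j<h. b j * ip p (A ! j * p))) / (1 + s * \<sigma>)"
        unfolding sum_distrib_left sum.distrib[symmetric] sum_divide_distrib
        by (intro sum.cong refl) (simp add: y_def distrib_right mult.assoc)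
      moreover have "I - (S + s * T) / (1 + s * \<sigma>) = ((1 * I - S) + s * (\<sigma> * I - T)) / (1 + s * \<sigma>)" for I S T :: real
      proof -
        have num: "(1 * I - S) + s * (\<sigma> * I - T) = (1 + s * \<sigma>) * I - (S + s * T)" by (simp add: algebra_simps)
        show ?thesis unfolding num using pos1[OF s] by (simp add: diff_divide_distrib)
      qed
      ultimately show ?thesis unfolding P_def Q_def ip_pen[OF A p] by simp
    qed
    thus "0 \<le> 1 * ip p p - (\<Sum>j<h. y s $ j * ip p (A ! j * p))"
      using small[OF p s] pos1[OF s] by simp
  qed
  have st: "\<bar>t\<bar> = t" "\<bar>- t\<bar> = t" using t by simp_all
  \<comment> \<open>The weights (1 + t \<sigma>) / 2 and (1 - t \<sigma>) / 2 undo the two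
    normalisations, so the perturbations cancel.\<close>
  define \<tau> where "\<tau> = (1 + t * \<sigma>) / 2"
  have \<tau>: "0 < \<tau>" "\<tau> < 1" using pos1[OF st(1)] pos1[OF st(2)] by (simp_all add: \<tau>_def)
  have "\<tau> \<cdot>\<^sub>v y t + (1 - \<tau>) \<cdot>\<^sub>v y (- t) = x"
  proof (rule eq_vecI)
    fix i assume "i < dim_vec x"
    hence i: "i < h" by (simp add: x_def)
    have half: "u / 2 * (v / u) = v / 2" if "u > 0" for u v :: real using that by simp
    have "\<tau> * ((x $ i + t * b i) / (1 + t * \<sigma>)) = (x $ i + t * b i) / 2"
      unfolding \<tau>_def by (rule half[OF pos1[OF st(1)]])
    moreover have "(1 - \<tau>) * ((x $ i + (- t) * b i) / (1 + (- t) * \<sigma>)) = (x $ i + (- t) * b i) / 2"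
    proof -
      have \<tau>': "1 - \<tau> = (1 + (- t) * \<sigma>) / 2" by (simp add: \<tau>_def field_simps)
      show ?thesis unfolding \<tau>' by (rule half[OF pos1[OF st(2)]])
    qed
    ultimately have "\<tau> * ((x $ i + t * b i) / (1 + t * \<sigma>))
        + (1 - \<tau>) * ((x $ i + (- t) * b i) / (1 + (- t) * \<sigma>)) = x $ i"
      by (simp only:) (simp add: field_simps)
    thus "(\<tau> \<cdot>\<^sub>v y t + (1 - \<tau>) \<cdot>\<^sub>v y (- t)) $ i = x $ i"
      using i by (simp add: y_def)
  qed (simp_all add: y_def x_def)
  hence "y t \<in> F" using face yC[OF st(1)] yC[OF st(2)] \<tau> xF unfolding is_face_def by metis
  note yF = face_coordinates[OF this]
  have "x $ g = 1" using gh a by (simp add: x_def pad_nth[OF len])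
  hence "(1 + t * b g) / (1 + t * \<sigma>) = 1" using yF(1) gh by (simp add: y_def)
  hence "1 + t * b g = 1 + t * \<sigma>" by (metis divide_eq_1_iff)
  hence "t * b g = t * \<sigma>" by linarith
  hence "b g = \<sigma>" using t(1) by simp
  thus "ip (V l * basis_col n a) (Y l ! g * w) = ip (V l * basis_col n a) w"
    by (simp add: b_def \<sigma>_def v_def e_def)
  fix j assume j: "g < j" "j < h"
  have "x $ j = 0" using j a by (simp add: x_def pad_nth[OF len])
  hence "(t * b j) / (1 + t * \<sigma>) = 0" using yF(2)[OF j] j by (simp add: y_def)
  hence "b j = 0" using t(1) pos1[OF st(1)] by simp
  thus "ip (V l * basis_col n a) (Y l ! j * w) = 0" by (simp add: b_def v_def e_def)
qed

text \<open>\<open>face_direction\<close> determines the pairing of each column of Y_j V_l with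
  every w. Taking w to be the difference S of the two columns shows that S has norm 0.\<close>

lemma face_rigidity:
  assumes V: "mconv_data h D n m k V Y" and X: "X \<in> SMn g n"
    and eq: "pad g h n X = mconv_value h n m V Y" and l: "l < m"
  shows "Y l ! g * V l = V l" and "\<And>j. g < j \<Longrightarrow> j < h \<Longrightarrow> Y l ! j * V l = 0\<^sub>m (k l) n"
proof -
  note dat = mconv_dataD[OF V]
  note Vl = dat(3)[OF l]
  have col: "Y l ! j * V l = Z" if j: "j < h" and Z: "Z \<in> carrier_mat (k l) n"
    and ipZ: "\<And>a w. a < n \<Longrightarrow> w \<in> carrier_mat (k l) 1 \<Longrightarrow> ip (V l * basis_col n a) (Y l ! j * w) = ip (Z * basis_col n a) w"
    for j Z
  proof (rule mat_eq_by_cols)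
    note y = SMn_nth[OF dat(2)[OF l] j]
    show "Y l ! j * V l \<in> carrier_mat (k l) n" using y Vl by auto
    fix a assume a: "a < n"
    define S where "S = Y l ! j * V l * basis_col n a - Z * basis_col n a"
    have S: "S \<in> carrier_mat (k l) 1" using y Vl Z by (auto simp: S_def)
    have "ip S S = ip (Y l ! j * (V l * basis_col n a)) S - ip (Z * basis_col n a) S"
      using y Vl Z S by (subst (1) S_def) (simp add: ip_minus_left mat_assoc)
    also have "ip (Y l ! j * (V l * basis_col n a)) S = ip (V l * basis_col n a) (Y l ! j * S)"
      using y Vl S by (subst ip_mult_left[of "V l * basis_col n a" "Y l ! j" S]) auto
    finally have "ip S S = 0" unfolding ipZ[OF a S] by simp
    from ip_self_zero[OF this] have "S = 0\<^sub>m (k l) 1" using S by (simp only: carrier_matD)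
    hence S0: "S $$ (u, 0) = 0" if "u < k l" for u using that by simp
    show "Y l ! j * V l * basis_col n a = Z * basis_col n a"
    proof (rule eq_matI)
      fix u v assume "u < dim_row (Z * basis_col n a)" "v < dim_col (Z * basis_col n a)"
      hence uv: "u < k l" "v = 0" using Z by auto
      show "(Y l ! j * V l * basis_col n a) $$ (u, v) = (Z * basis_col n a) $$ (u, v)"
        using S0[OF uv(1)] uv Z y Vl by (simp add: S_def del: index_mult_mat(1))
    qed (use y Vl Z in auto)
  qed (rule Z)
  show "Y l ! g * V l = V l"
    by (rule col[OF gh Vl]) (rule face_direction(1)[OF V X eq l])
  show "Y l ! j * V l = 0\<^sub>m (k l) n" if "g < j" "j < h" for j
    by (rule col[OF that(2)]) (simp_all add: face_direction(2)[OF V X eq l _ _ that] mat_zero_mult)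
qed

lemma compression_closed_G: "compression_closed h G"
  unfolding compression_closed_def
proof (intro allI ballI impI)
  fix k n Y and V :: "real mat" assume Y: "Y \<in> G \<inter> SMn h k" and V: "V \<in> carrier_mat k n" "1 \<le> n" "transpose_mat V * V = 1\<^sub>m n"
  obtain k' X where X: "X \<in> SMn g k'" "Y = pad g h k' X" using Y G_iff by blast
  have "k' = k" using SMn_size_unique[OF pad_SMn[OF X(1) gh] _ h, of k] Y X(2) by simp
  hence "conj_tuple V Y = pad g h n (conj_tuple V X)" "conj_tuple V X \<in> SMn g n"
    using conj_tuple_pad[of X g k h V n] conj_tuple_SMn[of X g k V n] X gh V by simp_all
  moreover have "conj_tuple V Y \<in> D" using free_spec_conj_closed[OF h A _ _ V(1,3,2)] Y G_iff by blast
  ultimately show "conj_tuple V Y \<in> G" using G_iff by blast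
qed

lemma G_SMn: "Z \<in> G \<Longrightarrow> \<exists>p. Z \<in> SMn h p"
  using G_iff free_spec_SMn by blast

end

section \<open>Extreme points of the graded lift\<close>

text \<open>Let w be the component of Y J e orthogonal to the range of J. Then |w|^2 is the pairing
  of w with Y J e, which equals that of J^T Y w with e and vanishes by assumption.\<close>

lemma invariant_of_off_diagonal_zero:
  fixes Y J :: "real mat"
  assumes Y: "Y \<in> carrier_mat k k" "transpose_mat Y = Y" and J: "J \<in> carrier_mat k n" "transpose_mat J * J = 1\<^sub>m n"
    and off: "\<And>w. w \<in> carrier_mat k 1 \<Longrightarrow> transpose_mat J * w = 0\<^sub>m n 1 \<Longrightarrow> transpose_mat J * (Y * w) = 0\<^sub>m n 1"
  shows "Y * J = J * (transpose_mat J * (Y * J))"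
proof (rule mat_eq_by_cols)
  have [simp]: "dim_row Y = k" "dim_col Y = k" "dim_row J = k" "dim_col J = n" using Y J by auto
  fix a assume "a < n"
  define e where "e = basis_col n a"
  have [simp]: "dim_row e = n" "dim_col e = 1" by (simp_all add: e_def)
  define y where "y = Y * (J * e)"
  have [simp]: "dim_row y = k" "dim_col y = 1" by (simp_all add: y_def)
  define w where "w = y - J * (transpose_mat J * y)"
  have w: "w \<in> carrier_mat k 1" by (auto simp: w_def intro!: carrier_matI)
  have [simp]: "dim_row w = k" "dim_col w = 1" using w by auto
  have "transpose_mat J * w = transpose_mat J * y - (transpose_mat J * J) * (transpose_mat J * y)"
    by (simp add: w_def mat_mult_minus mat_assoc)
  hence Jw: "transpose_mat J * w = 0\<^sub>m n 1" unfolding J(2) by (simp add: mat_one_mult) (auto intro!: eq_matI)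
  have "ip w w = ip w y - ip w (J * (transpose_mat J * y))" by (subst (2) w_def) (simp add: ip_minus_right)
  also have "ip w (J * (transpose_mat J * y)) = 0" by (subst ip_mult_left) (simp_all add: Jw)
  also have "ip w y = ip (transpose_mat J * (Y * w)) e"
    unfolding y_def by (subst ip_mult_left, simp, simp, simp, subst ip_mult_left) (simp_all add: Y(2))
  also have "\<dots> = 0" unfolding off[OF w Jw] by simp
  finally have "ip w w = 0" by simp
  from ip_self_zero[OF this] have w0: "w = 0\<^sub>m k 1" by simp
  have "y = J * (transpose_mat J * y)"
  proof (rule eq_matI)
    fix r s assume "r < dim_row (J * (transpose_mat J * y))" "s < dim_col (J * (transpose_mat J * y))"
    hence rs: "r < k" "s = 0" by auto
    have "w $$ (r, 0) = 0" using w0 rs by simp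
    thus "y $$ (r, s) = (J * (transpose_mat J * y)) $$ (r, s)" using rs by (simp add: w_def del: index_mult_mat(1))
  qed simp_all
  thus "Y * J * basis_col n a = J * (transpose_mat J * (Y * J)) * basis_col n a"
    by (simp add: y_def e_def[symmetric] mat_assoc)
qed (use Y J in auto)

section \<open>Passage between the graded lift and the spectrahedron\<close>

context standard_face
begin

lemma extreme_G_iff:
  assumes X: "X \<in> SMn g n"
  shows "pad g h n X \<in> free_extreme_points h G \<longleftrightarrow> pad g h n X \<in> G \<and>
    (\<forall>m k V Y. mconv_data h G n m k V Y \<and> (\<forall>l<m. V l \<noteq> 0\<^sub>m (k l) n) \<and> pad g h n X = mconv_value h n m V Y \<longrightarrow>
      (\<forall>l<m. embeds h n (k l) (pad g h n X) (Y l)))"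
  by (rule free_extreme_points_iff[OF h pad_SMn[OF X gh] compression_closed_G G_SMn])

lemma extreme_D_iff:
  assumes X: "X \<in> SMn g n"
  shows "pad g h n X \<in> free_extreme_points h D \<longleftrightarrow> pad g h n X \<in> D \<and>
    (\<forall>m k V Y. mconv_data h D n m k V Y \<and> (\<forall>l<m. V l \<noteq> 0\<^sub>m (k l) n) \<and> pad g h n X = mconv_value h n m V Y \<longrightarrow>
      (\<forall>l<m. embeds h n (k l) (pad g h n X) (Y l)))"
  by (rule free_extreme_points_iff[OF h pad_SMn[OF X gh] free_spec_compression_closed[OF h A] free_spec_SMn])

text \<open>The identity term drops out because J^T w = 0, the entries from g on because of their
  zero blocks. Applied both to the given dilation and to the one constructed from it.\<close>

lemma form_off_diagonal:
  assumes Y: "Y \<in> SMn h k" and J: "J \<in> carrier_mat k n" and w: "w \<in> carrier_mat k 1"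
    and Jw: "transpose_mat J * w = 0\<^sub>m n 1"
    and JYw: "\<And>j. g \<le> j \<Longrightarrow> j < h \<Longrightarrow> transpose_mat J * (Y ! j * w) = 0\<^sub>m n 1"
    and M: "M \<in> carrier_mat d n" and q: "q \<in> carrier_mat d 1"
  shows "form h A Y (M * transpose_mat J) (q * transpose_mat w)
    = - (\<Sum>i<g. ip (M * (transpose_mat J * (Y ! i * w))) (A ! i * q))"
proof -
  have N: "M * transpose_mat J \<in> carrier_mat d k" using M J by auto
  have "(\<Sum>j<h. ip (M * transpose_mat J * (Y ! j * w)) (A ! j * q))
      = (\<Sum>j<h. ip (M * (transpose_mat J * (Y ! j * w))) (A ! j * q))"
    using M J w SMn_nth[OF Y] by (intro sum.cong refl) (simp add: mat_assoc)
  also have "\<dots> = (\<Sum>i<g. ip (M * (transpose_mat J * (Y ! i * w))) (A ! i * q))"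
    using gh M q JYw SMn_nth[OF A] by (subst sum_split_tail[OF gh]) (auto simp: mat_mult_zero)
  finally show ?thesis
    unfolding form_outer_right[OF A Y N q w] using M J w q by (simp add: mat_assoc Jw mat_mult_zero)
qed

text \<open>If the off-diagonal block b of a dilation of an extreme point X were non-zero, a small
  multiple of b would already appear in a dilation of X inside the graded lift, because the
  kernel of B annihilates \<open>A\<^sub>1, \<dots>, A\<^sub>g\<close>.\<close>

lemma off_diagonal_zero:
  assumes X: "X \<in> SMn g n" and ext: "pad g h n X \<in> free_extreme_points h G"
    and Y: "Y \<in> D" "Y \<in> SMn h k" and J: "J \<in> carrier_mat k n" "transpose_mat J * J = 1\<^sub>m n"
    and JY: "conj_tuple J Y = pad g h n X"
    and Yg: "Y ! g * J = J" and Yj: "\<And>j. g < j \<Longrightarrow> j < h \<Longrightarrow> Y ! j * J = 0\<^sub>m k n"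
    and w: "w \<in> carrier_mat k 1" and Jw: "transpose_mat J * w = 0\<^sub>m n 1" and i: "i < g"
  shows "transpose_mat J * (Y ! i * w) = 0\<^sub>m n 1"
proof -
  note n = SMnD(2)[OF X] and len = SMnD(1)[OF X] and padS = pad_SMn[OF X gh]
  have padD: "pad g h n X \<in> D" using ext extreme_G_iff[OF X] G_iff by blast
  have [simp]: "dim_row J = k" "dim_col J = n" "dim_row w = k" "dim_col w = 1" using J w by auto
  define b where "b = (\<lambda>i. transpose_mat J * (Y ! i * w))"
  have b: "b i \<in> carrier_mat n 1" if "i < g" for i
  proof -
    have "Y ! i \<in> carrier_mat k k" using SMn_nth(1)[OF Y(2), of i] that gh by simp
    thus ?thesis using J(1) w unfolding b_def by (intro mult_carrier_mat[of _ n k]) auto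
  qed
  have JYw: "transpose_mat J * (Y ! j * w) = 0\<^sub>m n 1" if j: "g \<le> j" "j < h" for j
  proof -
    note y = SMn_nth[OF Y(2) j(2)]
    have "transpose_mat J * (Y ! j * w) = transpose_mat (Y ! j * J) * w"
      using y by (simp add: mat_ring)
    thus ?thesis using Yg Yj[of j] j Jw by (cases "j = g") (auto simp: mat_zero_mult)
  qed
  \<comment> \<open>Up to sign, the vector that represents the off-diagonal block of the pencil as a
    functional of q, for fixed M.\<close>
  define a where "a = (\<lambda>M. msum d 1 g (\<lambda>i. A ! i * (M * b i)))"
  have a: "a M \<in> carrier_mat d 1" for M by (simp add: a_def)
  have ip_a: "ip (a M) q = (\<Sum>i<g. ip (M * b i) (A ! i * q))"
    if M: "M \<in> carrier_mat d n" and q: "q \<in> carrier_mat d 1" for M q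
  proof -
    have c: "A ! i * (M * b i) \<in> carrier_mat d 1" if "i < g" for i
      using SMn_nth[OF A, of i] that gh M b[OF that] by auto
    have "ip (a M) q = ip q (a M)" using q a by (intro ip_comm) auto
    also have "\<dots> = (\<Sum>i<g. ip q (A ! i * (M * b i)))" unfolding a_def using c by (intro ip_msum) auto
    also have "\<dots> = (\<Sum>i<g. ip (M * b i) (A ! i * q))"
    proof (intro sum.cong refl)
      fix i assume "i \<in> {..<g}"
      hence i: "i < g" "i < h" using gh by auto
      have "M * b i \<in> carrier_mat d 1" using M b[OF i(1)] by auto
      thus "ip q (A ! i * (M * b i)) = ip (M * b i) (A ! i * q)"
        using SMn_nth[OF A i(2)] q by (intro ip_sym_mult) auto
    qed
    finally show ?thesis .
  qed
  define R where "R = pen h d A (ip w w) (\<lambda>j. ip w (Y ! j * w))"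
  have psdR: "psd d R" unfolding R_def by (rule psd_corner[OF Y w])
  obtain c where c: "c > 0" and dom: "\<And>a q \<phi>. a \<in> carrier_mat d 1 \<Longrightarrow> q \<in> carrier_mat d 1 \<Longrightarrow> 0 \<le> \<phi> \<Longrightarrow>
      (\<And>q. q \<in> carrier_mat d 1 \<Longrightarrow> (ip a q)\<^sup>2 \<le> \<phi> * ip q (R * q)) \<Longrightarrow>
      (\<And>q. q \<in> carrier_mat d 1 \<Longrightarrow> B * q = 0\<^sub>m d 1 \<Longrightarrow> ip a q = 0) \<Longrightarrow>
      (ip a q)\<^sup>2 \<le> c * \<phi> * ip q (B * q)"
    using psd_domination[OF psd_B psdR] by blast
  \<comment> \<open>Cauchy-Schwarz in Y gives the bound with the corner R of Y at w. Since a M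
    vanishes on the kernel of B, R may be exchanged for B at the price of c.\<close>
  have dominated: "(ip (a M) q)\<^sup>2 \<le> c * form h A (pad g h n X) M M * ip q (B * q)"
    if M: "M \<in> carrier_mat d n" and q: "q \<in> carrier_mat d 1" for M q
  proof (rule dom[OF a q form_nonneg[OF padD padS M]])
    fix q :: "real mat" assume q: "q \<in> carrier_mat d 1"
    have "(form h A Y (M * transpose_mat J) (q * transpose_mat w))\<^sup>2
        \<le> form h A Y (M * transpose_mat J) (M * transpose_mat J) * ip q (R * q)"
      unfolding R_def using M J by (intro corner_cauchy_schwarz[OF Y w q]) auto
    moreover have "form h A Y (M * transpose_mat J) (q * transpose_mat w) = - ip (a M) q"
      unfolding ip_a[OF M q] b_def by (rule form_off_diagonal[OF Y(2) J(1) w Jw JYw M q])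
    moreover have "form h A Y (M * transpose_mat J) (M * transpose_mat J) = form h A (pad g h n X) M M"
      unfolding JY[symmetric] form_conj_tuple[OF A Y(2) J M M] ..
    ultimately show "(ip (a M) q)\<^sup>2 \<le> form h A (pad g h n X) M M * ip q (R * q)" by simp
    assume "B * q = 0\<^sub>m d 1"
    hence "A ! i * q = 0\<^sub>m d 1" if "i < g" for i using kernel_B[OF that q] by blast
    thus "ip (a M) q = 0" unfolding ip_a[OF M q] by simp
  qed
  \<comment> \<open>Chosen so that t^2 c = 1: scaling the off-diagonal block by t absorbs exactly
    the constant of the domination.\<close>
  define t where "t = 1 / sqrt c"
  have t: "t > 0" "t\<^sup>2 * c = 1" using c by (simp_all add: t_def power_divide)
  \<comment> \<open>The new direction is the last basis vector; E is obtained by completion and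
    enters only through its orthogonality relations with f.\<close>
  define f where "f = basis_col (Suc n) n"
  have f: "f \<in> carrier_mat (Suc n) 1" by (simp add: f_def)
  have ff: "transpose_mat f * f = 1\<^sub>m 1"
    using inner_col[OF f f] ip_basis_self[of n "Suc n"] by (simp add: f_def) (auto intro!: eq_matI)
  obtain E where E: "E \<in> carrier_mat (Suc n) (Suc n - 1)" and EE: "transpose_mat E * E = 1\<^sub>m (Suc n - 1)"
    and fE: "transpose_mat f * E = 0\<^sub>m 1 (Suc n - 1)"
    and split: "f * transpose_mat f + E * transpose_mat E = 1\<^sub>m (Suc n)"
    using isometry_completion[OF f ff] by blast
  have E: "E \<in> carrier_mat (Suc n) n" and EE: "transpose_mat E * E = 1\<^sub>m n"
    and fE: "transpose_mat f * E = 0\<^sub>m 1 n"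
    using E EE fE by simp_all
  have [simp]: "dim_row E = Suc n" "dim_col E = n" "dim_row f = Suc n" "dim_col f = 1" using E f by auto
  have split: "E * transpose_mat E + f * transpose_mat f = 1\<^sub>m (Suc n)"
    unfolding split[symmetric] by (rule comm_add_mat) (auto intro!: carrier_matI)
  have Ef: "transpose_mat E * f = 0\<^sub>m n 1"
    using arg_cong[OF fE, of transpose_mat] by (simp add: mat_transpose_mult)
  have EE': "transpose_mat E * (E * Z) = Z" if "dim_row Z = n" for Z
  proof -
    have "transpose_mat E * (E * Z) = (transpose_mat E * E) * Z" using that by (simp add: mat_assoc)
    thus ?thesis unfolding EE using that by (simp add: mat_one_mult)
  qed
  have fE': "transpose_mat f * (E * Z) = 0\<^sub>m 1 (dim_col Z)" if "dim_row Z = n" for Z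
  proof -
    have "transpose_mat f * (E * Z) = (transpose_mat f * E) * Z" using that by (simp add: mat_assoc)
    thus ?thesis unfolding fE using that by (simp add: mat_zero_mult)
  qed
  have Ef': "transpose_mat E * (f * Z) = 0\<^sub>m n (dim_col Z)" if "dim_row Z = 1" for Z
  proof -
    have "transpose_mat E * (f * Z) = (transpose_mat E * f) * Z" using that by (simp add: mat_assoc)
    thus ?thesis unfolding Ef using that by (simp add: mat_zero_mult)
  qed
  \<comment> \<open>In the basis E, f this is the block matrix with X_i, t b_i and corner 0. The
    zero corner makes the last diagonal block of the padded pencil equal to B.\<close>
  define T where "T = map (\<lambda>i. E * (X ! i * transpose_mat E)
      + (E * ((t \<cdot>\<^sub>m b i) * transpose_mat f) + f * (transpose_mat (t \<cdot>\<^sub>m b i) * transpose_mat E))) [0..<g]"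
  have Ti: "T ! i = E * (X ! i * transpose_mat E)
      + (E * ((t \<cdot>\<^sub>m b i) * transpose_mat f) + f * (transpose_mat (t \<cdot>\<^sub>m b i) * transpose_mat E))" if "i < g" for i
    using that by (simp add: T_def)
  have dims: "dim_row (X ! i) = n" "dim_col (X ! i) = n" "transpose_mat (X ! i) = X ! i"
    "dim_row (b i) = n" "dim_col (b i) = 1" if "i < g" for i
    using SMn_nth[OF X that] b[OF that] by auto
  have T: "T \<in> SMn g (Suc n)"
  proof (rule SMnI)
    fix i assume i: "i < g"
    note [simp] = dims[OF i]
    show "T ! i \<in> carrier_mat (Suc n) (Suc n)" unfolding Ti[OF i] by (auto intro!: carrier_matI)
    define P Q where "P = E * (X ! i * transpose_mat E)" and "Q = E * ((t \<cdot>\<^sub>m b i) * transpose_mat f)"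
    have c: "P \<in> carrier_mat (Suc n) (Suc n)" "Q \<in> carrier_mat (Suc n) (Suc n)" by (auto simp: P_def Q_def intro!: carrier_matI)
    have "transpose_mat P = P" by (simp add: P_def mat_ring)
    moreover have "transpose_mat Q = f * (transpose_mat (t \<cdot>\<^sub>m b i) * transpose_mat E)"
      by (simp add: Q_def mat_ring)
    ultimately have "T ! i = P + (Q + transpose_mat Q)" "transpose_mat P = P"
      unfolding Ti[OF i] P_def Q_def by simp_all
    thus "transpose_mat (T ! i) = T ! i"
      using c comm_add_mat[of Q "Suc n" "Suc n" "transpose_mat Q"]
      by (simp add: transpose_add[of _ "Suc n" "Suc n"])
  qed (simp_all add: T_def)
  have TE: "transpose_mat E * (T ! i * E) = X ! i" "transpose_mat E * (T ! i * f) = t \<cdot>\<^sub>m b i"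
    "transpose_mat f * (T ! i * f) = 0\<^sub>m 1 1" if i: "i < g" for i
  proof -
    note [simp] = dims[OF i]
    have s [simp]: "0\<^sub>m p q + Z = Z" "Z + 0\<^sub>m p q = Z" if "dim_row Z = p" "dim_col Z = q" for Z :: "real mat" and p q
      using that by (auto intro!: eq_matI)
    show "transpose_mat E * (T ! i * E) = X ! i"
      unfolding Ti[OF i] by (simp add: mat_add_mult mat_mult_add mat_assoc EE EE' Ef' fE mat_mult_one mat_mult_zero)
    show "transpose_mat E * (T ! i * f) = t \<cdot>\<^sub>m b i"
      unfolding Ti[OF i] by (simp add: mat_add_mult mat_mult_add mat_assoc EE' Ef Ef' ff mat_mult_one mat_mult_zero)
    show "transpose_mat f * (T ! i * f) = 0\<^sub>m 1 1"
      unfolding Ti[OF i] by (simp add: mat_add_mult mat_mult_add mat_assoc fE' Ef ff mat_mult_one mat_mult_zero)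
  qed
  have lenT: "length T = g" by (simp add: T_def)
  note padT = pad_SMn[OF T gh]
  have conjT: "conj_tuple E T = X"
    using lenT len TE(1) SMn_nth[OF T] by (intro nth_equalityI) (auto simp: conj_tuple_def mat_assoc)
  hence conj_padT: "conj_tuple E (pad g h (Suc n) T) = pad g h n X"
    using conj_tuple_pad[OF T gh E EE n] by simp
  have padTD: "pad g h (Suc n) T \<in> D"
    unfolding free_spec_iff[OF h A padT]
  proof
    fix N :: "real mat" assume N: "N \<in> carrier_mat d (Suc n)"
    define M q where "M = N * E" and "q = N * f"
    have M: "M \<in> carrier_mat d n" and q: "q \<in> carrier_mat d 1" using N E f by (auto simp: M_def q_def)
    define P where "P = M * transpose_mat E"
    define Q where "Q = q * transpose_mat f"
    have P: "P \<in> carrier_mat d (Suc n)" and Q: "Q \<in> carrier_mat d (Suc n)" using M q by (auto simp: P_def Q_def)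
    have "N = N * (E * transpose_mat E + f * transpose_mat f)" using N by (simp add: split mat_mult_one)
    also have "\<dots> = P + Q" using N by (simp add: P_def Q_def M_def q_def mat_mult_add mat_assoc)
    finally have NPQ: "N = P + 1 \<cdot>\<^sub>m Q" using Q by (auto intro!: eq_matI)
    have tail: "transpose_mat E * (pad g h (Suc n) T ! j * f) = 0\<^sub>m n 1" if "g \<le> j" "j < h" for j
      using that by (simp add: pad_nth[OF lenT that(2)] mat_one_mult mat_zero_mult mat_mult_zero Ef)
    have off: "form h A (pad g h (Suc n) T) P Q = - (t * ip (a M) q)"
    proof -
      have "ip (M * (transpose_mat E * (pad g h (Suc n) T ! i * f))) (A ! i * q) = t * ip (M * b i) (A ! i * q)"
        if i: "i < g" for i
        using i gh M q dims[OF i] SMn_nth[OF A, of i]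
        by (simp add: pad_nth[OF lenT] TE mat_mult_smult ip_smult_left)
      hence "(\<Sum>i<g. ip (M * (transpose_mat E * (pad g h (Suc n) T ! i * f))) (A ! i * q)) = t * ip (a M) q"
        unfolding ip_a[OF M q] sum_distrib_left by (intro sum.cong refl) auto
      moreover have "form h A (pad g h (Suc n) T) P Q
          = - (\<Sum>i<g. ip (M * (transpose_mat E * (pad g h (Suc n) T ! i * f))) (A ! i * q))"
        unfolding P_def Q_def by (rule form_off_diagonal[OF padT E f Ef tail M q])
      ultimately show ?thesis by simp
    qed
    have diag: "form h A (pad g h (Suc n) T) P P = form h A (pad g h n X) M M"
      unfolding P_def form_conj_tuple[OF A padT E EE M M, symmetric] conj_padT ..
    have corner: "form h A (pad g h (Suc n) T) Q Q = ip q (B * q)"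
    proof -
      have "ip f f = 1" by (simp add: f_def ip_basis_self)
      moreover have "ip f (pad g h (Suc n) T ! j * f) = (if j = g then 1 else 0)" if j: "j < h" for j
      proof -
        have "ip f (T ! j * f) = 0" if "j < g"
        proof -
          have "T ! j * f \<in> carrier_mat (Suc n) 1" using SMn_nth[OF T that] f by auto
          from inner_col[OF f this] TE(3)[OF that] have "ip f (T ! j * f) \<cdot>\<^sub>m 1\<^sub>m 1 = 0\<^sub>m 1 1" by simp
          from arg_cong[OF this, of "\<lambda>M. M $$ (0, 0)"] show ?thesis by simp
        qed
        thus ?thesis using \<open>ip f f = 1\<close> by (simp add: pad_nth[OF lenT j] mat_one_mult mat_zero_mult)
      qed
      ultimately have "pen h d A (ip f f) (\<lambda>j. ip f (pad g h (Suc n) T ! j * f)) = B"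
        by (simp only:) (rule pen_cong, simp)
      thus ?thesis unfolding Q_def form_outer[OF A padT q q f f] by simp
    qed
    \<comment> \<open>The form at N = P + Q is \<alpha> - 2 \<gamma> + \<beta>. It is nonnegative
      because \<gamma>^2 \<le> \<alpha> \<beta>, by the inequality of arithmetic and geometric
      means.\<close>
    define \<alpha> \<beta> \<gamma> where "\<alpha> = form h A (pad g h n X) M M" and "\<beta> = ip q (B * q)" and "\<gamma> = t * ip (a M) q"
    have nn: "0 \<le> \<alpha>" "0 \<le> \<beta>"
      unfolding \<alpha>_def \<beta>_def by (rule form_nonneg[OF padD padS M], rule psd_nonneg[OF psd_B q])
    have "\<gamma>\<^sup>2 \<le> t\<^sup>2 * (c * \<alpha> * \<beta>)"
      unfolding \<gamma>_def \<alpha>_def \<beta>_def power_mult_distrib by (intro mult_left_mono dominated[OF M q]) simp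
    also have "\<dots> = (t\<^sup>2 * c) * (\<alpha> * \<beta>)" by (simp only: mult.assoc)
    finally have "\<gamma>\<^sup>2 \<le> \<alpha> * \<beta>" unfolding t(2) by simp
    hence "(2 * \<gamma>)\<^sup>2 \<le> (\<alpha> + \<beta>)\<^sup>2"
      using zero_le_power2[of "\<alpha> - \<beta>"] by (simp add: power2_eq_square algebra_simps)
    hence "2 * \<gamma> \<le> \<alpha> + \<beta>" by (rule power2_le_imp_le) (use nn in simp)
    thus "0 \<le> form h A (pad g h (Suc n) T) N N"
      unfolding NPQ form_expand[OF A padT P Q] diag off corner \<alpha>_def \<beta>_def \<gamma>_def by simp
  qed
  have padTG: "pad g h (Suc n) T \<in> G" using padTD pad_mem_G[OF T] by simp
  \<comment> \<open>Extremality speaks of combinations with non-zero coefficients only.\<close>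
  have "E \<noteq> 0\<^sub>m (Suc n) n"
  proof
    assume "E = 0\<^sub>m (Suc n) n"
    hence "1\<^sub>m n = (0\<^sub>m n n :: real mat)" using EE by (simp add: mat_mult_zero)
    from arg_cong[OF this, of "\<lambda>M. M $$ (0, 0)"] show False using n by simp
  qed
  hence "embeds h n (Suc n) (pad g h n X) (pad g h (Suc n) T)"
    using ext mconv_data_isometry[OF padTG padT E EE] unfolding extreme_G_iff[OF X] conj_padT
    by (metis less_one)
  hence "embeds g n (Suc n) X T" unfolding embeds_pad[OF X T gh] .
  then obtain L where L: "L \<in> carrier_mat (Suc n) n" "transpose_mat L * L = 1\<^sub>m n"
    and TL: "T ! i * L = L * X ! i" unfolding embeds_def using i by blast
  have "T ! i * f = 0\<^sub>m (Suc n) 1"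
    by (rule trace_zero_embedding[OF SMn_nth(1)[OF T i] SMn_nth(2)[OF T i] SMn_nth(1)[OF X i] E f split
        TE(1)[OF i] TE(3)[OF i] L TL])
  hence "t \<cdot>\<^sub>m b i = 0\<^sub>m n 1" using TE(2)[OF i] by (simp add: mat_mult_zero)
  hence "(t \<cdot>\<^sub>m b i) $$ (r, 0) = 0" if "r < n" for r using that by simp
  hence z: "t * b i $$ (r, 0) = 0" if "r < n" for r using that b[OF i] by simp
  have "b i = 0\<^sub>m n 1"
    using z t(1) b[OF i] by (intro eq_matI) auto
  thus ?thesis by (simp add: b_def)
qed

lemma extreme_G_imp_extreme_D:
  assumes X: "X \<in> SMn g n" and ext: "pad g h n X \<in> free_extreme_points h G"
  shows "pad g h n X \<in> free_extreme_points h D"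
  unfolding extreme_D_iff[OF X]
proof (intro conjI allI impI; (elim conjE)?)
  show "pad g h n X \<in> D" using ext extreme_G_iff[OF X] G_iff by blast
next
  fix m k V Y l0
  assume V: "mconv_data h D n m k V Y" and nz: "\<forall>l<m. V l \<noteq> 0\<^sub>m (k l) n"
    and eq: "pad g h n X = mconv_value h n m V Y" and l0: "l0 < m"
  note dat = mconv_dataD[OF V]
  note rigid = face_rigidity[OF V X eq]
  \<comment> \<open>Factors V l through its range: with W from Gram-Schmidt for the Gram matrix of V
    l, the columns of V l W are an orthonormal basis of the range.\<close>
  have "\<exists>r W. W \<in> carrier_mat n r \<and> transpose_mat (V l * W) * (V l * W) = 1\<^sub>m r \<and>
      (V l * W) * (transpose_mat (V l * W) * V l) = V l" if l: "l < m" for l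
  proof -
    have [simp]: "dim_row (V l) = k l" "dim_col (V l) = n" using dat(3)[OF l] by auto
    define B' where "B' = transpose_mat (V l) * V l"
    have B': "B' \<in> carrier_mat n n" by (auto simp: B'_def intro!: carrier_matI)
    have "psd n B'"
      unfolding psd_iff_ip
    proof (intro conjI ballI B')
      show "transpose_mat B' = B'" by (simp add: B'_def mat_transpose_mult)
      fix v :: "real mat" assume "v \<in> carrier_mat n 1"
      hence "ip v (B' * v) = ip (V l * v) (V l * v)"
        by (simp add: B'_def mat_assoc ip_mult_left[of v "transpose_mat (V l)"])
      thus "0 \<le> ip v (B' * v)" by (simp add: ip_self_nonneg)
    qed
    then obtain r W where W: "W \<in> carrier_mat n r" "transpose_mat W * (B' * W) = 1\<^sub>m r"
      and BWB: "B' * (W * (transpose_mat W * B')) = B'"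
      using psd_gram_schmidt by blast
    have [simp]: "dim_row W = n" "dim_col W = r" using W by auto
    define U where "U = 1\<^sub>m n - W * (transpose_mat W * B')"
    have [simp]: "dim_row B' = n" "dim_col B' = n" using B' by auto
    have [simp]: "dim_row U = n" "dim_col U = n" by (simp_all add: U_def)
    have "B' * U = B' - B' * (W * (transpose_mat W * B'))" by (simp add: U_def mat_mult_minus mat_mult_one)
    hence BU: "B' * U = 0\<^sub>m n n" unfolding BWB by (auto intro!: eq_matI)
    have "ip (V l * U) (V l * U) = ip (B' * U) U"
      by (subst (1) ip_mult_left) (simp_all add: B'_def mat_assoc)
    hence "ip (V l * U) (V l * U) = 0" unfolding BU by simp
    from ip_self_zero[OF this] have VU: "V l * U = 0\<^sub>m (k l) n" by simp
    have "V l * U = V l - V l * (W * (transpose_mat W * B'))" by (simp add: U_def mat_mult_minus mat_mult_one)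
    with VU have d: "V l - V l * (W * (transpose_mat W * B')) = 0\<^sub>m (k l) n" by simp
    have "V l * (W * (transpose_mat W * B')) = V l"
    proof (rule eq_matI)
      fix r s assume rs: "r < dim_row (V l)" "s < dim_col (V l)"
      show "(V l * (W * (transpose_mat W * B'))) $$ (r, s) = V l $$ (r, s)"
        using arg_cong[OF d, of "\<lambda>M. M $$ (r, s)"] rs by (simp del: index_mult_mat(1))
    qed simp_all
    thus ?thesis using W by (intro exI[of _ r] exI[of _ W]) (simp add: mat_ring B'_def)
  qed
  then obtain r W where W: "\<And>l. l < m \<Longrightarrow> W l \<in> carrier_mat n (r l)"
    and iso: "\<And>l. l < m \<Longrightarrow> transpose_mat (V l * W l) * (V l * W l) = 1\<^sub>m (r l)"
    and span: "\<And>l. l < m \<Longrightarrow> (V l * W l) * (transpose_mat (V l * W l) * V l) = V l"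
    by metis
  \<comment> \<open>\<iota> l is the isometry onto the range of V l, Y' l the compression of Y l to
    it, and V' l the coefficient with \<iota> l V' l = V l.\<close>
  define \<iota> where "\<iota> = (\<lambda>l. V l * W l)"
  define V' where "V' = (\<lambda>l. transpose_mat (\<iota> l) * V l)"
  define Y' where "Y' = (\<lambda>l. conj_tuple (\<iota> l) (Y l))"
  have \<iota>: "\<iota> l \<in> carrier_mat (k l) (r l)" if "l < m" for l using W[OF that] dat(3)[OF that] by (auto simp: \<iota>_def)
  have V': "V' l \<in> carrier_mat (r l) n" if "l < m" for l using \<iota>[OF that] dat(3)[OF that] by (auto simp: V'_def)
  have \<iota>V': "\<iota> l * V' l = V l" if "l < m" for l using span[OF that] by (simp add: V'_def \<iota>_def)
  have \<iota>\<iota>: "transpose_mat (\<iota> l) * \<iota> l = 1\<^sub>m (r l)" if "l < m" for l using iso[OF that] by (simp add: \<iota>_def)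
  have Yg\<iota>: "Y l ! g * \<iota> l = \<iota> l" if l: "l < m" for l
  proof -
    have "Y l ! g * \<iota> l = (Y l ! g * V l) * W l"
      using SMn_nth[OF dat(2)[OF l] gh] dat(3)[OF l] W[OF l] by (simp add: \<iota>_def mat_assoc)
    thus ?thesis unfolding rigid(1)[OF l] by (simp add: \<iota>_def)
  qed
  have Yj\<iota>: "Y l ! j * \<iota> l = 0\<^sub>m (k l) (r l)" if l: "l < m" and j: "g < j" "j < h" for l j
  proof -
    have "Y l ! j * \<iota> l = (Y l ! j * V l) * W l"
      using SMn_nth[OF dat(2)[OF l] j(2)] dat(3)[OF l] W[OF l] by (simp add: \<iota>_def mat_assoc)
    thus ?thesis unfolding rigid(2)[OF l j] using W[OF l] by (simp add: mat_zero_mult)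
  qed
  \<comment> \<open>Tuples of size 0 are excluded from \<open>SMn\<close>; here V l being non-zero
    rules them out.\<close>
  have r: "1 \<le> r l" if l: "l < m" for l
  proof (rule ccontr)
    assume "\<not> 1 \<le> r l"
    hence "r l = 0" by simp
    hence "\<iota> l * V' l = 0\<^sub>m (k l) n"
      using \<iota>[OF l] V'[OF l] by (intro eq_matI) (auto simp: index_mult_sum simp del: index_mult_mat(1))
    thus False using nz l \<iota>V'[OF l] by simp
  qed
  have Y'S: "Y' l \<in> SMn h (r l)" if l: "l < m" for l
    unfolding Y'_def by (rule conj_tuple_SMn[OF dat(2)[OF l] \<iota>[OF l] r[OF l]])
  have Y'nth: "Y' l ! j = transpose_mat (\<iota> l) * (Y l ! j * \<iota> l)" if l: "l < m" and j: "j < h" for l j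
    using SMnD(1)[OF dat(2)[OF l]] j SMn_nth[OF dat(2)[OF l] j] \<iota>[OF l] by (simp add: Y'_def conj_tuple_nth mat_assoc)
  have Y'G: "Y' l \<in> G" if l: "l < m" for l
  proof -
    have "Y' l \<in> D" unfolding Y'_def
      by (rule free_spec_conj_closed[OF h A dat(1,2)[OF l] \<iota>[OF l] \<iota>\<iota>[OF l] r[OF l]])
    moreover have "Y' l ! g = 1\<^sub>m (r l)" unfolding Y'nth[OF l gh] Yg\<iota>[OF l] \<iota>\<iota>[OF l] ..
    moreover have "Y' l ! j = 0\<^sub>m (r l) (r l)" if "g < j" "j < h" for j
      unfolding Y'nth[OF l that(2)] Yj\<iota>[OF l that] using \<iota>[OF l] by (simp add: mat_mult_zero)
    ultimately show ?thesis using pad_take[OF Y'S[OF l] gh] G_iff by blast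
  qed
  have V'Y: "transpose_mat (V' l) * Z * V' l = transpose_mat (V l) * Q * V l"
    if l: "l < m" and Q: "Q \<in> carrier_mat (k l) (k l)" and Z: "Z = transpose_mat (\<iota> l) * (Q * \<iota> l)" for l Q Z
  proof -
    have "transpose_mat (\<iota> l * V' l) * Q * (\<iota> l * V' l) = transpose_mat (V' l) * Z * V' l"
      using Q \<iota>[OF l] V'[OF l] by (simp add: Z mat_ring)
    thus ?thesis unfolding \<iota>V'[OF l] by simp
  qed
  have V'V': "transpose_mat (V' l) * V' l = transpose_mat (V l) * V l" if l: "l < m" for l
  proof -
    have "transpose_mat (\<iota> l * V' l) * (\<iota> l * V' l) = transpose_mat (V' l) * ((transpose_mat (\<iota> l) * \<iota> l) * V' l)"
      using \<iota>[OF l] V'[OF l] by (simp add: mat_ring)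
    thus ?thesis unfolding \<iota>V'[OF l] \<iota>\<iota>[OF l] using V'[OF l] by (simp add: mat_one_mult)
  qed
  have data': "mconv_data h G n m r V' Y'"
    unfolding mconv_data_def using Y'G Y'S V' dat(4) msum_cong[of m "\<lambda>l. transpose_mat (V' l) * V' l", OF V'V']
    by auto
  have "mconv_value h n m V' Y' = mconv_value h n m V Y"
  proof (rule nth_equalityI)
    fix j assume "j < length (mconv_value h n m V' Y')"
    hence j: "j < h" by (simp add: mconv_value_def)
    show "mconv_value h n m V' Y' ! j = mconv_value h n m V Y ! j"
      unfolding mconv_value_nth[OF data' j] mconv_value_nth[OF V j]
      by (rule msum_cong) (rule V'Y[OF _ SMn_nth(1)[OF dat(2) j] Y'nth[OF _ j]])
  qed (simp add: mconv_value_def)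
  moreover have "V' l \<noteq> 0\<^sub>m (r l) n" if l: "l < m" for l
  proof
    assume "V' l = 0\<^sub>m (r l) n"
    hence "V l = 0\<^sub>m (k l) n" using \<iota>V'[OF l] \<iota>[OF l] by (simp add: mat_mult_zero)
    thus False using nz l by blast
  qed
  ultimately have "embeds h n (r l0) (pad g h n X) (Y' l0)"
    using ext data' eq l0 unfolding extreme_G_iff[OF X] by metis
  then obtain Q where Q_iso: "Q \<in> carrier_mat (r l0) n" "transpose_mat Q * Q = 1\<^sub>m n"
    and YO: "\<And>j. j < h \<Longrightarrow> Y' l0 ! j * Q = Q * pad g h n X ! j"
    unfolding embeds_def by blast
  \<comment> \<open>X embeds into Y' by Q, but Y' is only a compression of Y. So J compresses Y to
    X, and the invariance of its range is still to be shown.\<close>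
  define J where "J = \<iota> l0 * Q"
  note \<iota>0 = \<iota>[OF l0] and Yd = dat(1,2)[OF l0]
  have J: "J \<in> carrier_mat (k l0) n" using \<iota>0 Q_iso by (auto simp: J_def)
  have JJ: "transpose_mat J * J = 1\<^sub>m n"
  proof -
    have "transpose_mat J * J = transpose_mat Q * ((transpose_mat (\<iota> l0) * \<iota> l0) * Q)"
      using \<iota>0 Q_iso by (simp add: J_def mat_ring)
    thus ?thesis unfolding \<iota>\<iota>[OF l0] using Q_iso by (simp add: mat_one_mult)
  qed
  have JYJ: "transpose_mat J * (Y l0 ! j * J) = pad g h n X ! j" if j: "j < h" for j
  proof -
    note y = SMn_nth[OF Yd(2) j] and x = SMn_nth[OF pad_SMn[OF X gh] j]
    have "transpose_mat J * (Y l0 ! j * J) = transpose_mat Q * (Y' l0 ! j * Q)"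
      unfolding Y'nth[OF l0 j] using \<iota>0 Q_iso y by (simp add: J_def mat_ring)
    also have "\<dots> = (transpose_mat Q * Q) * pad g h n X ! j"
      unfolding YO[OF j] using Q_iso(1) x by (simp add: mat_assoc)
    finally show ?thesis unfolding Q_iso(2) using x by (simp add: mat_one_mult)
  qed
  have conjJ: "conj_tuple J (Y l0) = pad g h n X"
  proof (rule nth_equalityI)
    note lens = SMnD(1)[OF Yd(2)] SMnD(1)[OF pad_SMn[OF X gh]]
    fix j assume "j < length (conj_tuple J (Y l0))"
    hence j: "j < h" using lens by (simp add: conj_tuple_def)
    show "conj_tuple J (Y l0) ! j = pad g h n X ! j"
      using JYJ[OF j] j lens J SMn_nth[OF Yd(2) j] by (simp add: conj_tuple_nth mat_assoc)
  qed (use SMnD(1)[OF Yd(2)] SMnD(1)[OF pad_SMn[OF X gh]] in \<open>simp add: conj_tuple_def\<close>)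
  have YgJ: "Y l0 ! g * J = J"
  proof -
    have "Y l0 ! g * J = (Y l0 ! g * \<iota> l0) * Q" using SMn_nth[OF Yd(2) gh] \<iota>0 Q_iso by (simp add: J_def mat_assoc)
    thus ?thesis unfolding Yg\<iota>[OF l0] by (simp add: J_def)
  qed
  have YjJ: "Y l0 ! j * J = 0\<^sub>m (k l0) n" if j: "g < j" "j < h" for j
  proof -
    have "Y l0 ! j * J = (Y l0 ! j * \<iota> l0) * Q" using SMn_nth[OF Yd(2) j(2)] \<iota>0 Q_iso by (simp add: J_def mat_assoc)
    thus ?thesis unfolding Yj\<iota>[OF l0 j] using Q_iso by (simp add: mat_zero_mult)
  qed
  \<comment> \<open>For the first g entries the off-diagonal block vanishes by extremality; for the
    others rigidity already gives the equation.\<close>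
  have "Y l0 ! j * J = J * pad g h n X ! j" if j: "j < h" for j
  proof (cases "j < g")
    case True
    have "Y l0 ! j * J = J * (transpose_mat J * (Y l0 ! j * J))"
      using SMn_nth[OF Yd(2) j]
      by (intro invariant_of_off_diagonal_zero[OF _ _ J JJ]
          off_diagonal_zero[OF X ext Yd J JJ conjJ YgJ YjJ _ _ True])
    thus ?thesis unfolding JYJ[OF j] .
  next
    case False
    thus ?thesis
      using j YgJ YjJ[of j] J by (cases "j = g") (auto simp: pad_nth[OF SMnD(1)[OF X]] mat_mult_one mat_mult_zero)
  qed
  thus "embeds h n (k l0) (pad g h n X) (Y l0)" unfolding embeds_def using J JJ by blast
qed

text \<open>One direction holds because combinations from G are combinations from D, and
  \<open>embeds\<close> is the same condition for both.\<close>

lemma extreme_G_iff_extreme_D: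
  assumes X: "X \<in> SMn g n"
  shows "pad g h n X \<in> free_extreme_points h G \<longleftrightarrow> pad g h n X \<in> free_extreme_points h D"
proof
  assume ext: "pad g h n X \<in> free_extreme_points h D"
  have "mconv_data h D n m k V Y" if "mconv_data h G n m k V Y" for m k V Y
    using that G_iff unfolding mconv_data_def by blast
  thus "pad g h n X \<in> free_extreme_points h G"
    using ext pad_mem_G[OF X] unfolding extreme_D_iff[OF X] extreme_G_iff[OF X] by blast
qed (rule extreme_G_imp_extreme_D[OF X])

section \<open>The set K\<close>

abbreviation K where "K \<equiv> {X. \<exists>n. X \<in> SMn g n \<and> pad g h n X \<in> G}"

lemma K_iff: "X \<in> SMn g n \<Longrightarrow> X \<in> K \<longleftrightarrow> pad g h n X \<in> D"
  using pad_mem_G SMn_size_unique[OF _ _ g] by blast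

lemma compression_closed_K: "compression_closed g K"
  unfolding compression_closed_def
proof (intro allI ballI impI)
  fix k n X and V :: "real mat"
  assume X: "X \<in> K \<inter> SMn g k" and V: "V \<in> carrier_mat k n" "1 \<le> n" "transpose_mat V * V = 1\<^sub>m n"
  have "pad g h k X \<in> D" using X K_iff by blast
  hence "pad g h n (conj_tuple V X) \<in> D"
    using free_spec_conj_closed[OF h A _ pad_SMn[OF _ gh] V(1,3,2), of X] conj_tuple_pad[OF _ gh V(1,3,2), of X] X by auto
  thus "conj_tuple V X \<in> K" using K_iff[OF conj_tuple_SMn[OF _ V(1,2), of X]] X by blast
qed

text \<open>Every point of G is padded, and padding is injective, commutes with combinations and
  respects embeddings. So the combinations that represent X and its padding correspond to each other
  with the same coefficients.\<close>

lemma extreme_K_iff_extreme_G: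
  assumes X: "X \<in> SMn g n"
  shows "X \<in> free_extreme_points g K \<longleftrightarrow> pad g h n X \<in> free_extreme_points h G"
proof -
  note n = SMnD(2)[OF X]
  have KS: "\<exists>p. Z \<in> SMn g p" if "Z \<in> K" for Z using that by blast
  have extK: "X \<in> free_extreme_points g K \<longleftrightarrow> X \<in> K \<and>
    (\<forall>m k V Y. mconv_data g K n m k V Y \<and> (\<forall>l<m. V l \<noteq> 0\<^sub>m (k l) n) \<and> X = mconv_value g n m V Y \<longrightarrow>
      (\<forall>l<m. embeds g n (k l) X (Y l)))"
    by (rule free_extreme_points_iff[OF g X compression_closed_K KS])
  have data: "mconv_data h G n m k V (\<lambda>l. pad g h (k l) (Y l))" if "mconv_data g K n m k V Y" for m k V Y
    using that K_iff pad_mem_G pad_SMn[OF _ gh] unfolding mconv_data_def by blast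
  show ?thesis
    unfolding extreme_G_iff[OF X] extK K_iff[OF X] pad_mem_G[OF X]
  proof (rule conj_cong[OF refl], rule iffI; intro allI impI; elim conjE)
    fix m k V Y l
    assume ext: "\<forall>m k V Y. mconv_data g K n m k V Y \<and> (\<forall>l<m. V l \<noteq> 0\<^sub>m (k l) n) \<and> X = mconv_value g n m V Y \<longrightarrow>
        (\<forall>l<m. embeds g n (k l) X (Y l))"
      and V: "mconv_data h G n m k V Y" "\<forall>l<m. V l \<noteq> 0\<^sub>m (k l) n" "pad g h n X = mconv_value h n m V Y" and l: "l < m"
    note dat = mconv_dataD[OF V(1)]
    have "\<exists>Z. Z \<in> SMn g (k l) \<and> Y l = pad g h (k l) Z" if l: "l < m" for l
    proof -
      obtain k' Z where Z: "Z \<in> SMn g k'" "Y l = pad g h k' Z" using dat(1)[OF l] G_iff by blast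
      have "k' = k l" using SMn_size_unique[OF pad_SMn[OF Z(1) gh] _ h] dat(2)[OF l] Z(2) by simp
      thus ?thesis using Z by blast
    qed
    then obtain Z where Z: "\<And>l. l < m \<Longrightarrow> Z l \<in> SMn g (k l)" "\<And>l. l < m \<Longrightarrow> Y l = pad g h (k l) (Z l)" by metis
    have dZ: "mconv_data g K n m k V Z"
      unfolding mconv_data_def
    proof (intro conjI allI impI)
      fix l assume l: "l < m"
      have "pad g h (k l) (Z l) \<in> D" using dat(1)[OF l] Z(2)[OF l] G_iff by simp
      thus "Z l \<in> K \<inter> SMn g (k l)" using K_iff[OF Z(1)[OF l]] Z(1)[OF l] by blast
      show "V l \<in> carrier_mat (k l) n" by (rule dat(3)[OF l])
    qed (rule dat(4))
    have "pad g h n X = mconv_value h n m V (\<lambda>l. pad g h (k l) (Z l))"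
      unfolding V(3) by (rule mconv_value_cong) (rule Z(2))
    also have "\<dots> = pad g h n (mconv_value g n m V Z)"
      by (rule mconv_value_pad[OF dZ gh n data[OF dZ]])
    finally have "X = mconv_value g n m V Z"
      using SMnD(1)[OF X] SMnD(1)[OF mconv_value_SMn[OF dZ n]] by (simp add: pad_inj)
    hence "embeds g n (k l) X (Z l)" using ext dZ V(2) l by blast
    thus "embeds h n (k l) (pad g h n X) (Y l)" unfolding Z(2)[OF l] embeds_pad[OF X Z(1)[OF l] gh] .
  next
    fix m k V Y l
    assume ext: "\<forall>m k V Y. mconv_data h G n m k V Y \<and> (\<forall>l<m. V l \<noteq> 0\<^sub>m (k l) n) \<and> pad g h n X = mconv_value h n m V Y \<longrightarrow>
        (\<forall>l<m. embeds h n (k l) (pad g h n X) (Y l))"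
      and V: "mconv_data g K n m k V Y" "\<forall>l<m. V l \<noteq> 0\<^sub>m (k l) n" "X = mconv_value g n m V Y" and l: "l < m"
    have "pad g h n X = mconv_value h n m V (\<lambda>l. pad g h (k l) (Y l))"
      unfolding mconv_value_pad[OF V(1) gh n data[OF V(1)]] V(3)[symmetric] ..
    hence "embeds h n (k l) (pad g h n X) (pad g h (k l) (Y l))" using ext data[OF V(1)] V(2) l by blast
    thus "embeds g n (k l) X (Y l)" unfolding embeds_pad[OF X mconv_dataD(2)[OF V(1) l] gh] .
  qed
qed

lemma free_spectrahedron_K: "is_free_spectrahedron g K"
proof -
  obtain d' C where C: "C \<in> SMn g d'" and iff: "\<And>n X. X \<in> SMn g n \<Longrightarrow> pad g h n X \<in> D \<longleftrightarrow> X \<in> free_spec g d' C"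
    using free_spectrahedron_pad by blast
  have "X \<in> K \<longleftrightarrow> X \<in> free_spec g d' C" for X
  proof (cases "\<exists>n. X \<in> SMn g n")
    case True
    then obtain n where "X \<in> SMn g n" by blast
    thus ?thesis using K_iff iff by blast
  next
    case False
    thus ?thesis using free_spec_SMn by blast
  qed
  hence "K = free_spec g d' C" by blast
  thus ?thesis unfolding is_free_spectrahedron_def using C by blast
qed

lemma bounded_K:
  assumes "bounded_mat_set h D"
  shows "bounded_mat_set g K"
proof -
  have "K = {X. \<exists>n. X \<in> SMn g n \<and> pad g h n X \<in> D}" using pad_mem_G by blast
  thus ?thesis using bounded_pad[OF assms] by simp
qed

end

theorem theorem4p4:
  fixes g h d :: nat
    and A :: "real mat list"
    and F :: "real vec set"
    and K :: "real mat list set"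
  assumes "1 \<le> g" and "g < h"
    and "A \<in> SMn h d"
    and "bounded_mat_set h (free_spec h d A)"
    and "is_face (level_one h (free_spec h d A)) F"
    and "has_dim h F g"
    and "standard_position h g (level_one h (free_spec h d A)) F"
    and "K = {X. \<exists>n. X \<in> SMn g n \<and> pad g h n X \<in> graded_lift h (free_spec h d A) F}"
  shows "bounded_mat_set g K \<and> is_free_spectrahedron g K \<and>
    (\<forall>n. \<forall>X \<in> SMn g n.
      (X \<in> free_extreme_points g K \<longleftrightarrow>
         pad g h n X \<in> free_extreme_points h (graded_lift h (free_spec h d A) F)) \<and>
      (pad g h n X \<in> free_extreme_points h (graded_lift h (free_spec h d A) F) \<longleftrightarrow>
         pad g h n X \<in> free_extreme_points h (free_spec h d A)))"
proof -
  interpret standard_face g h d A F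
    by standard (use assms in auto)
  show ?thesis
    unfolding assms(8)
    using bounded_K[OF assms(4)] free_spectrahedron_K extreme_K_iff_extreme_G extreme_G_iff_extreme_D by blast
qed

end
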